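(* Let $G$ be a finite group. Then $G\in\mathcal{A}_3$ if and only if either $G\cong S_3$, or $|G|$ is even and for every involution $x\in G$ and every element $y\in G$, the subgroup $\langle x,y\rangle$ is isomorphic to one of the following groups: $$\mathbb{Z}_2,\ \mathbb{Z}_2^2,\ \mathbb{Z}_4,\ \mathbb{Z}_6,\ \mathbb{Z}_2\times\mathbb{Z}_4,\ \mathbb{Z}_2\times\mathbb{Z}_6,\ A_4.$$
   Context: For a finite group $G$ and a subset $S\subseteq G$ with $S=S^{-1}$ and $1\notin S$, the Cayley graph $\mathrm{Cay}(G,S)$ is the graph with vertex set $G$ and edge set $\{\{g,sg\}: g\in G,\ s\in S\}$ (it need not be connected; it is regular of valency $|S|$). A graph is integral if all eigenvalues of its adjacency matrix are integers. $\mathcal{A}_3$ is the class of finite groups all of whose Cayley graphs of valency $3$ are integral, with the convention that groups of odd order (which have no Cayley graph of valency $3$) do not belong to $\mathcal{A}_3$. Explicitly: $G\in\mathcal{A}_3$ if and only if $|G|$ is even and $\mathrm{Cay}(G,S)$ is integral for every $S\subseteq G$ with $S=S^{-1}$, $1\notin S$, $|S|=3$ (so $\mathbb{Z}_2$ belongs to $\mathcal{A}_3$ vacuously). An involution is an element of order $2$. $S_3$ is the symmetric group of degree 3 and $A_4$ the alternating group of degree 4. *)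

theory Defs
  imports
    "HOL-Algebra.Algebra"
    "Graph_Theory.Pair_Digraph"
    "Jordan_Normal_Form.Char_Poly"
begin

text \<open>
  Undirected graphs are represented, as in the Graph Theory library, by symmetric digraphs
  (locale \<^locale>\<open>pair_graph\<close>), an edge \<open>{u, v}\<close> being the pair of arcs \<open>(u, v)\<close> and \<open>(v, u)\<close>.
\<close>

definition cayley_graph :: "('a, 'b) monoid_scheme \<Rightarrow> 'a set \<Rightarrow> 'a pair_pre_digraph" where
  "cayley_graph G S =
     \<lparr>pverts = carrier G, parcs = {(g, s \<otimes>\<^bsub>G\<^esub> g) | g s. g \<in> carrier G \<and> s \<in> S}\<rparr>"

definition connection_set :: "('a, 'b) monoid_scheme \<Rightarrow> 'a set \<Rightarrow> bool" where
  "connection_set G S \<longleftrightarrow> S \<subseteq> carrier G \<and> set_inv\<^bsub>G\<^esub> S = S \<and> \<one>\<^bsub>G\<^esub> \<notin> S"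

lemma pair_graph_cayley_graph:
  assumes "group G" "finite (carrier G)" "connection_set G S"
  shows "pair_graph (cayley_graph G S)"
proof -
  interpret group G by fact
  have S: "S \<subseteq> carrier G" "set_inv\<^bsub>G\<^esub> S = S" "\<one>\<^bsub>G\<^esub> \<notin> S"
    using assms(3) by (auto simp: connection_set_def)
  have inv_S: "inv\<^bsub>G\<^esub> s \<in> S" if "s \<in> S" for s
    using S(2) that by (auto simp: SET_INV_def)
  have sub: "parcs (cayley_graph G S) \<subseteq> carrier G \<times> carrier G"
    using S(1) by (auto simp: cayley_graph_def)
  have fin: "finite (parcs (cayley_graph G S))"
    by (rule finite_subset[OF sub]) (use assms(2) in auto)
  have sym: "sym (parcs (cayley_graph G S))"
  proof (rule symI)
    fix u v assume "(u, v) \<in> parcs (cayley_graph G S)"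
    then obtain s where s: "u \<in> carrier G" "s \<in> S" "v = s \<otimes>\<^bsub>G\<^esub> u"
      by (auto simp: cayley_graph_def)
    have sc: "s \<in> carrier G" using s(2) S(1) by auto
    have "u = inv\<^bsub>G\<^esub> s \<otimes>\<^bsub>G\<^esub> v" "v \<in> carrier G"
      using s sc by (auto simp: m_assoc[symmetric])
    then show "(v, u) \<in> parcs (cayley_graph G S)"
      using inv_S[OF s(2)] by (auto simp: cayley_graph_def)
  qed
  have no_loop: "fst e \<noteq> snd e" if "e \<in> parcs (cayley_graph G S)" for e
  proof
    assume eq: "fst e = snd e"
    from that obtain g s where g: "e = (g, s \<otimes>\<^bsub>G\<^esub> g)" "g \<in> carrier G" "s \<in> S"
      by (auto simp: cayley_graph_def)
    then have "s \<otimes>\<^bsub>G\<^esub> g = g" "s \<in> carrier G" using eq S(1) by auto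
    then have "s = \<one>\<^bsub>G\<^esub>" using g(2) by (metis r_cancel_one')
    then show False using g(3) S(3) by simp
  qed
  show ?thesis
  proof
    show "finite (pverts (cayley_graph G S))" using assms(2) by (simp add: cayley_graph_def)
    show "finite (parcs (cayley_graph G S))" by (rule fin)
    show "symmetric (with_proj (cayley_graph G S))"
      using sym by (simp add: symmetric_def arcs_ends_def arc_to_ends_def)
  next
    fix e assume e: "e \<in> parcs (cayley_graph G S)"
    show "fst e \<in> pverts (cayley_graph G S)" "snd e \<in> pverts (cayley_graph G S)"
      using subsetD[OF sub e] by (auto simp: mem_Times_iff cayley_graph_def)
    show "fst e \<noteq> snd e" using no_loop[OF e] .
  qed
qed

text \<open>
  Matrices are indexed by natural numbers, so an adjacency matrix is taken with respect to an
  enumeration of the vertices. Different enumerations give similar matrices, hence the same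
  eigenvalues, and every finite vertex set has an enumeration.
\<close>

definition adjacency_matrix :: "'a pair_pre_digraph \<Rightarrow> 'a list \<Rightarrow> complex mat" where
  "adjacency_matrix H vs =
     mat (length vs) (length vs) (\<lambda>(i, j). if (vs ! i, vs ! j) \<in> parcs H then 1 else 0)"

definition integral_graph :: "'a pair_pre_digraph \<Rightarrow> bool" where
  "integral_graph H \<longleftrightarrow>
     (\<forall>vs k. distinct vs \<and> set vs = pverts H \<and> eigenvalue (adjacency_matrix H vs) k \<longrightarrow> k \<in> \<int>)"

definition class_A3 :: "('a, 'b) monoid_scheme \<Rightarrow> bool" where
  "class_A3 G \<longleftrightarrow> group G \<and> finite (carrier G) \<and> even (Coset.order G) \<and>
     (\<forall>S. connection_set G S \<and> card S = 3 \<longrightarrow> integral_graph (cayley_graph G S))"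

abbreviation generated_subgroup :: "('a, 'b) monoid_scheme \<Rightarrow> 'a set \<Rightarrow> ('a, 'b) monoid_scheme"
  where "generated_subgroup G A \<equiv> G\<lparr>carrier := generate G A\<rparr>"

end

theory Submission
  imports Defs
begin

text \<open>
  An eigenvalue of a Cayley graph is an eigenvalue of the operator
  \<open>f \<mapsto> (g \<mapsto> \<Sum>s\<in>S. f (s g))\<close> on complex functions, so a nonzero \<open>f\<close> annihilated by a quadratic
  polynomial without integer roots in this operator shows that the graph is not integral.
  Applied to suitable \<open>S\<close> and \<open>f\<close>, this limits the orders of elements and forces two noncommuting
  involutions to generate a copy of \<open>S\<^sub>3\<close>, which then has to be the whole group. If all
  involutions commute, it remains to consider an involution \<open>x\<close> and an element \<open>y\<close> that does not
  commute with it; then \<open>y\<close> has order 3, the product of the three conjugates of \<open>x\<close> under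
  \<open>y\<close> is trivial, and \<open>\<langle>x, y\<rangle>\<close> is \<open>A\<^sub>4\<close>. Conversely, the spectra of the cubic Cayley graphs of the
  listed groups are computed by splitting an eigenfunction with respect to the involutions.
\<close>

subsection \<open>Integral Cayley graphs in terms of eigenfunctions\<close>

text \<open>Apart from the bounds on element orders, each obstruction comes from a small
  representation in which the three connection elements add up to an operator with an irrational
  quadratic eigenvalue; the non-squares responsible are 2, 3, 5 and 17. A function living in that
  representation is obtained by applying factors such as \<open>1 - c\<close> or
  \<open>1 + c\<close> to the point mass at the identity, and it is nonzero as soon as its value
  there is. A recurring mechanism is unequal weights: three distinct elements turn into
  \<open>2 x + z\<close> or \<open>x + 2 y\<close> once some subgroup acts trivially. Two
  noncommuting involutions exhaust the group because every conjugate of a reflection is one of the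
  three reflections and only the identity centralises them, which leaves no room beyond the six
  permutations of the reflections. When involutions commute, the elements of square 1 form a normal
  subgroup, and its cosets take over the role of single elements in the bound for odd
  orders.\<close>

definition neighbour_sum ::
    "('a, 'b) monoid_scheme \<Rightarrow> 'a set \<Rightarrow> ('a \<Rightarrow> complex) \<Rightarrow> 'a \<Rightarrow> complex" where
  "neighbour_sum G S f g = (\<Sum>s\<in>S. f (s \<otimes>\<^bsub>G\<^esub> g))"

text \<open>Right cancellation makes \<open>s \<mapsto> s g\<close> injective on \<open>S\<close>,
  so summing over connection elements counts each neighbour once, as the 0/1 matrix does.\<close>

lemma adjacency_matrix_mult_vec:
  assumes "group G" "finite (carrier G)" "S \<subseteq> carrier G"
    and vs: "distinct vs" "set vs = carrier G" and i: "i < length vs"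
  shows "(adjacency_matrix (cayley_graph G S) vs *\<^sub>v vec (length vs) (\<lambda>j. f (vs ! j))) $ i
           = neighbour_sum G S f (vs ! i)"
proof -
  interpret group G by fact
  let ?g = "vs ! i"
  have g: "?g \<in> carrier G" using nth_mem[OF i] vs(2) by simp
  have inj: "inj_on (\<lambda>s. s \<otimes>\<^bsub>G\<^esub> ?g) S"
    by (rule inj_onI) (metis assms(3) g right_cancel subsetD)
  have "(adjacency_matrix (cayley_graph G S) vs *\<^sub>v vec (length vs) (\<lambda>j. f (vs ! j))) $ i
      = (\<Sum>j\<in>{..<length vs}. if (?g, vs ! j) \<in> parcs (cayley_graph G S) then f (vs ! j) else 0)"
    using i by (auto simp: adjacency_matrix_def scalar_prod_def atLeast0LessThan intro!: sum.cong)
  also have "\<dots> = (\<Sum>h\<in>carrier G. if (?g, h) \<in> parcs (cayley_graph G S) then f h else 0)"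
    using sum.reindex_bij_betw[OF bij_betw_nth[OF vs(1) refl vs(2)[symmetric]],
        of "\<lambda>h. if (?g, h) \<in> parcs (cayley_graph G S) then f h else 0"] .
  also have "\<dots> = (\<Sum>h\<in>(\<lambda>s. s \<otimes>\<^bsub>G\<^esub> ?g) ` S. f h)"
  proof (rule sum.mono_neutral_cong_right)
    show "finite (carrier G)" by fact
    show "(\<lambda>s. s \<otimes>\<^bsub>G\<^esub> ?g) ` S \<subseteq> carrier G" using assms(3) g by auto
    show "\<forall>h\<in>carrier G - (\<lambda>s. s \<otimes>\<^bsub>G\<^esub> ?g) ` S.
        (if (?g, h) \<in> parcs (cayley_graph G S) then f h else 0) = 0"
      using g by (auto simp: cayley_graph_def)
    fix h assume "h \<in> (\<lambda>s. s \<otimes>\<^bsub>G\<^esub> ?g) ` S"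
    then show "(if (?g, h) \<in> parcs (cayley_graph G S) then f h else 0) = f h"
      using g by (auto simp: cayley_graph_def)
  qed
  also have "\<dots> = neighbour_sum G S f ?g"
    unfolding neighbour_sum_def
    by (subst sum.reindex[OF inj]) simp
  finally show ?thesis .
qed

lemma integral_cayley_graph_iff:
  assumes "group G" "finite (carrier G)" "S \<subseteq> carrier G"
  shows "integral_graph (cayley_graph G S) \<longleftrightarrow>
    (\<forall>f k. (\<exists>g\<in>carrier G. f g \<noteq> 0) \<longrightarrow>
       (\<forall>g\<in>carrier G. neighbour_sum G S f g = k * f g) \<longrightarrow> k \<in> \<int>)"
    (is "?L \<longleftrightarrow> ?R")
proof
  assume L: ?L
  show ?R
  proof (intro allI impI)
    fix f k assume nz: "\<exists>g\<in>carrier G. f g \<noteq> 0"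
      and ev: "\<forall>g\<in>carrier G. neighbour_sum G S f g = k * f g"
    obtain vs where vs: "distinct vs" "set vs = carrier G"
      using finite_distinct_list[OF assms(2)] by auto
    let ?v = "vec (length vs) (\<lambda>j. f (vs ! j))" and ?A = "adjacency_matrix (cayley_graph G S) vs"
    have "?A *\<^sub>v ?v = k \<cdot>\<^sub>v ?v"
    proof
      show "dim_vec (?A *\<^sub>v ?v) = dim_vec (k \<cdot>\<^sub>v ?v)" by (simp add: adjacency_matrix_def)
      fix i assume "i < dim_vec (k \<cdot>\<^sub>v ?v)"
      then have i: "i < length vs" by simp
      then have "vs ! i \<in> carrier G" using nth_mem[OF i] vs(2) by simp
      then show "(?A *\<^sub>v ?v) $ i = (k \<cdot>\<^sub>v ?v) $ i"
        using adjacency_matrix_mult_vec[OF assms vs i, of f] ev i by simp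
    qed
    moreover have "?v \<noteq> 0\<^sub>v (length vs)"
    proof
      assume z: "?v = 0\<^sub>v (length vs)"
      obtain g where g: "g \<in> carrier G" "f g \<noteq> 0" using nz by auto
      then obtain i where i: "i < length vs" "vs ! i = g" using vs by (metis in_set_conv_nth)
      then have "?v $ i = f g" by simp
      then show False using z g i by simp
    qed
    ultimately have "eigenvalue ?A k"
      by (auto simp: eigenvalue_def eigenvector_def adjacency_matrix_def intro!: exI[of _ ?v])
    then show "k \<in> \<int>" using L vs by (auto simp: integral_graph_def cayley_graph_def)
  qed
next
  assume R: ?R
  show ?L unfolding integral_graph_def
  proof (intro allI impI, elim conjE)
    fix vs k assume vs: "distinct vs" "set vs = pverts (cayley_graph G S)"
      and "eigenvalue (adjacency_matrix (cayley_graph G S) vs) k"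
    then obtain v where v: "v \<in> carrier_vec (length vs)" "v \<noteq> 0\<^sub>v (length vs)"
      "adjacency_matrix (cayley_graph G S) vs *\<^sub>v v = k \<cdot>\<^sub>v v"
      by (auto simp: eigenvalue_def eigenvector_def adjacency_matrix_def)
    have vs2: "set vs = carrier G" using vs by (simp add: cayley_graph_def)
    \<comment> \<open>The vector is read as a function through the inverse of the enumeration. Its
      values outside the carrier are arbitrary, which is harmless because neighbours stay
      inside.\<close>
    define f where "f g = v $ (the_inv_into {..<length vs} ((!) vs) g)" for g
    have f: "f (vs ! i) = v $ i" if "i < length vs" for i
      unfolding f_def using that vs(1)
      by (subst the_inv_into_f_f) (auto simp: inj_on_nth)
    have veq: "v = vec (length vs) (\<lambda>j. f (vs ! j))"
      using v(1) f by auto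
    have "\<exists>i<length vs. v $ i \<noteq> 0"
    proof (rule ccontr)
      assume "\<not> ?thesis"
      then have "v = 0\<^sub>v (length vs)" using v(1) by (intro eq_vecI) auto
      then show False using v(2) by simp
    qed
    then obtain i where "i < length vs" "f (vs ! i) \<noteq> 0" using f by metis
    then have nz: "\<exists>g\<in>carrier G. f g \<noteq> 0" using nth_mem[of i vs] unfolding vs2 by blast
    have "neighbour_sum G S f g = k * f g" if g: "g \<in> carrier G" for g
    proof -
      obtain i where i: "i < length vs" "vs ! i = g"
        using g vs2 by (metis in_set_conv_nth)
      have "neighbour_sum G S f g = (adjacency_matrix (cayley_graph G S) vs *\<^sub>v v) $ i"
        unfolding i(2)[symmetric] adjacency_matrix_mult_vec[OF assms vs(1) vs2 i(1), of f, symmetric]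
          veq[symmetric] by (rule refl)
      also have "\<dots> = k * f g" using v(1,3) i f[OF i(1)] by simp
      finally show ?thesis .
    qed
    then show "k \<in> \<int>" using R nz by blast
  qed
qed

text \<open>Rules out the integer roots of the quadratics met below: after completing the square
  they ask for 2, 3, 5 or 17 to be a square.\<close>

lemma not_between_squares:
  fixes k m t :: int
  assumes "0 \<le> m" "m * m < t" "t < (m + 1) * (m + 1)"
  shows "k * k \<noteq> t"
proof
  assume "k * k = t"
  then have "\<bar>k\<bar> * \<bar>k\<bar> = t" by simp
  moreover have "\<bar>k\<bar> \<le> m \<or> m + 1 \<le> \<bar>k\<bar>" by linarith
  then have "\<bar>k\<bar> * \<bar>k\<bar> \<le> m * m \<or> (m + 1) * (m + 1) \<le> \<bar>k\<bar> * \<bar>k\<bar>"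
    using assms(1) mult_mono[of "\<bar>k\<bar>" m "\<bar>k\<bar>" m] mult_mono[of "m + 1" "\<bar>k\<bar>" "m + 1" "\<bar>k\<bar>"]
    by linarith
  ultimately show False using assms by linarith
qed

text \<open>Cancellation in the shape that survives \<open>m_assoc\<close>: once words are bracketed
  to the right, instances of this rule simplify them.\<close>

lemma (in group) cancel_left_pair:
  "\<lbrakk>a \<otimes> b = \<one>; a \<in> carrier G; b \<in> carrier G; g \<in> carrier G\<rbrakk> \<Longrightarrow> a \<otimes> (b \<otimes> g) = g"
  by (metis m_assoc l_one)

lemma (in group) one_pair_commute:
  "\<lbrakk>a \<otimes> b = \<one>; a \<in> carrier G; b \<in> carrier G\<rbrakk> \<Longrightarrow> b \<otimes> a = \<one>"
  using inv_comm by blast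

lemma (in group) connection_set_inverse_pair:
  assumes "x \<in> carrier G" "y \<in> carrier G" "y' \<in> carrier G"
    and "x \<otimes> x = \<one>" "x \<noteq> \<one>" "y \<otimes> y' = \<one>" "y \<noteq> y'"
  shows "connection_set G {x, y, y'}" "card {x, y, y'} = 3"
proof -
  have y'y: "y' \<otimes> y = \<one>" using assms one_pair_commute by blast
  have i: "inv x = x" "inv y = y'" "inv y' = y"
    using assms y'y by (auto intro: inv_equality)
  \<comment> \<open>\<open>x\<close> is its own inverse, whereas \<open>y\<close> and
    \<open>y'\<close> are exchanged by inversion and differ.\<close>
  then have ne: "x \<noteq> y" "x \<noteq> y'" using assms(7) by metis+
  then show "card {x, y, y'} = 3" using assms by simp
  have "y \<noteq> \<one>" "y' \<noteq> \<one>" using assms y'y by auto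
  then show "connection_set G {x, y, y'}"
    using assms i by (auto simp: connection_set_def SET_INV_def)
qed

lemma (in group) connection_set_involutions:
  assumes "x \<in> carrier G" "y \<in> carrier G" "z \<in> carrier G"
    and "x \<otimes> x = \<one>" "x \<noteq> \<one>" "y \<otimes> y = \<one>" "y \<noteq> \<one>" "z \<otimes> z = \<one>" "z \<noteq> \<one>"
    and "x \<noteq> y" "x \<noteq> z" "y \<noteq> z"
  shows "connection_set G {x, y, z}" "card {x, y, z} = 3"
proof -
  have i: "inv x = x" "inv y = y" "inv z = z"
    using assms by (auto intro: inv_equality)
  then show "connection_set G {x, y, z}"
    using assms by (auto simp: connection_set_def SET_INV_def)
  show "card {x, y, z} = 3" using assms by simp
qed

section \<open>Certificates for a non-integral eigenvalue\<close>

locale A3_group = group G for G (structure) +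
  assumes class_A3: "class_A3 G"
begin

lemma finite_carrier [simp]: "finite (carrier G)"
  using class_A3 by (simp add: class_A3_def)

lemma even_order: "even (Coset.order G)"
  using class_A3 by (simp add: class_A3_def)

lemma eigenvalue_in_Ints:
  assumes S: "connection_set G S" "card S = 3"
    and "g0 \<in> carrier G" "f g0 \<noteq> 0"
    and "\<And>g. g \<in> carrier G \<Longrightarrow> neighbour_sum G S f g = k * f g"
  shows "k \<in> \<int>"
proof -
  have "integral_graph (cayley_graph G S)" using class_A3 S by (auto simp: class_A3_def)
  moreover have "S \<subseteq> carrier G" using S by (auto simp: connection_set_def)
  ultimately show ?thesis
    using integral_cayley_graph_iff[OF is_group finite_carrier, of S] assms by blast
qed

text \<open>Over the complex numbers the quadratic in the adjacency operator \<open>A\<close>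
  factors as \<open>(A - r) (A - r')\<close>. Either \<open>(A - r') f\<close> is nonzero and is an
  eigenfunction for \<open>r\<close>, or \<open>f\<close> itself is one for \<open>r'\<close>. Hence
  later arguments only have to establish a relation for \<open>f\<close>, not to find an
  eigenfunction.\<close>

lemma quadratic_has_root_in_Ints:
  fixes p q :: int
  assumes S: "connection_set G S" "card S = 3"
    and g0: "g0 \<in> carrier G" "f g0 \<noteq> 0"
    and quad: "\<And>g. g \<in> carrier G \<Longrightarrow>
      neighbour_sum G S (neighbour_sum G S f) g = of_int p * neighbour_sum G S f g + of_int q * f g"
  shows "\<exists>k::int. k * k = p * k + q"
proof -
  let ?A = "neighbour_sum G S"
  define d :: complex where "d = csqrt (of_int (p * p + 4 * q))"
  define r where "r = (of_int p + d) / 2"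
  define r' where "r' = (of_int p - d) / 2"
  have dd: "d * d = of_int (p * p + 4 * q)"
    unfolding d_def by (metis power2_csqrt power2_eq_square)
  have sum: "of_int p = r + r'" by (simp add: r_def r'_def field_simps)
  have rr: "r * r = of_int p * r + of_int q"
    using dd by (simp add: r_def field_simps)
  have rr': "r' * r' = of_int p * r' + of_int q"
    using dd by (simp add: r'_def field_simps)
  have prod: "of_int q = - (r * r')" using rr sum by (simp add: algebra_simps eq_neg_iff_add_eq_0)
  have "r \<in> \<int> \<or> r' \<in> \<int>"
  proof (cases "\<exists>g\<in>carrier G. ?A f g \<noteq> r' * f g")
    case True
    then obtain g1 where g1: "g1 \<in> carrier G" "?A f g1 - r' * f g1 \<noteq> 0" by auto
    have "?A (\<lambda>g. ?A f g - r' * f g) g = r * (?A f g - r' * f g)" if "g \<in> carrier G" for g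
    proof -
      have "?A (\<lambda>g. ?A f g - r' * f g) g = ?A (?A f) g - r' * ?A f g"
        by (simp add: neighbour_sum_def sum_subtractf sum_distrib_left)
      also have "\<dots> = r * (?A f g - r' * f g)"
        using quad[OF that] sum prod by (simp add: algebra_simps)
      finally show ?thesis .
    qed
    then show ?thesis using eigenvalue_in_Ints[OF S g1(1), of "\<lambda>g. ?A f g - r' * f g" r] g1 by auto
  next
    case False
    then show ?thesis using eigenvalue_in_Ints[OF S g0(1), of f r'] g0(2) by auto
  qed
  then obtain k :: int where "(of_int k :: complex) * of_int k = of_int p * of_int k + of_int q"
    using rr rr' by (auto elim!: Ints_cases)
  then have "(of_int (k * k) :: complex) = of_int (p * k + q)" by simp
  then show ?thesis by (metis of_int_eq_iff)
qed

end

subsection \<open>Element orders\<close>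

text \<open>The crystallographic restriction. For \<open>n > 2\<close> the angle lies strictly
  between 0 and pi, so the integer is -1, 0 or 1, and injectivity of the cosine on that range
  identifies the angle with the one for 3, 4 or 6.\<close>

lemma two_cos_in_Ints_imp:
  fixes n :: nat
  assumes "n > 0" "2 * cos (2 * pi / n) \<in> \<int>"
  shows "n \<in> {1, 2, 3, 4, 6}"
proof (cases "n \<le> 2")
  case True
  then show ?thesis using assms(1) by auto
next
  case False
  let ?t = "2 * pi / real n"
  have t: "0 < ?t" "?t < pi" using False pi_gt_zero by (auto simp: field_simps)
  obtain k :: int where k: "2 * cos ?t = of_int k" using assms(2) by (auto elim: Ints_cases)
  have "-1 < cos ?t" "cos ?t < 1"
    using t cos_monotone_0_pi[of 0 ?t] cos_monotone_0_pi[of ?t pi] by auto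
  then have "-2 < k" "k < 2" using k by linarith+
  then have "k \<in> {-1, 0, 1}" by auto
  then have "cos ?t \<in> {cos (2 * pi / 3), cos (2 * pi / 4), cos (2 * pi / 6)}"
    using k cos_60 cos_120 by (auto simp: cos_pi_half)
  then obtain m where m: "m \<in> {3, 4, 6 :: real}" "cos ?t = cos (2 * pi / m)" by blast
  have "0 \<le> 2 * pi / m" "2 * pi / m \<le> pi" using m(1) pi_gt_zero by auto
  then have "?t = 2 * pi / m"
    using cos_inj_pi[OF less_imp_le[OF t(1)] less_imp_le[OF t(2)] _ _ m(2)] by simp
  then have "real n = m" using False m(1) by (simp add: frac_eq_eq)
  then show ?thesis using m(1) by auto
qed

context A3_group
begin

text \<open>
  The relation \<open>R g k\<close> says that \<open>g\<close> lies in the \<open>k\<close>-th cell of a partition of part of the group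
  into cells permuted by \<open>x\<close> and \<open>y\<close>; the function \<open>cos (2 \<pi> k / n)\<close> of the cell is then an
  eigenfunction.
\<close>

lemma cyclic_cells_imp:
  fixes R :: "'a \<Rightarrow> int \<Rightarrow> bool" and n :: nat and \<epsilon> :: int
  assumes x: "x \<in> carrier G" "x \<otimes> x = \<one>" "x \<noteq> \<one>"
    and y: "y \<in> carrier G" "y \<otimes> y \<noteq> \<one>"
    and n: "n > 0" and R0: "R \<one> 0"
    and uniq: "\<And>g j k. R g j \<Longrightarrow> R g k \<Longrightarrow> int n dvd j - k"
    and Rx: "\<And>g k. g \<in> carrier G \<Longrightarrow> R g k \<Longrightarrow>
      \<exists>d. R (x \<otimes> g) (k + d) \<and> cos (2 * pi * of_int (k + d) / n) = \<epsilon> * cos (2 * pi * k / n)"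
    and Ry: "\<And>g k. g \<in> carrier G \<Longrightarrow> R g k \<Longrightarrow>
      R (y \<otimes> g) (k + 1) \<and> R (inv y \<otimes> g) (k - 1) \<or> R (y \<otimes> g) (k - 1) \<and> R (inv y \<otimes> g) (k + 1)"
  shows "n \<in> {1, 2, 3, 4, 6}"
proof -
  let ?S = "{x, y, inv y}"
  have yy: "y \<noteq> inv y" using y by (metis r_inv)
  note S = connection_set_inverse_pair[OF x(1) y(1) inv_closed[OF y(1)] x(2,3) r_inv[OF y(1)] yy]
  have ne: "x \<noteq> y" "x \<noteq> inv y"
    using x y yy by (metis, metis inv_equality inv_inv)
  \<comment> \<open>The cell index is only determined modulo \<open>n\<close>, by
    \<open>uniq\<close>, and the cosine does not see the choice. Elements outside all cells get the
    value 0.\<close>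
  define f :: "'a \<Rightarrow> complex" where
    "f g = (if \<exists>k. R g k then of_real (cos (2 * pi * (SOME k. R g k) / n)) else 0)" for g
  have f: "f g = of_real (cos (2 * pi * k / n))" if "R g k" for g k
  proof -
    have "R g (SOME k. R g k)" using that by (rule someI)
    from uniq[OF this that] obtain m where "(SOME k. R g k) - k = int n * m" by (elim dvdE)
    then have "(SOME k. R g k) = k + int n * m" by linarith
    then have "2 * pi * (SOME k. R g k) / n = 2 * pi * k / n + 2 * pi * m"
      using n by (simp add: field_simps)
    then have "cos (2 * pi * (SOME k. R g k) / n) = cos (2 * pi * k / n)"
      by (simp add: cos_add)
    then show ?thesis using that by (auto simp: f_def)
  qed
  define c where "c = \<epsilon> + 2 * cos (2 * pi / n)"
  have "neighbour_sum G ?S f g = of_real c * f g" if g: "g \<in> carrier G" for g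
  proof (cases "\<exists>k. R g k")
    case True
    then obtain k where k: "R g k" by blast
    obtain d where d: "R (x \<otimes> g) (k + d)" "cos (2 * pi * of_int (k + d) / n) = \<epsilon> * cos (2 * pi * k / n)"
      using Rx[OF g k] by blast
    have 1: "f (x \<otimes> g) = of_real (\<epsilon> * cos (2 * pi * k / n))" using f[OF d(1)] d(2) by simp
    \<comment> \<open>Whether \<open>y\<close> moves this element forwards or backwards does not
      matter, since \<open>y\<close> and its inverse enter symmetrically; the addition theorem then
      yields the factor \<open>2 cos (2 pi / n)\<close>.\<close>
    have "f (y \<otimes> g) + f (inv y \<otimes> g)
        = of_real (cos (2 * pi * of_int (k + 1) / n) + cos (2 * pi * of_int (k - 1) / n))"
      using Ry[OF g k]
    proof
      assume "R (y \<otimes> g) (k + 1) \<and> R (inv y \<otimes> g) (k - 1)"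
      then show ?thesis using f[of "y \<otimes> g" "k + 1"] f[of "inv y \<otimes> g" "k - 1"] by (simp only: of_real_add)
    next
      assume "R (y \<otimes> g) (k - 1) \<and> R (inv y \<otimes> g) (k + 1)"
      then show ?thesis using f[of "y \<otimes> g" "k - 1"] f[of "inv y \<otimes> g" "k + 1"]
        by (simp only: of_real_add add.commute)
    qed
    also have "2 * pi * of_int (k + 1) / n = 2 * pi * k / n + 2 * pi / n"
      by (simp add: add_divide_distrib distrib_left)
    also have "2 * pi * of_int (k - 1) / n = 2 * pi * k / n - 2 * pi / n"
      by (simp add: diff_divide_distrib right_diff_distrib)
    finally have 2: "f (y \<otimes> g) + f (inv y \<otimes> g) = of_real (2 * cos (2 * pi / n) * cos (2 * pi * k / n))"
      by (simp add: cos_add cos_diff algebra_simps)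
    have "neighbour_sum G ?S f g = f (x \<otimes> g) + (f (y \<otimes> g) + f (inv y \<otimes> g))"
      using ne yy by (simp add: neighbour_sum_def)
    then show ?thesis unfolding 1 2 f[OF k] c_def by (simp add: algebra_simps)
  next
    \<comment> \<open>No neighbour of \<open>g\<close> lies in a cell either: applying the inverse
      generator would lead from that cell back to \<open>g\<close>.\<close>
    case False
    have nx: "\<not> R (x \<otimes> g) k" for k
      using False Rx[of "x \<otimes> g" k] x g by (auto simp: cancel_left_pair)
    have ny: "\<not> R (y \<otimes> g) k" for k
      using False Ry[of "y \<otimes> g" k] y g by (auto simp: cancel_left_pair[OF l_inv])
    have ny': "\<not> R (inv y \<otimes> g) k" for k
      using False Ry[of "inv y \<otimes> g" k] y g by (auto simp: cancel_left_pair[OF r_inv])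
    have "f h = 0" if "\<And>k. \<not> R h k" for h using that by (simp add: f_def)
    then show ?thesis using False nx ny ny' ne yy by (simp add: neighbour_sum_def)
  qed
  then have "of_real c \<in> (\<int> :: complex set)"
    using eigenvalue_in_Ints[OF S one_closed, of f "of_real c"] f[OF R0] by simp
  then obtain m :: int where "complex_of_real c = of_int m" by (auto elim: Ints_cases)
  then have "complex_of_real c = complex_of_real (of_int m)" by simp
  then have "c = of_int m" by (simp only: of_real_eq_iff)
  then have "2 * cos (2 * pi / n) = of_int (m - \<epsilon>)" by (simp add: c_def)
  then show ?thesis using two_cos_in_Ints_imp[OF n] by (metis Ints_of_int)
qed

lemma ord_pos: "y \<in> carrier G \<Longrightarrow> ord y > 0"
  using ord_ge_1[OF finite_carrier] by fastforce

text \<open>The connection set consists of \<open>y\<close>, its inverse and the involution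
  \<open>y^(n/2)\<close>, with the single elements \<open>y^k\<close> as cells. The involution is a
  half turn and changes the sign of the cosine, so the eigenvalue is
  \<open>2 cos (2 pi / n) - 1\<close>. Order 2 is split off because there \<open>y\<close> equals
  its inverse.\<close>

lemma even_ord_cases:
  assumes y: "y \<in> carrier G" and "even (ord y)"
  shows "ord y \<in> {2, 4, 6}"
proof (cases "ord y = 2")
  case False
  let ?n = "ord y"
  let ?u = "y [^] (?n div 2)"
  have n: "?n > 0" using ord_pos y by simp
  obtain m where m: "?n = 2 * m" "m > 1" using assms(2) False n by (auto elim!: evenE)
  have u: "?u \<in> carrier G" using y by simp
  have "?u \<otimes> ?u = y [^] ?n" using y m by (simp add: nat_pow_mult mult_2)
  then have uu: "?u \<otimes> ?u = \<one>" using y by simp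
  have u1: "?u \<noteq> \<one>" using y m by (simp add: pow_eq_id)
  have "y \<otimes> y = y [^] (2::nat)" using y by (simp add: numeral_2_eq_2)
  then have yy: "y \<otimes> y \<noteq> \<one>" using y m by (auto simp: pow_eq_id dest!: dvd_imp_le)
  have "?n \<in> {1, 2, 3, 4, 6}"
  proof (rule cyclic_cells_imp[where R = "\<lambda>g k. g = y [^] k" and \<epsilon> = "-1", OF u uu u1 y yy n])
    show "\<one> = y [^] (0::int)" by simp
    show "int ?n dvd j - k" if "g = y [^] j" "g = y [^] k" for g and j k :: int
      using that y int_pow_eq by (metis)
  next
    fix g k assume g: "g = y [^] (k::int)"
    have "?u \<otimes> g = y [^] (k + int m)"
      using y m g by (simp add: int_pow_mult[symmetric] add.commute flip: int_pow_int)
    moreover have "2 * pi * (k + int m) / ?n = 2 * pi * k / ?n + pi"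
      using m by (simp add: field_simps)
    ultimately show "\<exists>d. ?u \<otimes> g = y [^] (k + d) \<and>
        cos (2 * pi * of_int (k + d) / ?n) = (-1::int) * cos (2 * pi * k / ?n)"
      by (intro exI[of _ "int m"]) simp
    have "y \<otimes> g = y [^] (k + 1)" "inv y \<otimes> g = y [^] (k - 1)"
      using y g int_pow_mult[of y 1 k] int_pow_mult[of y "-1" k]
      by (simp_all add: int_pow_neg add.commute)
    then show "y \<otimes> g = y [^] (k + 1) \<and> inv y \<otimes> g = y [^] (k - 1) \<or>
        y \<otimes> g = y [^] (k - 1) \<and> inv y \<otimes> g = y [^] (k + 1)" by simp
  qed
  then show ?thesis using assms(2) by auto
qed simp

text \<open>The connection set consists of \<open>x\<close>, the rotation \<open>r = x z\<close> and
  its inverse, and the cells are the pairs \<open>r^k\<close>, \<open>x r^k\<close>. The reflection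
  \<open>x\<close> stays inside each cell, and \<open>r\<close> runs forwards on the first members
  and backwards on the second, because \<open>x\<close> inverts \<open>r\<close>. The eigenvalue is
  \<open>1 + 2 cos (2 pi / n)\<close>.\<close>

lemma ord_product_involutions_cases:
  assumes x: "x \<in> carrier G" "x \<otimes> x = \<one>" and z: "z \<in> carrier G" "z \<otimes> z = \<one>"
    and nc: "x \<otimes> z \<noteq> z \<otimes> x"
  shows "ord (x \<otimes> z) \<in> {3, 4, 6}"
proof -
  let ?r = "x \<otimes> z"
  let ?n = "ord ?r"
  have r: "?r \<in> carrier G" using x z by simp
  have n: "?n > 0" using ord_pos r by simp
  have x1: "x \<noteq> \<one>" using nc x z by auto
  have ix: "inv x = x" "inv z = z" using x z by (auto intro: inv_equality)
  have ir: "inv ?r = z \<otimes> x" using x z ix by (simp add: inv_mult_group)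
  have rr: "?r \<otimes> ?r \<noteq> \<one>"
    using nc ir r by (metis inv_equality)
  have xr: "?r \<otimes> x = x \<otimes> inv ?r" using x z by (simp add: ir m_assoc cancel_left_pair)
  have xr': "inv ?r \<otimes> x = x \<otimes> ?r" using x z by (simp add: ir m_assoc cancel_left_pair)
  \<comment> \<open>The two members of a cell must not meet another cell. As a power of
    \<open>r\<close>, the element \<open>x\<close> would both commute with \<open>r\<close> and
    invert it, making \<open>r\<close> its own inverse.\<close>
  have nx: "x \<noteq> ?r [^] (i::int)" for i
  proof
    assume "x = ?r [^] i"
    then have "x \<otimes> ?r = ?r \<otimes> x" using r by (metis int_pow_mult int_pow_1 add.commute)
    then have "x \<otimes> ?r = x \<otimes> inv ?r" using xr by simp
    then have "?r = inv ?r" using x r by simp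
    then show False using rr r by (metis r_inv)
  qed
  have step: "?r \<otimes> ?r [^] k = ?r [^] (k + 1)" "inv ?r \<otimes> ?r [^] k = ?r [^] (k - 1)" for k :: int
    using r int_pow_mult[of ?r 1 k] int_pow_mult[of ?r "-1" k]
    by (simp_all add: int_pow_neg add.commute)
  let ?R = "\<lambda>g (k::int). g = ?r [^] k \<or> g = x \<otimes> ?r [^] k"
  have "?n \<in> {1, 2, 3, 4, 6}"
  proof (rule cyclic_cells_imp[where R = ?R and \<epsilon> = 1, OF x x1 r rr n])
    show "?R \<one> 0" by simp
    fix g and j k :: int assume "?R g j" "?R g k"
    then consider "?r [^] j = ?r [^] k" | "?r [^] j = x \<otimes> ?r [^] k" | "?r [^] k = x \<otimes> ?r [^] j"
      using x r by auto
    then show "int ?n dvd j - k"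
    proof cases
      case 1
      then show ?thesis using int_pow_eq r by metis
    next
      case 2
      then have "x = ?r [^] (j - k)" using x r by (simp add: int_pow_diff inv_solve_right)
      then show ?thesis using nx by blast
    next
      case 3
      then have "x = ?r [^] (k - j)" using x r by (simp add: int_pow_diff inv_solve_right)
      then show ?thesis using nx by blast
    qed
  next
    fix g and k :: int assume g: "g \<in> carrier G" "?R g k"
    have "?R (x \<otimes> g) k" using g x r by (auto simp: cancel_left_pair)
    then show "\<exists>d. ?R (x \<otimes> g) (k + d) \<and> cos (2 * pi * of_int (k + d) / ?n) = (1::int) * cos (2 * pi * k / ?n)"
      by (intro exI[of _ 0]) simp
    have a: "?r \<otimes> (x \<otimes> h) = x \<otimes> (inv ?r \<otimes> h)" "inv ?r \<otimes> (x \<otimes> h) = x \<otimes> (?r \<otimes> h)"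
      if "h \<in> carrier G" for h
      using xr xr' that x r by (metis m_assoc inv_closed)+
    show "?R (?r \<otimes> g) (k + 1) \<and> ?R (inv ?r \<otimes> g) (k - 1) \<or> ?R (?r \<otimes> g) (k - 1) \<and> ?R (inv ?r \<otimes> g) (k + 1)"
      using g(2)
    proof
      assume "g = ?r [^] k"
      then show ?thesis using step by simp
    next
      assume "g = x \<otimes> ?r [^] k"
      then show ?thesis using step a[of "?r [^] k"] r by simp
    qed
  qed
  moreover have "?n \<noteq> 1" using rr r by (metis ord_eq_1 r_one)
  moreover have "?n \<noteq> 2"
  proof
    assume "?n = 2"
    then have "?r [^] (2::nat) = \<one>" using pow_ord_eq_1[OF r] by metis
    then show False using rr r by (simp add: numeral_2_eq_2)
  qed
  ultimately show ?thesis by auto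
qed

end

subsection \<open>Noncommuting involutions\<close>

lemma neighbour_sum_triple:
  "card {a, b, c} = 3 \<Longrightarrow>
    neighbour_sum G {a, b, c} f g = f (a \<otimes>\<^bsub>G\<^esub> g) + f (b \<otimes>\<^bsub>G\<^esub> g) + f (c \<otimes>\<^bsub>G\<^esub> g)"
  unfolding neighbour_sum_def
  by (cases "a = b"; cases "a = c"; cases "b = c") (auto simp: add.assoc card_insert_if)

context group
begin

abbreviation involution :: "'a \<Rightarrow> bool" where
  "involution x \<equiv> x \<in> carrier G \<and> x \<otimes> x = \<one> \<and> x \<noteq> \<one>"

lemma inv_involution: "\<lbrakk>x \<in> carrier G; x \<otimes> x = \<one>\<rbrakk> \<Longrightarrow> inv x = x"
  by (rule inv_equality)

lemma involution_mult:
  assumes "involution x" "involution y" "x \<otimes> y = y \<otimes> x" "x \<noteq> y"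
  shows "involution (x \<otimes> y)"
proof -
  have "x \<otimes> y \<otimes> (x \<otimes> y) = x \<otimes> y \<otimes> (y \<otimes> x)" using assms by simp
  also have "\<dots> = \<one>" using assms(1,2) by (simp add: m_assoc cancel_left_pair)
  finally have "x \<otimes> y \<otimes> (x \<otimes> y) = \<one>" .
  moreover have "x \<otimes> y \<noteq> \<one>" using assms by (metis inv_equality inv_involution)
  ultimately show ?thesis using assms by simp
qed

lemma involution_conj:
  assumes "involution x" "g \<in> carrier G"
  shows "involution (g \<otimes> x \<otimes> inv g)"
proof -
  have "g \<otimes> x \<otimes> inv g \<otimes> (g \<otimes> x \<otimes> inv g) = \<one>"
    using assms by (simp add: m_assoc cancel_left_pair cancel_left_pair[OF l_inv])
  moreover have "g \<otimes> x \<otimes> inv g \<noteq> \<one>"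
  proof
    assume "g \<otimes> x \<otimes> inv g = \<one>"
    then have "g \<otimes> x = g" using assms by (metis inv_solve_right' l_one m_closed one_closed)
    then show False using assms by simp
  qed
  ultimately show ?thesis using assms by simp
qed

end

text \<open>The seed of all test functions below: group algebra elements are applied to it, and the
  value of the result at \<open>\<one>\<close> is their coefficient there, which certifies that the
  function is nonzero.\<close>

definition unit_mass :: "('a, 'b) monoid_scheme \<Rightarrow> 'a \<Rightarrow> complex" where
  "unit_mass G g = (if g = \<one>\<^bsub>G\<^esub> then 1 else 0)"

section \<open>Excluding the dihedral groups of order 8 and 12 and the product of S3 with Z3\<close>

context A3_group
begin

text \<open>The subgroup would be dihedral of order 8 with central involution
  \<open>c = r^2\<close>. Where \<open>c\<close> acts as -1, the reflections \<open>x\<close> and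
  \<open>z\<close> anticommute, so \<open>x + z\<close> squares to 2 and the connection set
  \<open>x, z, c\<close> has the eigenvalues \<open>-1 + sqrt 2\<close> and
  \<open>-1 - sqrt 2\<close>.\<close>

lemma ord_product_involutions_neq_4:
  assumes x: "involution x" and z: "involution z" and nc: "x \<otimes> z \<noteq> z \<otimes> x"
  shows "ord (x \<otimes> z) \<noteq> 4"
proof
  assume o4: "ord (x \<otimes> z) = 4"
  define r where "r = x \<otimes> z"
  define c where "c = r \<otimes> r"
  have [simp]: "x \<in> carrier G" "z \<in> carrier G" "r \<in> carrier G" "c \<in> carrier G"
    using x z by (simp_all add: r_def c_def)
  have xx: "x \<otimes> x = \<one>" "z \<otimes> z = \<one>" using x z by auto
  note red = m_assoc xx cancel_left_pair[OF xx(1)] cancel_left_pair[OF xx(2)]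
  have ir: "inv r = z \<otimes> x" using xx by (simp add: r_def inv_mult_group inv_involution)
  have "r [^] (4::nat) = \<one>" using o4 pow_ord_eq_1[of r] by (simp add: r_def)
  moreover have "r [^] (4::nat) = c \<otimes> c"
    by (simp add: c_def numeral_eq_Suc m_assoc)
  ultimately have cc: "c \<otimes> c = \<one>" by simp
  have "r [^] (2::nat) \<noteq> \<one>"
    using o4 pow_eq_id[of r 2] by (simp add: r_def)
  then have c1: "c \<noteq> \<one>" by (simp add: c_def numeral_2_eq_2)
  have "c \<otimes> r \<otimes> r = \<one>" using cc by (simp add: c_def m_assoc)
  then have zx: "z \<otimes> x = c \<otimes> (x \<otimes> z)" using ir r_def by (metis inv_equality m_closed \<open>r \<in> carrier G\<close> \<open>c \<in> carrier G\<close>)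
  have ic: "inv c = c" using cc by (simp add: inv_involution)
  have ic': "inv c = z \<otimes> x \<otimes> (z \<otimes> x)" by (simp add: c_def inv_mult_group ir)
  \<comment> \<open>Conjugation by \<open>x\<close> inverts \<open>r\<close> and hence
    \<open>c\<close>, which is its own inverse. The same holds for \<open>z\<close> below.\<close>
  have cx: "x \<otimes> c = c \<otimes> x"
  proof -
    have "x \<otimes> (x \<otimes> c) = x \<otimes> (c \<otimes> x)"
      using ic ic' by (simp add: c_def r_def red)
    then show ?thesis by simp
  qed
  have cz: "z \<otimes> c = c \<otimes> z"
  proof -
    have "c \<otimes> z = x \<otimes> (z \<otimes> x)" by (simp add: c_def r_def red)
    moreover have "z \<otimes> c = z \<otimes> (z \<otimes> x \<otimes> (z \<otimes> x))" using ic ic' by simp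
    then have "z \<otimes> c = x \<otimes> (z \<otimes> x)" by (simp add: red)
    ultimately show ?thesis by simp
  qed
  have ne: "x \<noteq> z" "x \<noteq> c" "z \<noteq> c" using nc cx cz by auto
  let ?S = "{x, z, c}"
  note S = connection_set_involutions[of x z c, OF _ _ _ _ _ _ _ cc c1 ne]
  have S: "connection_set G ?S" "card ?S = 3" using S x z by auto
  \<comment> \<open>The central involution \<open>c\<close> acts on \<open>f\<close> as \<open>-1\<close>, so the adjacency operator \<open>A\<close> satisfies \<open>(A + 1)\<^sup>2 = 2\<close> on \<open>f\<close>.\<close>
  define f where "f g = unit_mass G g - unit_mass G (c \<otimes> g)" for g
  have fc: "f (c \<otimes> g) = - f g" if "g \<in> carrier G" for g
    using that cc by (simp add: f_def cancel_left_pair)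
  have c_past: "x \<otimes> (c \<otimes> g) = c \<otimes> (x \<otimes> g)" "z \<otimes> (c \<otimes> g) = c \<otimes> (z \<otimes> g)"
    "z \<otimes> (x \<otimes> g) = c \<otimes> (x \<otimes> (z \<otimes> g))"
    if "g \<in> carrier G" for g
    using cx cz zx that by (simp_all add: m_assoc[symmetric])
  have A: "neighbour_sum G ?S f g = f (x \<otimes> g) + f (z \<otimes> g) - f g" if "g \<in> carrier G" for g
    using that by (simp add: neighbour_sum_triple[OF S(2)] fc)
  have "neighbour_sum G ?S (neighbour_sum G ?S f) g
      = of_int (-2) * neighbour_sum G ?S f g + of_int 1 * f g" if g: "g \<in> carrier G" for g
    using g by (simp add: neighbour_sum_triple[OF S(2), of _ "neighbour_sum G ?S f"] A c_past fc
        cancel_left_pair[OF xx(1)] cancel_left_pair[OF xx(2)] algebra_simps)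
  moreover have "f \<one> \<noteq> 0" using c1 by (simp add: f_def unit_mass_def)
  ultimately obtain k :: int where "k * k = -2 * k + 1"
    using quadratic_has_root_in_Ints[OF S one_closed, of f "-2" 1] by blast
  then have "(k + 1) * (k + 1) = 2" by (simp add: algebra_simps)
  then show False using not_between_squares[of 1 2 "k + 1"] by simp
qed

text \<open>The subgroup would be dihedral of order 12 with central involution
  \<open>c = r^3\<close>. Modulo \<open>c\<close> the three elements \<open>x, z, x c\<close> give
  one reflection of S3 the weight 2 and another the weight 1. In the reflection representation
  \<open>x z + z x = -1\<close>, so \<open>2 x + z\<close> squares to
  \<open>4 + 1 - 2 = 3\<close>.\<close>

lemma ord_product_involutions_neq_6:
  assumes x: "involution x" and z: "involution z" and nc: "x \<otimes> z \<noteq> z \<otimes> x"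
  shows "ord (x \<otimes> z) \<noteq> 6"
proof
  assume o6: "ord (x \<otimes> z) = 6"
  define r where "r = x \<otimes> z"
  define c where "c = r \<otimes> (r \<otimes> r)"
  have [simp]: "x \<in> carrier G" "z \<in> carrier G" "r \<in> carrier G" "c \<in> carrier G"
    using x z by (simp_all add: r_def c_def)
  have xx: "x \<otimes> x = \<one>" "z \<otimes> z = \<one>" using x z by auto
  note red = m_assoc xx cancel_left_pair[OF xx(1)] cancel_left_pair[OF xx(2)]
  have ir: "inv r = z \<otimes> x" using xx by (simp add: r_def inv_mult_group inv_involution)
  have "r [^] (6::nat) = \<one>" using o6 pow_ord_eq_1[of r] by (simp add: r_def)
  moreover have "r [^] (6::nat) = c \<otimes> c"
    by (simp add: c_def numeral_eq_Suc m_assoc)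
  ultimately have cc: "c \<otimes> c = \<one>" by simp
  have "r [^] (3::nat) \<noteq> \<one>" "r [^] (4::nat) \<noteq> \<one>" "r [^] (1::nat) \<noteq> \<one>"
    using o6 pow_eq_id[of r 3] pow_eq_id[of r 4] pow_eq_id[of r 1] by (simp_all add: r_def)
  then have c1: "c \<noteq> \<one>" and cr1: "c \<otimes> r \<noteq> \<one>" and r1: "r \<noteq> \<one>"
    by (simp_all add: c_def numeral_eq_Suc m_assoc)
  have "c \<otimes> (r \<otimes> r) \<otimes> r = \<one>" using cc by (simp add: c_def m_assoc)
  then have ir': "inv r = c \<otimes> (r \<otimes> r)" by (intro inv_equality) simp_all
  have ic: "inv c = c" using cc by (simp add: inv_involution)
  have ic': "inv c = z \<otimes> x \<otimes> (z \<otimes> x) \<otimes> (z \<otimes> x)" by (simp add: c_def inv_mult_group ir)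
  have cx: "x \<otimes> c = c \<otimes> x"
  proof -
    have "x \<otimes> (x \<otimes> c) = x \<otimes> (c \<otimes> x)"
      using ic ic' by (simp add: c_def r_def red)
    then show ?thesis by simp
  qed
  have cz: "z \<otimes> c = c \<otimes> z"
  proof -
    have "c \<otimes> z = x \<otimes> (z \<otimes> (x \<otimes> (z \<otimes> x)))" by (simp add: c_def r_def red)
    moreover have "z \<otimes> c = z \<otimes> (z \<otimes> x \<otimes> (z \<otimes> x) \<otimes> (z \<otimes> x))" using ic ic' by simp
    then have "z \<otimes> c = x \<otimes> (z \<otimes> (x \<otimes> (z \<otimes> x)))" by (simp add: red)
    ultimately show ?thesis by simp
  qed
  have cr: "r \<otimes> c = c \<otimes> r" by (simp add: c_def m_assoc)
  have "x \<noteq> c" using cz nc by auto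
  then have xc: "involution (x \<otimes> c)" using involution_mult[OF x _ cx] cc c1 by simp
  have ne: "x \<noteq> z" "x \<noteq> x \<otimes> c" "z \<noteq> x \<otimes> c"
  proof -
    show "x \<noteq> z" using nc by auto
    show "x \<noteq> x \<otimes> c" using c1 by simp
    have "x \<otimes> (x \<otimes> c) = x \<otimes> (c \<otimes> x)" using cx by simp
    also have "\<dots> = x \<otimes> c \<otimes> x" by (simp add: m_assoc)
    finally have "x \<otimes> (x \<otimes> c) = x \<otimes> c \<otimes> x" .
    then show "z \<noteq> x \<otimes> c" using nc by metis
  qed
  let ?S = "{x, z, x \<otimes> c}"
  have S: "connection_set G ?S" "card ?S = 3"
    using connection_set_involutions[of x z "x \<otimes> c"] x z xc ne by auto
  \<comment> \<open>On \<open>f\<close> the central involution \<open>c\<close> acts as \<open>1\<close> and \<open>1 + r + r\<^sup>2\<close> as \<open>0\<close>: this is the reflection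
    representation of the quotient \<open>S\<^sub>3\<close>.\<close>
  define d where "d g = unit_mass G g + unit_mass G (c \<otimes> g)" for g
  define f where "f g = d g - d (r \<otimes> g)" for g
  have dc: "d (c \<otimes> g) = d g" if "g \<in> carrier G" for g
    using that cc by (simp add: d_def cancel_left_pair)
  have c_past: "x \<otimes> (c \<otimes> g) = c \<otimes> (x \<otimes> g)" "z \<otimes> (c \<otimes> g) = c \<otimes> (z \<otimes> g)"
    "r \<otimes> (c \<otimes> g) = c \<otimes> (r \<otimes> g)" "x \<otimes> c \<otimes> g = c \<otimes> (x \<otimes> g)"
    if "g \<in> carrier G" for g
    using cx cz cr that by (simp_all add: m_assoc[symmetric])
  have fc: "f (c \<otimes> g) = f g" if "g \<in> carrier G" for g
    using that by (simp add: f_def c_past dc)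
  have fr: "f (x \<otimes> (z \<otimes> g)) + f (z \<otimes> (x \<otimes> g)) = - f g" if "g \<in> carrier G" for g
  proof -
    have "z \<otimes> (x \<otimes> g) = c \<otimes> (r \<otimes> (r \<otimes> g))"
      using that ir ir' by (simp add: m_assoc[symmetric])
    moreover have "x \<otimes> (z \<otimes> g) = r \<otimes> g" using that by (simp add: r_def m_assoc)
    moreover have "d (r \<otimes> (r \<otimes> (r \<otimes> g))) = d g"
      using that dc[of g] by (simp add: c_def m_assoc)
    ultimately show ?thesis using that by (simp add: c_past dc f_def)
  qed
  have A: "neighbour_sum G ?S f g = 2 * f (x \<otimes> g) + f (z \<otimes> g)" if "g \<in> carrier G" for g
    using that by (simp add: neighbour_sum_triple[OF S(2)] c_past fc)
  have "neighbour_sum G ?S (neighbour_sum G ?S f) g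
      = of_int 0 * neighbour_sum G ?S f g + of_int 3 * f g" if g: "g \<in> carrier G" for g
  proof -
    have "neighbour_sum G ?S (neighbour_sum G ?S f) g
      = 5 * f g + 2 * (f (x \<otimes> (z \<otimes> g)) + f (z \<otimes> (x \<otimes> g)))"
      using g by (simp add: neighbour_sum_triple[OF S(2), of _ "neighbour_sum G ?S f"] A c_past fc
        cancel_left_pair[OF xx(1)] cancel_left_pair[OF xx(2)] algebra_simps)
    then show ?thesis using fr[OF g] by simp
  qed
  moreover have "f \<one> \<noteq> 0" using c1 cr1 r1 by (simp add: f_def d_def unit_mass_def)
  ultimately obtain k :: int where "k * k = 3"
    using quadratic_has_root_in_Ints[OF S one_closed, of f 0 3] by auto
  then show False using not_between_squares[of 1 3 k] by simp
qed

lemma product_involutions_cube: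
  assumes "involution x" "involution z" "x \<otimes> z \<noteq> z \<otimes> x"
  shows "x \<otimes> z \<otimes> (x \<otimes> z) \<otimes> (x \<otimes> z) = \<one>"
proof -
  have "ord (x \<otimes> z) = 3"
    using ord_product_involutions_cases[of x z] ord_product_involutions_neq_4[of x z]
      ord_product_involutions_neq_6[of x z] assms by auto
  then have "(x \<otimes> z) [^] (3::nat) = \<one>" using pow_ord_eq_1[of "x \<otimes> z"] assms by simp
  then show ?thesis using assms by (simp add: numeral_3_eq_3)
qed

text \<open>Where \<open>1 + c + c^2\<close> vanishes, the inverse pair \<open>x c, x c^2\<close>
  adds up to \<open>-x\<close>. The connection set \<open>z, x c, x c^2\<close> therefore simulates
  the signed sum \<open>z - x\<close>, whose square is \<open>2 - (x z + z x) = 3\<close> in the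
  reflection representation.\<close>

lemma no_centralizer_of_order_3:
  assumes x: "involution x" and z: "involution z" and nc: "x \<otimes> z \<noteq> z \<otimes> x"
    and c: "c \<in> carrier G" "c \<otimes> c \<otimes> c = \<one>" "c \<otimes> x = x \<otimes> c" "c \<otimes> z = z \<otimes> c"
  shows "c = \<one>"
proof (rule ccontr)
  assume c1: "c \<noteq> \<one>"
  define r where "r = x \<otimes> z"
  have [simp]: "x \<in> carrier G" "z \<in> carrier G" "r \<in> carrier G" "c \<in> carrier G"
    using x z c by (simp_all add: r_def)
  have xx: "x \<otimes> x = \<one>" "z \<otimes> z = \<one>" using x z by auto
  have rrr: "r \<otimes> r \<otimes> r = \<one>" using product_involutions_cube[OF x z nc] by (simp add: r_def)
  have ir: "inv r = z \<otimes> x" using xx by (simp add: r_def inv_mult_group inv_involution)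
  have ir': "inv r = r \<otimes> r" using rrr by (intro inv_equality) simp_all
  have r1: "r \<noteq> \<one>" using nc ir by (auto simp: r_def)
  have c_past: "x \<otimes> (c \<otimes> g) = c \<otimes> (x \<otimes> g)" "z \<otimes> (c \<otimes> g) = c \<otimes> (z \<otimes> g)"
    if "g \<in> carrier G" for g
    using c that by (simp_all add: m_assoc[symmetric])
  then have cr: "r \<otimes> (c \<otimes> g) = c \<otimes> (r \<otimes> g)" if "g \<in> carrier G" for g
    using that by (simp add: r_def m_assoc)
  have "(x \<otimes> c) \<otimes> (x \<otimes> (c \<otimes> c)) = x \<otimes> (c \<otimes> (x \<otimes> (c \<otimes> c)))" by (simp add: m_assoc)
  also have "\<dots> = \<one>"
    using c(2) by (simp add: c_past[symmetric] cancel_left_pair[OF xx(1)]) (simp add: m_assoc)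
  finally have inv_pair: "(x \<otimes> c) \<otimes> (x \<otimes> (c \<otimes> c)) = \<one>" .
  have ne: "x \<otimes> c \<noteq> x \<otimes> (c \<otimes> c)" using c1 by simp
  let ?S = "{z, x \<otimes> c, x \<otimes> (c \<otimes> c)}"
  have S: "connection_set G ?S" "card ?S = 3"
    using connection_set_inverse_pair[of z, OF _ _ _ _ _ inv_pair ne] z by auto
  \<comment> \<open>Both \<open>1 + c + c\<^sup>2\<close> and \<open>1 + r + r\<^sup>2\<close> annihilate \<open>f\<close>.\<close>
  define e where "e g = unit_mass G g - unit_mass G (r \<otimes> g)" for g
  define f where "f g = e g - e (c \<otimes> g)" for g
  define h where "h g = f (z \<otimes> g) - f (x \<otimes> g)" for g
  have ccc: "c \<otimes> (c \<otimes> (c \<otimes> g)) = g" if "g \<in> carrier G" for g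
    using c(2) that by (simp add: m_assoc[symmetric])
  have fc: "f (c \<otimes> g) + f (c \<otimes> (c \<otimes> g)) = - f g" if "g \<in> carrier G" for g
    using that by (simp add: f_def ccc)
  have hc: "h (c \<otimes> g) + h (c \<otimes> (c \<otimes> g)) = - h g" if "g \<in> carrier G" for g
    using that fc[of "z \<otimes> g"] fc[of "x \<otimes> g"] by (simp add: h_def c_past algebra_simps)
  have fr: "f (x \<otimes> (z \<otimes> g)) + f (z \<otimes> (x \<otimes> g)) = - f g" if "g \<in> carrier G" for g
  proof -
    have "z \<otimes> (x \<otimes> g) = r \<otimes> (r \<otimes> g)"
      using that ir ir' by (simp add: m_assoc[symmetric])
    moreover have "x \<otimes> (z \<otimes> g) = r \<otimes> g" using that by (simp add: r_def m_assoc)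
    moreover have "r \<otimes> (r \<otimes> (r \<otimes> u)) = u" if "u \<in> carrier G" for u
      using that rrr by (simp add: m_assoc[symmetric])
    ultimately show ?thesis using that by (simp add: f_def e_def cr)
  qed
  have A: "neighbour_sum G ?S f g = h g" if "g \<in> carrier G" for g
    unfolding neighbour_sum_triple[OF S(2)]
    using that fc[of "x \<otimes> g"] by (simp add: m_assoc c_past h_def)
  have "neighbour_sum G ?S (neighbour_sum G ?S f) g
      = of_int 0 * neighbour_sum G ?S f g + of_int 3 * f g" if g: "g \<in> carrier G" for g
  proof -
    have "neighbour_sum G ?S (neighbour_sum G ?S f) g = h (z \<otimes> g) + h (x \<otimes> c \<otimes> g) + h (x \<otimes> (c \<otimes> c) \<otimes> g)"
      using g unfolding neighbour_sum_triple[OF S(2), of _ "neighbour_sum G ?S f"]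
      by (subst (1 2 3) A) simp_all
    also have "\<dots> = h (z \<otimes> g) - h (x \<otimes> g)"
      using g hc[of "x \<otimes> g"] by (simp add: m_assoc c_past)
    also have "\<dots> = 2 * f g - (f (x \<otimes> (z \<otimes> g)) + f (z \<otimes> (x \<otimes> g)))"
      using g by (simp add: h_def cancel_left_pair[OF xx(1)] cancel_left_pair[OF xx(2)])
    also have "\<dots> = 3 * f g" using fr[OF g] by simp
    finally show ?thesis by simp
  qed
  moreover have "f \<one> \<noteq> 0" using c1 r1 by (simp add: f_def e_def unit_mass_def)
  ultimately obtain k :: int where "k * k = 3"
    using quadratic_has_root_in_Ints[OF S one_closed, of f 0 3] by auto
  then show False using not_between_squares[of 1 3 k] by simp
qed

end

context group
begin

text \<open>The relations are those of a group of exponent 3, in which every element commutes with its conjugates.\<close>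

lemma exponent_3_commute:
  assumes [simp]: "a \<in> carrier G" "b \<in> carrier G"
    and a3: "a \<otimes> a \<otimes> a = \<one>" and b3: "b \<otimes> b \<otimes> b = \<one>"
    and ab3: "a \<otimes> b \<otimes> (a \<otimes> b) \<otimes> (a \<otimes> b) = \<one>"
    and a'b3: "inv a \<otimes> b \<otimes> (inv a \<otimes> b) \<otimes> (inv a \<otimes> b) = \<one>"
  shows "a \<otimes> (inv b \<otimes> a \<otimes> b) = inv b \<otimes> a \<otimes> b \<otimes> a"
proof -
  have ib: "inv b = b \<otimes> b" using b3 by (intro inv_equality) simp_all
  \<comment> \<open>The relation \<open>(a b)^3 = \<one>\<close> is cut in the middle as
    \<open>(a b a) (b a b) = \<one>\<close>; the same is done for the inverse of \<open>a\<close>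
    afterwards.\<close>
  have "inv (a \<otimes> (b \<otimes> a)) = b \<otimes> (a \<otimes> b)" using ab3 one_pair_commute[of "b \<otimes> (a \<otimes> b)" "a \<otimes> (b \<otimes> a)"]
    by (intro inv_equality one_pair_commute[of "a \<otimes> (b \<otimes> a)" "b \<otimes> (a \<otimes> b)"]) (simp_all add: m_assoc)
  then have 1: "a \<otimes> (b \<otimes> a) = inv b \<otimes> (inv a \<otimes> inv b)"
    by (metis assms(1,2) inv_inv inv_mult_group m_assoc m_closed inv_closed)
  have "inv (inv a \<otimes> (b \<otimes> inv a)) = b \<otimes> (inv a \<otimes> b)"
    using a'b3
    by (intro inv_equality one_pair_commute[of "inv a \<otimes> (b \<otimes> inv a)" "b \<otimes> (inv a \<otimes> b)"]) (simp_all add: m_assoc)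
  then have 2: "b \<otimes> (inv a \<otimes> b) = a \<otimes> (inv b \<otimes> a)"
    by (simp add: inv_mult_group m_assoc)
  have "inv b \<otimes> a \<otimes> b \<otimes> a = inv b \<otimes> (inv b \<otimes> (inv a \<otimes> inv b))" by (simp add: m_assoc 1)
  also have "\<dots> = (inv b \<otimes> inv b) \<otimes> (inv a \<otimes> inv b)" by (simp add: m_assoc)
  also have "inv b \<otimes> inv b = b" using b3 by (simp add: ib m_assoc)
  also have "b \<otimes> (inv a \<otimes> inv b) = b \<otimes> (inv a \<otimes> b) \<otimes> b" by (simp add: ib m_assoc)
  also have "\<dots> = a \<otimes> (inv b \<otimes> a \<otimes> b)" unfolding 2 by (simp add: m_assoc)
  finally show ?thesis by simp
qed

end

section \<open>Noncommuting involutions generate the whole group\<close>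

context A3_group
begin

lemma involutions_braid:
  assumes x: "involution x" and z: "involution z" and nc: "x \<otimes> z \<noteq> z \<otimes> x"
  shows "x \<otimes> (z \<otimes> x) = z \<otimes> (x \<otimes> z)"
proof -
  have "x \<otimes> (z \<otimes> x) \<otimes> (z \<otimes> (x \<otimes> z)) = \<one>"
    using product_involutions_cube[OF assms] x z by (simp add: m_assoc)
  then have "inv (z \<otimes> (x \<otimes> z)) = x \<otimes> (z \<otimes> x)" using x z by (intro inv_equality) simp_all
  then show ?thesis using x z by (simp add: inv_mult_group inv_involution m_assoc)
qed

text \<open>Otherwise \<open>x w\<close> is a further involution, and \<open>z\<close> satisfies the
  braid relation with each of \<open>x\<close>, \<open>w\<close>, \<open>x w\<close> that it does
  not commute with. These relations are incompatible: if \<open>w\<close> commutes with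
  \<open>z\<close> they give \<open>w = \<one>\<close>; if not, they give \<open>w = x\<close>, or
  else \<open>w = x z\<close>, which makes \<open>x\<close> and \<open>z\<close> commute.\<close>

lemma commuting_involutions_eq:
  assumes x: "involution x" and z: "involution z" and nc: "x \<otimes> z \<noteq> z \<otimes> x"
    and w: "involution w" and xw: "x \<otimes> w = w \<otimes> x"
  shows "w = x"
proof (rule ccontr)
  assume "w \<noteq> x"
  then have v: "involution (x \<otimes> w)" using involution_mult x w xw by auto
  have [simp]: "x \<in> carrier G" "z \<in> carrier G" "w \<in> carrier G" using x z w by auto
  have xx: "x \<otimes> x = \<one>" "z \<otimes> z = \<one>" "w \<otimes> w = \<one>" using x z w by auto
  note red = m_assoc xx cancel_left_pair[OF xx(1)] cancel_left_pair[OF xx(2)]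
    cancel_left_pair[OF xx(3)]
  have xz: "x \<otimes> (z \<otimes> x) = z \<otimes> (x \<otimes> z)" using involutions_braid[OF x z nc] .
  have wx: "w \<otimes> (x \<otimes> g) = x \<otimes> (w \<otimes> g)" if "g \<in> carrier G" for g
    using that xw by (simp add: m_assoc[symmetric])
  show False
  proof (cases "w \<otimes> z = z \<otimes> w")
    case True
    have wz: "w \<otimes> (z \<otimes> g) = z \<otimes> (w \<otimes> g)" if "g \<in> carrier G" for g
      using that True by (simp add: m_assoc[symmetric])
    have "x \<otimes> w \<otimes> z \<noteq> z \<otimes> (x \<otimes> w)"
    proof
      assume "x \<otimes> w \<otimes> z = z \<otimes> (x \<otimes> w)"
      then have "x \<otimes> z \<otimes> w = z \<otimes> x \<otimes> w" using True by (simp add: m_assoc)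
      then show False using nc by simp
    qed
    from involutions_braid[OF v z this]
    have "x \<otimes> (z \<otimes> x) = z \<otimes> (x \<otimes> z) \<otimes> w"
      using True by (simp add: red wx wz xw[symmetric])
    then show False using xz w by simp
  next
    case False
    then have wz: "w \<otimes> (z \<otimes> w) = z \<otimes> (w \<otimes> z)" using involutions_braid[OF w z] by simp
    have "x \<otimes> w \<otimes> z \<noteq> z \<otimes> (x \<otimes> w)"
    proof
      assume "x \<otimes> w \<otimes> z = z \<otimes> (x \<otimes> w)"
      then have "x \<otimes> (x \<otimes> w \<otimes> z) \<otimes> w = x \<otimes> (z \<otimes> (x \<otimes> w)) \<otimes> w" by simp
      then have "w \<otimes> (z \<otimes> w) = x \<otimes> (z \<otimes> x)" by (simp add: red)
      then have "z \<otimes> (w \<otimes> z) = z \<otimes> (x \<otimes> z)" using wz xz by simp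
      then show False using \<open>w \<noteq> x\<close> by simp
    qed
    from involutions_braid[OF v z this]
    have br: "x \<otimes> (w \<otimes> (z \<otimes> (x \<otimes> w))) = z \<otimes> (x \<otimes> (w \<otimes> z))" by (simp add: m_assoc)
    have "x \<otimes> (w \<otimes> (z \<otimes> (x \<otimes> w))) = x \<otimes> (w \<otimes> (z \<otimes> w)) \<otimes> x" by (simp add: m_assoc xw)
    also have "\<dots> = x \<otimes> (z \<otimes> (w \<otimes> (z \<otimes> x)))" by (simp add: wz m_assoc)
    finally have "x \<otimes> (z \<otimes> (w \<otimes> (z \<otimes> x))) = z \<otimes> (x \<otimes> (w \<otimes> z))" using br by simp
    \<comment> \<open>Left multiplication by \<open>z x\<close> collapses the left side to
      \<open>w z x\<close> and exposes a word \<open>x z x\<close> on the right, where the braid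
      relation applies.\<close>
    then have "z \<otimes> (x \<otimes> (x \<otimes> (z \<otimes> (w \<otimes> (z \<otimes> x))))) = z \<otimes> (x \<otimes> (z \<otimes> x)) \<otimes> (w \<otimes> z)"
      by (simp add: m_assoc)
    then have "w \<otimes> (z \<otimes> x) = z \<otimes> (z \<otimes> (x \<otimes> z)) \<otimes> (w \<otimes> z)" by (simp only: xz) (simp add: red)
    then have "w \<otimes> (z \<otimes> x) = x \<otimes> (z \<otimes> (w \<otimes> z))" by (simp add: red)
    also have "\<dots> = x \<otimes> (w \<otimes> (z \<otimes> w))" by (simp add: wz)
    also have "\<dots> = w \<otimes> (x \<otimes> (z \<otimes> w))" by (simp add: wx)
    finally have "z \<otimes> x = x \<otimes> (z \<otimes> w)" by simp
    then have "x \<otimes> (z \<otimes> x) = z \<otimes> w" by (simp add: red)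
    then have "x \<otimes> z = w" using xz by simp
    then have "x \<otimes> z = z \<otimes> x" using xw by (metis \<open>x \<in> carrier G\<close> \<open>z \<in> carrier G\<close> m_assoc xx(1) l_one r_one m_closed inv_solve_left inv_unique' )
    then show False using nc by simp
  qed
qed

text \<open>A fourth involution \<open>w\<close> commutes with none of the three reflections, so
  \<open>a = x z\<close> and \<open>b = x w\<close> satisfy the relations of exponent 3. Their
  commutator is centralised by \<open>x\<close> and \<open>z\<close> and has trivial cube, hence is
  trivial. Thus \<open>a\<close> and \<open>b\<close> span a product of two groups of order 3
  inverted by \<open>x\<close>; modulo \<open>a\<close> the set \<open>x, z, w\<close> again has
  weights 2 and 1, and its square is 3.\<close>

lemma third_reflection_only:
  assumes x: "involution x" and z: "involution z" and nc: "x \<otimes> z \<noteq> z \<otimes> x"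
    and w: "involution w"
  shows "w \<in> {x, z, x \<otimes> (z \<otimes> x)}"
proof (rule ccontr)
  assume w_new: "w \<notin> {x, z, x \<otimes> (z \<otimes> x)}"
  have ncx: "x \<otimes> w \<noteq> w \<otimes> x" using commuting_involutions_eq[OF x z nc w] w_new by auto
  have ncz: "z \<otimes> w \<noteq> w \<otimes> z"
    using commuting_involutions_eq[OF z x nc[symmetric] w] w_new by auto
  have [simp]: "x \<in> carrier G" "z \<in> carrier G" "w \<in> carrier G" using x z w by auto
  have xx: "x \<otimes> x = \<one>" "z \<otimes> z = \<one>" "w \<otimes> w = \<one>" using x z w by auto
  note cl = cancel_left_pair[OF xx(1)] cancel_left_pair[OF xx(2)] cancel_left_pair[OF xx(3)]
  have ix: "inv x = x" "inv z = z" "inv w = w" using xx by (simp_all add: inv_involution)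
  \<comment> \<open>The third reflection is introduced because \<open>a b = v w\<close> below; its
    cube is then controlled as a product of two noncommuting involutions.\<close>
  define v where "v = x \<otimes> (z \<otimes> x)"
  have v: "involution v"
    using involution_conj[OF z, of x] by (simp add: v_def ix m_assoc)
  have ncv: "v \<otimes> w \<noteq> w \<otimes> v"
  proof
    assume vw: "v \<otimes> w = w \<otimes> v"
    have "w \<noteq> v" using w_new by (simp add: v_def)
    moreover have "w = v" using commuting_involutions_eq[OF v x _ w vw] commuting_involutions_eq[OF w x ncx[symmetric] v vw[symmetric]]
      by simp
    ultimately show False by simp
  qed
  define a where "a = x \<otimes> z"
  define b where "b = x \<otimes> w"
  have [simp]: "a \<in> carrier G" "b \<in> carrier G" by (simp_all add: a_def b_def)
  have ia: "inv a = z \<otimes> x" "inv b = w \<otimes> x"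
    by (simp_all add: a_def b_def inv_mult_group ix)
  have a3: "a \<otimes> a \<otimes> a = \<one>" using product_involutions_cube[OF x z nc] by (simp add: a_def)
  have b3: "b \<otimes> b \<otimes> b = \<one>" using product_involutions_cube[OF x w ncx] by (simp add: b_def)
  have ab3: "a \<otimes> b \<otimes> (a \<otimes> b) \<otimes> (a \<otimes> b) = \<one>"
    using product_involutions_cube[OF v w ncv] by (simp add: a_def b_def v_def m_assoc)
  have a'b3: "inv a \<otimes> b \<otimes> (inv a \<otimes> b) \<otimes> (inv a \<otimes> b) = \<one>"
    using product_involutions_cube[OF z w ncz] by (simp add: ia b_def m_assoc cl)
  have b'a3: "inv b \<otimes> a \<otimes> (inv b \<otimes> a) \<otimes> (inv b \<otimes> a) = \<one>"
    using product_involutions_cube[OF w z ncz[symmetric]] by (simp add: ia a_def m_assoc cl)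
  have ba3: "b \<otimes> a \<otimes> (b \<otimes> a) \<otimes> (b \<otimes> a) = \<one>"
  proof -
    have "a \<otimes> (b \<otimes> a \<otimes> (b \<otimes> a) \<otimes> (b \<otimes> a)) = a \<otimes> b \<otimes> (a \<otimes> b) \<otimes> (a \<otimes> b) \<otimes> a"
      by (simp add: m_assoc)
    then show ?thesis unfolding ab3 by simp
  qed
  have com_a: "a \<otimes> (inv b \<otimes> a \<otimes> b) = inv b \<otimes> a \<otimes> b \<otimes> a"
    using exponent_3_commute[OF _ _ a3 b3 ab3 a'b3] by simp
  have com_b: "b \<otimes> (inv a \<otimes> b \<otimes> a) = inv a \<otimes> b \<otimes> a \<otimes> b"
    using exponent_3_commute[OF _ _ b3 a3 ba3 b'a3] by simp
  \<comment> \<open>The commutator of \<open>a\<close> and \<open>b\<close>. That each of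
    \<open>a\<close> and \<open>b\<close> commutes with its conjugate by the other means that
    \<open>c\<close> commutes with both.\<close>
  define c where "c = inv a \<otimes> (inv b \<otimes> (a \<otimes> b))"
  have [simp]: "c \<in> carrier G" by (simp add: c_def)
  note cl' = cancel_left_pair[OF l_inv] cancel_left_pair[OF r_inv]
  have bac: "a \<otimes> b = b \<otimes> (a \<otimes> c)" by (simp add: c_def cl')
  have ca: "c \<otimes> a = a \<otimes> c"
  proof -
    have "inv a \<otimes> (inv b \<otimes> a \<otimes> b \<otimes> a) = inv a \<otimes> (a \<otimes> (inv b \<otimes> a \<otimes> b))" using com_a by simp
    then show ?thesis by (simp add: c_def m_assoc cl')
  qed
  have cb: "c \<otimes> b = b \<otimes> c"
  proof -
    define u where "u = inv a \<otimes> b \<otimes> a"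
    have u: "u \<in> carrier G" by (simp add: u_def)
    have bu: "b \<otimes> u = u \<otimes> b" using com_b by (simp add: u_def)
    have c_u: "c = inv u \<otimes> b" by (simp add: c_def u_def inv_mult_group m_assoc)
    have "inv u \<otimes> (b \<otimes> u) \<otimes> inv u = inv u \<otimes> (u \<otimes> b) \<otimes> inv u" using bu by simp
    then have "inv u \<otimes> b = b \<otimes> inv u" using u by (simp add: m_assoc cl')
    then show ?thesis using u by (simp add: c_u m_assoc)
  qed
  \<comment> \<open>The conjugate of \<open>a\<close> by \<open>b\<close> is \<open>a c\<close> and
    has trivial cube like \<open>a\<close>; since \<open>a\<close> and \<open>c\<close> commute,
    \<open>c^3\<close> is left over.\<close>
  have c3: "c \<otimes> c \<otimes> c = \<one>"
  proof -
    define u where "u = inv b \<otimes> a \<otimes> b"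
    have u: "u \<in> carrier G" by (simp add: u_def)
    have c_u: "u = a \<otimes> c" by (simp add: c_def u_def m_assoc cl')
    have "u \<otimes> u \<otimes> u = inv b \<otimes> (a \<otimes> a \<otimes> a) \<otimes> b" by (simp add: u_def m_assoc cl')
    also have "\<dots> = \<one>" by (simp add: a3)
    finally have "a \<otimes> c \<otimes> (a \<otimes> c) \<otimes> (a \<otimes> c) = \<one>" by (simp add: c_u)
    moreover have "c \<otimes> (a \<otimes> g) = a \<otimes> (c \<otimes> g)" if "g \<in> carrier G" for g
      using ca that by (simp add: m_assoc[symmetric])
    ultimately have "(a \<otimes> a \<otimes> a) \<otimes> (c \<otimes> c \<otimes> c) = \<one>" by (simp add: m_assoc)
    then show ?thesis by (simp add: a3)
  qed
  have xa: "x \<otimes> inv a = a \<otimes> x" "x \<otimes> inv b = b \<otimes> x" "x \<otimes> a = inv a \<otimes> x" "x \<otimes> b = inv b \<otimes> x"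
    unfolding ia by (simp_all add: a_def b_def m_assoc cl xx)
  have xa': "x \<otimes> (inv a \<otimes> g) = a \<otimes> (x \<otimes> g)" "x \<otimes> (inv b \<otimes> g) = b \<otimes> (x \<otimes> g)"
    "x \<otimes> (a \<otimes> g) = inv a \<otimes> (x \<otimes> g)" "x \<otimes> (b \<otimes> g) = inv b \<otimes> (x \<otimes> g)" if "g \<in> carrier G" for g
    using that xa by (simp_all add: m_assoc[symmetric])
  \<comment> \<open>Conjugation by \<open>x\<close> inverts \<open>a\<close> and \<open>b\<close>
    and turns \<open>c\<close> into the commutator of their inverses, which is \<open>c\<close>
    again because \<open>c\<close> commutes with \<open>a\<close> and \<open>b\<close>.\<close>
  have cx: "c \<otimes> x = x \<otimes> c"
  proof -
    have "x \<otimes> c = a \<otimes> b \<otimes> (inv a \<otimes> inv b) \<otimes> x" by (simp add: c_def xa' xa m_assoc)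
    also have "a \<otimes> b \<otimes> (inv a \<otimes> inv b) = c \<otimes> (b \<otimes> (a \<otimes> (inv a \<otimes> inv b)))"
    proof -
      have "c \<otimes> (b \<otimes> a) = c \<otimes> b \<otimes> a" by (simp add: m_assoc)
      also have "\<dots> = b \<otimes> (c \<otimes> a)" unfolding cb by (simp add: m_assoc)
      finally have "a \<otimes> b = c \<otimes> (b \<otimes> a)" unfolding ca bac by simp
      then show ?thesis by (simp add: m_assoc)
    qed
    also have "\<dots> = c" by (simp add: cl')
    finally show ?thesis by simp
  qed
  have z_xa: "z = x \<otimes> a" by (simp add: a_def cl)
  have "c \<otimes> z = z \<otimes> c" using cx ca by (simp add: z_xa m_assoc[symmetric]) (simp add: m_assoc ca)
  then have "c = \<one>" using no_centralizer_of_order_3[OF x z nc _ c3 cx] by simp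
  then have ab: "a \<otimes> b = b \<otimes> a" using bac by simp
  let ?S = "{x, z, w}"
  have "x \<noteq> z" using nc by auto
  then have S: "connection_set G ?S" "card ?S = 3"
    using connection_set_involutions[of x z w] x z w w_new by auto
  \<comment> \<open>On \<open>f\<close> the rotation \<open>a\<close> acts as \<open>1\<close> and \<open>1 + b + b\<^sup>2\<close> as \<open>0\<close>.\<close>
  define h where "h g = unit_mass G g + unit_mass G (a \<otimes> g) + unit_mass G (a \<otimes> (a \<otimes> g))" for g
  define f where "f g = h g - h (b \<otimes> g)" for g
  have aaa: "a \<otimes> (a \<otimes> (a \<otimes> g)) = g" "b \<otimes> (b \<otimes> (b \<otimes> g)) = g" if "g \<in> carrier G" for g
    using that a3 b3 by (simp_all add: m_assoc[symmetric])
  have abg: "b \<otimes> (a \<otimes> g) = a \<otimes> (b \<otimes> g)" if "g \<in> carrier G" for g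
    using that ab by (simp add: m_assoc[symmetric])
  have ha: "h (a \<otimes> g) = h g" if "g \<in> carrier G" for g
    using that by (simp add: h_def aaa)
  have fa: "f (a \<otimes> g) = f g" if "g \<in> carrier G" for g
    using that by (simp add: f_def abg ha)
  have fb: "f (b \<otimes> g) + f (b \<otimes> (b \<otimes> g)) = - f g" if "g \<in> carrier G" for g
    using that by (simp add: f_def aaa)
  have ia': "inv a = a \<otimes> a" "inv b = b \<otimes> b"
    using a3 b3 by (auto intro!: inv_equality)
  have zg: "z \<otimes> g = a \<otimes> (a \<otimes> (x \<otimes> g))" if "g \<in> carrier G" for g
    using that ia'(1) xa(3) by (simp add: z_xa m_assoc[symmetric])
  have wg: "w \<otimes> g = b \<otimes> (b \<otimes> (x \<otimes> g))" if "g \<in> carrier G" for g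
  proof -
    have "w = x \<otimes> b" by (simp add: b_def cl)
    then show ?thesis using that ia'(2) xa(4) by (simp add: m_assoc[symmetric])
  qed
  have xg: "x \<otimes> (a \<otimes> g) = a \<otimes> (a \<otimes> (x \<otimes> g))" "x \<otimes> (b \<otimes> g) = b \<otimes> (b \<otimes> (x \<otimes> g))"
    if "g \<in> carrier G" for g
    using that xa' ia' by (simp_all add: m_assoc)
  have A: "neighbour_sum G ?S f g = 2 * f (x \<otimes> g) + f (b \<otimes> (b \<otimes> (x \<otimes> g)))"
    if "g \<in> carrier G" for g
    using that by (simp add: neighbour_sum_triple[OF S(2)] zg wg fa)
  have "neighbour_sum G ?S (neighbour_sum G ?S f) g
      = of_int 0 * neighbour_sum G ?S f g + of_int 3 * f g" if g: "g \<in> carrier G" for g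
  proof -
    have "neighbour_sum G ?S (neighbour_sum G ?S f) g
      = 5 * f g + 2 * (f (b \<otimes> g) + f (b \<otimes> (b \<otimes> g)))"
      using g by (simp add: neighbour_sum_triple[OF S(2), of _ "neighbour_sum G ?S f"] A zg wg xg aaa
        abg fa cl algebra_simps)
    then show ?thesis using fb[OF g] by simp
  qed
  moreover have "f \<one> \<noteq> 0"
  proof -
    \<comment> \<open>What matters is that \<open>b\<close> is not a power of \<open>a\<close>: the
      values \<open>\<one>\<close>, \<open>a\<close> and \<open>inv a\<close> of \<open>b\<close>
      would make \<open>w\<close> equal to \<open>x\<close>, \<open>z\<close> and
      \<open>x z x\<close>.\<close>
    have 1: "b \<noteq> \<one>" "a \<noteq> \<one>" using ncx nc ia by (auto simp: a_def b_def)
    have 2: "a \<otimes> b \<noteq> \<one>"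
    proof
      assume "a \<otimes> b = \<one>"
      then have "b = inv a" by (metis ab inv_equality \<open>a \<in> carrier G\<close> \<open>b \<in> carrier G\<close>)
      then have "x \<otimes> b = x \<otimes> (z \<otimes> x)" by (simp add: ia)
      then show False using w_new by (simp add: b_def cl)
    qed
    have 3: "a \<otimes> (a \<otimes> b) \<noteq> \<one>"
    proof
      assume "a \<otimes> (a \<otimes> b) = \<one>"
      then have "a \<otimes> (a \<otimes> (a \<otimes> b)) = a" by simp
      then have "b = a" by (simp add: aaa)
      then show False using w_new by (simp add: a_def b_def)
    qed
    have 4: "a \<otimes> a \<noteq> \<one>" using a3 1 by auto
    show ?thesis using 1 2 3 4 by (simp add: f_def h_def unit_mass_def)
  qed
  ultimately obtain k :: int where "k * k = 3"
    using quadratic_has_root_in_Ints[OF S one_closed, of f 0 3] by auto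
  then show False using not_between_squares[of 1 3 k] by simp
qed

text \<open>An even order of \<open>c\<close> would provide an involution commuting with
  \<open>x\<close> and \<open>z\<close>, hence equal to both. So the order is odd,
  \<open>x c\<close> has even order, and the bound for even orders reaches \<open>c\<close> through
  its power \<open>(x c)^12\<close>. Only order 1 or 3 remains, and order 3 is excluded
  already.\<close>

lemma central_in_reflections_eq_one:
  assumes x: "involution x" and z: "involution z" and nc: "x \<otimes> z \<noteq> z \<otimes> x"
    and c: "c \<in> carrier G" "c \<otimes> x = x \<otimes> c" "c \<otimes> z = z \<otimes> c"
  shows "c = \<one>"
proof -
  have odd: "odd (ord c)"
  proof
    assume "even (ord c)"
    then obtain m where m: "ord c = m + m" by (auto elim!: evenE simp: mult_2)
    then have "m > 0" using ord_pos[OF c(1)] by simp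
    define u where "u = c [^] m"
    have "u \<otimes> u = \<one>" using c(1) m pow_ord_eq_1[OF c(1)] by (simp add: u_def nat_pow_mult)
    moreover have "u \<noteq> \<one>" using c(1) m \<open>m > 0\<close> by (auto simp: u_def pow_eq_id dest: dvd_imp_le)
    ultimately have u: "involution u" using c(1) by (simp add: u_def)
    have "u \<otimes> x = x \<otimes> u" "u \<otimes> z = z \<otimes> u"
      using c x z by (simp_all add: u_def group_commutes_pow)
    then have "u = x" "u = z"
      using commuting_involutions_eq[OF x z nc u] commuting_involutions_eq[OF z x nc[symmetric] u]
      by simp_all
    then show False using nc by simp
  qed
  define y where "y = x \<otimes> c"
  have y: "y \<in> carrier G" using x c by (simp add: y_def)
  have x_pow: "x [^] (2 * k) = \<one>" for k :: nat
    using x nat_pow_pow[of x 2 k] by (simp add: numeral_2_eq_2)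
  have y_pow: "y [^] k = x [^] k \<otimes> c [^] k" for k :: nat
    using pow_mult_distrib[of x c k] c x by (simp add: y_def)
  have "even (ord y)"
  proof (rule ccontr)
    assume "odd (ord y)"
    then obtain k where k: "ord y = Suc (2 * k)" by (auto elim!: oddE)
    have "\<one> = x [^] Suc (2 * k) \<otimes> c [^] Suc (2 * k)"
      using y_pow[of "ord y"] pow_ord_eq_1[OF y] k by metis
    then have "\<one> = x \<otimes> c [^] Suc (2 * k)" using x_pow x by simp
    then have "c [^] Suc (2 * k) = x"
      using x c(1) by (metis inv_equality inv_involution nat_pow_closed one_pair_commute)
    moreover have "c [^] Suc (2 * k) \<otimes> z = z \<otimes> c [^] Suc (2 * k)"
      using c z group_commutes_pow by blast
    ultimately show False using nc by simp
  qed
  then have "ord y \<in> {2, 4, 6}" using even_ord_cases y by blast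
  \<comment> \<open>12 is the least common multiple of 2, 4 and 6. It is even, so the factor
    \<open>x\<close> disappears from the power.\<close>
  then have "ord y dvd 12" by auto
  then have "y [^] (12::nat) = \<one>" using pow_eq_id[OF y] by blast
  moreover have "x [^] (12::nat) = \<one>" using x_pow[of 6] by simp
  ultimately have "c [^] (12::nat) = \<one>" using y_pow[of 12] c by simp
  then have "ord c dvd 4 * 3" using pow_eq_id[OF c(1)] by simp
  moreover have "coprime (ord c) 4"
  proof -
    have "coprime (ord c) (2 ^ 2)" using odd by (metis coprime_power_right_iff coprime_right_2_iff_odd)
    then show ?thesis by simp
  qed
  ultimately have "ord c dvd 3" by (metis coprime_dvd_mult_right_iff)
  then have "c [^] (3::nat) = \<one>" using pow_eq_id[OF c(1)] by blast
  then have "c \<otimes> c \<otimes> c = \<one>" using c by (simp add: numeral_3_eq_3)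
  then show ?thesis using no_centralizer_of_order_3[OF x z nc c(1)] c by simp
qed

text \<open>Conjugation by any \<open>g\<close> permutes the three reflections, and every
  permutation of them is realised inside the generated subgroup. Correcting \<open>g\<close> by such
  elements makes it centralise \<open>x\<close> and \<open>z\<close>, whereupon it is
  trivial.\<close>

lemma carrier_eq_reflections:
  assumes x: "involution x" and z: "involution z" and nc: "x \<otimes> z \<noteq> z \<otimes> x"
  shows "carrier G = generate G {x, z}"
proof
  show "generate G {x, z} \<subseteq> carrier G" using generate_in_carrier[of "{x, z}"] x z by blast
  let ?H = "generate G {x, z}"
  have sub: "subgroup ?H G" using generate_is_subgroup[of "{x, z}"] x z by simp
  have [simp]: "x \<in> carrier G" "z \<in> carrier G" using x z by auto
  have xH: "x \<in> ?H" "z \<in> ?H" by (auto intro: generate.incl)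
  define v where "v = x \<otimes> (z \<otimes> x)"
  have vH: "v \<in> ?H" using xH by (simp add: v_def subgroup.m_closed[OF sub])
  have xx: "x \<otimes> x = \<one>" "z \<otimes> z = \<one>" using x z by auto
  have ix: "inv x = x" "inv z = z" using xx by (simp_all add: inv_involution)
  have v: "involution v" using involution_conj[OF z, of x] by (simp add: v_def ix m_assoc)
  have [simp]: "v \<in> carrier G" using v by simp
  note cl = cancel_left_pair[OF xx(1)] cancel_left_pair[OF xx(2)]
  have v': "v = z \<otimes> (x \<otimes> z)" using involutions_braid[OF x z nc] by (simp add: v_def)
  have iv: "inv v = v" using v by (simp add: inv_involution)
  have vz: "v \<otimes> z = x \<otimes> v"
  proof -
    have "v \<otimes> z = z \<otimes> x" by (simp add: v' m_assoc xx)
    moreover have "x \<otimes> v = z \<otimes> x" by (simp add: v_def cl)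
    ultimately show ?thesis by simp
  qed
  have zv: "z \<otimes> v = x \<otimes> z" by (simp add: v' cl)
  have xv: "x \<otimes> v = z \<otimes> x" by (simp add: v_def cl)
  show "carrier G \<subseteq> ?H"
  proof
    fix g assume g: "g \<in> carrier G"
    have conj: "\<exists>u \<in> {x, z, v}. g \<otimes> t = u \<otimes> g" if "involution t" "g \<in> carrier G" for t g
    proof -
      have "g \<otimes> t \<otimes> inv g \<in> {x, z, v}"
        using third_reflection_only[OF x z nc involution_conj[OF that]] by (simp add: v_def)
      moreover have "g \<otimes> t = g \<otimes> t \<otimes> inv g \<otimes> g"
        using that by (simp add: m_assoc)
      ultimately show ?thesis by auto
    qed
    \<comment> \<open>\<open>t\<close> brings the conjugate of \<open>x\<close> back to
      \<open>x\<close>: conjugation by \<open>v\<close> exchanges \<open>x\<close> with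
      \<open>z\<close>, and conjugation by \<open>z\<close> exchanges \<open>x\<close> with
      \<open>v\<close>.\<close>
    obtain t where t: "t \<in> ?H" "t \<in> carrier G" "t \<otimes> g \<otimes> x = x \<otimes> (t \<otimes> g)"
    proof -
      consider "g \<otimes> x = x \<otimes> g" | "g \<otimes> x = z \<otimes> g" | "g \<otimes> x = v \<otimes> g" using conj[OF x g] by auto
      then show ?thesis
      proof cases
        case 1
        then show ?thesis using that[of \<one>] g generate.one[of G "{x, z}"] by simp
      next
        case 2
        then have "v \<otimes> g \<otimes> x = (v \<otimes> z) \<otimes> g" using g by (simp add: m_assoc)
        then have "v \<otimes> g \<otimes> x = x \<otimes> (v \<otimes> g)" using g vz by (simp add: m_assoc)
        then show ?thesis using that[of v] vH by simp
      next
        case 3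
        then have "z \<otimes> g \<otimes> x = (z \<otimes> v) \<otimes> g" using g by (simp add: m_assoc)
        then have "z \<otimes> g \<otimes> x = x \<otimes> (z \<otimes> g)" using g zv by (simp add: m_assoc)
        then show ?thesis using that[of z] xH by simp
      qed
    qed
    let ?g = "t \<otimes> g"
    have g': "?g \<in> carrier G" using t g by simp
    \<comment> \<open>With \<open>x\<close> fixed, \<open>z\<close> can only be fixed or sent to
      \<open>v\<close>; in the second case \<open>x\<close> sends it back without disturbing
      \<open>x\<close>.\<close>
    obtain s where s: "s \<in> ?H" "s \<in> carrier G" "s \<otimes> ?g \<otimes> x = x \<otimes> (s \<otimes> ?g)" "s \<otimes> ?g \<otimes> z = z \<otimes> (s \<otimes> ?g)"
    proof -
      consider "?g \<otimes> z = x \<otimes> ?g" | "?g \<otimes> z = z \<otimes> ?g" | "?g \<otimes> z = v \<otimes> ?g" using conj[OF z g'] by auto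
      then show ?thesis
      proof cases
        case 1
        then have "?g \<otimes> z = ?g \<otimes> x" using t by simp
        then have "z = x" using g' by simp
        then show ?thesis using nc by simp
      next
        case 2
        then show ?thesis using that[of \<one>] g' t generate.one[of G "{x, z}"] by simp
      next
        case 3
        have "x \<otimes> ?g \<otimes> z = (x \<otimes> v) \<otimes> ?g" using 3 g' by (simp add: m_assoc del: m_assoc[of t g])
        then have "x \<otimes> ?g \<otimes> z = z \<otimes> (x \<otimes> ?g)" using g' unfolding xv by (simp add: m_assoc)
        moreover have "x \<otimes> ?g \<otimes> x = x \<otimes> (x \<otimes> ?g)" using t(3) g' by (metis m_assoc \<open>x \<in> carrier G\<close>)
        ultimately show ?thesis using that[of x] xH by simp
      qed
    qed
    have "s \<otimes> ?g = \<one>"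
      using central_in_reflections_eq_one[OF x z nc _ s(3,4)] s g' by simp
    then have "s \<otimes> t \<otimes> g = \<one>" using s t g by (simp add: m_assoc)
    then have "g = inv (s \<otimes> t)" using s t g by (metis inv_equality m_closed inv_inv)
    then show "g \<in> ?H" using s t by (simp add: subgroup.m_closed[OF sub] subgroup.m_inv_closed[OF sub] del: inv_mult_group)
  qed
qed

end

subsection \<open>Commuting involutions\<close>

locale A3_commuting = A3_group +
  assumes involutions_commute: "\<lbrakk>involution u; involution v\<rbrakk> \<Longrightarrow> u \<otimes> v = v \<otimes> u"
begin

text \<open>Since involutions commute, the elements of square \<open>\<one>\<close> form a normal
  subgroup \<open>E\<close>, and the cells are the cosets \<open>E y^k\<close>. The involution
  \<open>x\<close> lies in \<open>E\<close> and fixes every cell, so the eigenvalue is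
  \<open>1 + 2 cos (2 pi / n)\<close>. Odd order keeps the cells apart: \<open>E\<close> contains no
  nontrivial power of \<open>y\<close>.\<close>

lemma odd_ord_cases:
  assumes x: "involution x" and y: "y \<in> carrier G" "odd (ord y)"
  shows "ord y \<in> {1, 3}"
proof (cases "ord y = 1")
  case False
  let ?n = "ord y"
  define E where "E = {a \<in> carrier G. a \<otimes> a = \<one>}"
  have E_comm: "a \<otimes> b = b \<otimes> a" if "a \<in> E" "b \<in> E" for a b
    using that involutions_commute[of a b] by (cases "a = \<one>"; cases "b = \<one>") (auto simp: E_def)
  have E_mult: "a \<otimes> b \<in> E" if "a \<in> E" "b \<in> E" for a b
  proof -
    have "a \<otimes> b \<otimes> (a \<otimes> b) = a \<otimes> b \<otimes> (b \<otimes> a)" using E_comm that by simp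
    also have "\<dots> = \<one>" using that by (simp add: E_def m_assoc cancel_left_pair)
    finally show ?thesis using that by (simp add: E_def)
  qed
  have E_conj: "g \<otimes> a \<otimes> inv g \<in> E" if "a \<in> E" "g \<in> carrier G" for a g
    using that by (simp add: E_def m_assoc cancel_left_pair cancel_left_pair[OF l_inv])
  have yy: "y \<otimes> y \<noteq> \<one>"
  proof
    assume "y \<otimes> y = \<one>"
    then have "ord y dvd 2" using pow_eq_id[of y 2] y by (simp add: numeral_2_eq_2)
    then have "ord y \<le> 2" by (auto dest: dvd_imp_le)
    then have "ord y = 0 \<or> ord y = 1 \<or> ord y = 2" by linarith
    then show False using y False ord_pos[of y] by auto
  qed
  have x': "x \<in> carrier G" "x \<otimes> x = \<one>" "x \<noteq> \<one>" "x \<in> E" using x by (auto simp: E_def)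
  have n: "?n > 0" using ord_pos y by simp
  have step: "y \<otimes> (a \<otimes> y [^] k) = (y \<otimes> a \<otimes> inv y) \<otimes> y [^] (k + 1)"
      "inv y \<otimes> (a \<otimes> y [^] k) = (inv y \<otimes> a \<otimes> inv (inv y)) \<otimes> y [^] (k - 1)"
    if "a \<in> carrier G" for a and k :: int
  proof -
    have "y [^] (k + 1) = y \<otimes> y [^] k" "y [^] (k - 1) = inv y \<otimes> y [^] k"
      using y int_pow_mult[of y 1 k] int_pow_mult[of y "-1" k] by (simp_all add: int_pow_neg add.commute)
    then show "y \<otimes> (a \<otimes> y [^] k) = (y \<otimes> a \<otimes> inv y) \<otimes> y [^] (k + 1)"
      "inv y \<otimes> (a \<otimes> y [^] k) = (inv y \<otimes> a \<otimes> inv (inv y)) \<otimes> y [^] (k - 1)"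
      using y that by (simp_all add: m_assoc cancel_left_pair[OF l_inv] cancel_left_pair[OF r_inv])
  qed
  have "?n \<in> {1, 2, 3, 4, 6}"
  proof (rule cyclic_cells_imp[where R = "\<lambda>g k. \<exists>a\<in>E. g = a \<otimes> y [^] k" and \<epsilon> = 1,
        OF x'(1-3) y(1) yy n])
    show "\<exists>a\<in>E. \<one> = a \<otimes> y [^] (0::int)" by (auto simp: E_def)
  next
    fix g and j k :: int
    assume "\<exists>a\<in>E. g = a \<otimes> y [^] j" "\<exists>a\<in>E. g = a \<otimes> y [^] k"
    then obtain a b where ab: "a \<in> E" "b \<in> E" "a \<otimes> y [^] j = b \<otimes> y [^] k" by auto
    have [simp]: "a \<in> carrier G" "b \<in> carrier G" "a \<otimes> a = \<one>" using ab by (auto simp: E_def)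
    have "y [^] (j - k) = y [^] j \<otimes> inv (y [^] k)" using y by (simp add: int_pow_diff)
    also have "\<dots> = a \<otimes> (a \<otimes> y [^] j) \<otimes> inv (y [^] k)"
      using y cancel_left_pair[of a a "y [^] j"] by simp
    also have "\<dots> = a \<otimes> b" unfolding ab(3) using y by (simp add: m_assoc)
    finally have "y [^] (j - k) \<in> E" using E_mult[OF ab(1,2)] by simp
    then have "y [^] (j - k) \<otimes> y [^] (j - k) = \<one>" by (simp add: E_def)
    then have "y [^] (2 * (j - k)) = \<one>" unfolding mult_2 using int_pow_mult[OF y(1)] by metis
    then have "int ?n dvd 2 * (j - k)" using int_pow_eq_id y by blast
    moreover have "coprime (int ?n) 2" using y(2) by simp
    ultimately show "int ?n dvd j - k" by (metis coprime_dvd_mult_right_iff)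
  next
    fix g and k :: int assume "\<exists>a\<in>E. g = a \<otimes> y [^] k"
    then obtain a where a: "a \<in> E" "g = a \<otimes> y [^] k" by auto
    then have "x \<otimes> g = (x \<otimes> a) \<otimes> y [^] k" using x' y by (simp add: m_assoc E_def)
    then have "\<exists>a\<in>E. x \<otimes> g = a \<otimes> y [^] k" using E_mult[OF x'(4) a(1)] by blast
    then show "\<exists>d. (\<exists>a\<in>E. x \<otimes> g = a \<otimes> y [^] (k + d)) \<and>
        cos (2 * pi * of_int (k + d) / ?n) = (1::int) * cos (2 * pi * k / ?n)"
      by (intro exI[of _ 0]) simp
    have "a \<in> carrier G" using a by (simp add: E_def)
    then have "(\<exists>a\<in>E. y \<otimes> g = a \<otimes> y [^] (k + 1)) \<and> (\<exists>a\<in>E. inv y \<otimes> g = a \<otimes> y [^] (k - 1))"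
      unfolding a(2) using step[of a k] E_conj[OF a(1)] y by (metis inv_closed)
    then show "(\<exists>a\<in>E. y \<otimes> g = a \<otimes> y [^] (k + 1)) \<and> (\<exists>a\<in>E. inv y \<otimes> g = a \<otimes> y [^] (k - 1)) \<or>
        (\<exists>a\<in>E. y \<otimes> g = a \<otimes> y [^] (k - 1)) \<and> (\<exists>a\<in>E. inv y \<otimes> g = a \<otimes> y [^] (k + 1))" by blast
  qed
  then show ?thesis using y(2) by auto
qed simp

text \<open>Let \<open>t = y^2\<close> and let \<open>p\<close> be the product of \<open>x\<close>
  and its conjugate by \<open>y\<close>. If \<open>t = p\<close>, then \<open>x y\<close> has square
  \<open>p t = \<one>\<close>, so it is an involution commuting with \<open>x\<close>, and then so
  does \<open>y\<close>. Otherwise \<open>t = 1\<close> and \<open>p = -1\<close> can be imposed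
  simultaneously; then \<open>y\<close> has square 1 and anticommutes with \<open>x\<close>, and the
  connection set acts as \<open>x + 2 y\<close>, whose square is 5.\<close>

lemma order_4_commutes:
  assumes x: "involution x" and y: "y \<in> carrier G" and y4: "y \<otimes> y \<otimes> (y \<otimes> y) = \<one>"
  shows "x \<otimes> y = y \<otimes> x"
proof (rule ccontr)
  assume nc: "x \<otimes> y \<noteq> y \<otimes> x"
  define t where "t = y \<otimes> y"
  define x' where "x' = y \<otimes> x \<otimes> inv y"
  define p where "p = x \<otimes> x'"
  have [simp]: "x \<in> carrier G" "y \<in> carrier G" "t \<in> carrier G" "x' \<in> carrier G" "p \<in> carrier G"
    using x y by (simp_all add: t_def x'_def p_def)
  have y1: "y \<noteq> \<one>" using nc by auto
  have tt: "t \<otimes> t = \<one>" using y4 by (simp add: t_def)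
  have t1: "t \<noteq> \<one>" using involutions_commute[OF x, of y] y nc y1 by (auto simp: t_def)
  have t: "involution t" using tt t1 by simp
  have x': "involution x'" using involution_conj[OF x y] by (simp add: x'_def)
  have xx: "x \<otimes> x = \<one>" "x' \<otimes> x' = \<one>" using x x' by auto
  note cl = cancel_left_pair[OF xx(1)] cancel_left_pair[OF xx(2)] cancel_left_pair[OF tt]
  have x'x: "x \<otimes> x' = x' \<otimes> x" using involutions_commute[OF x x'] .
  have tx: "t \<otimes> x = x \<otimes> t" using involutions_commute[OF t x] .
  have yx: "y \<otimes> x = x' \<otimes> y" by (simp add: x'_def m_assoc)
  have yx': "y \<otimes> x' = x \<otimes> y"
  proof -
    have "y \<otimes> x' = t \<otimes> x \<otimes> inv y" by (simp add: x'_def t_def m_assoc)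
    also have "\<dots> = x \<otimes> y" unfolding tx by (simp add: t_def m_assoc)
    finally show ?thesis .
  qed
  have "x' \<noteq> x" using yx nc by auto
  then have p1: "p \<noteq> \<one>" using xx(1) by (metis p_def inv_equality inv_involution \<open>x \<in> carrier G\<close> \<open>x' \<in> carrier G\<close> xx(2))
  have iy: "y \<noteq> t \<otimes> y" using t1 by simp
  have pair: "y \<otimes> (t \<otimes> y) = \<one>" using y4 by (simp add: t_def m_assoc)
  show False
  proof (cases "t = p")
    case True
    have "(x \<otimes> y) \<otimes> (x \<otimes> y) = x \<otimes> (y \<otimes> x) \<otimes> y" by (simp add: m_assoc)
    also have "\<dots> = p \<otimes> t" unfolding yx by (simp add: p_def t_def m_assoc)
    also have "\<dots> = \<one>" using tt True by simp
    finally have "(x \<otimes> y) \<otimes> (x \<otimes> y) = \<one>" .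
    moreover have "x \<otimes> y \<noteq> \<one>" using nc one_pair_commute[of x y] by auto
    ultimately have "x \<otimes> (x \<otimes> y) = x \<otimes> y \<otimes> x" using involutions_commute[OF x, of "x \<otimes> y"] by simp
    then have "x \<otimes> (x \<otimes> y) = x \<otimes> (y \<otimes> x)" by (simp add: m_assoc)
    then show False using nc by simp
  next
    case False
    let ?S = "{x, y, t \<otimes> y}"
    have S: "connection_set G ?S" "card ?S = 3"
      using connection_set_inverse_pair[of x, OF _ _ _ _ _ pair iy] x by auto
    \<comment> \<open>On \<open>f\<close> the central involutions \<open>t\<close> and \<open>p\<close> act as \<open>1\<close> and \<open>-1\<close>.\<close>
    define d where "d g = unit_mass G g + unit_mass G (t \<otimes> g)" for g
    define f where "f g = d g - d (p \<otimes> g)" for g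
    have pp: "p \<otimes> p = \<one>" using involution_mult[OF x x' x'x] \<open>x' \<noteq> x\<close> by (simp add: p_def)
    then have tp: "t \<otimes> p = p \<otimes> t" using involutions_commute[OF t, of p] p1 by simp
    have past: "t \<otimes> (p \<otimes> g) = p \<otimes> (t \<otimes> g)" "t \<otimes> (x \<otimes> g) = x \<otimes> (t \<otimes> g)" "t \<otimes> (y \<otimes> g) = y \<otimes> (t \<otimes> g)"
      "y \<otimes> (x \<otimes> g) = p \<otimes> (x \<otimes> (y \<otimes> g))" "y \<otimes> (y \<otimes> g) = t \<otimes> g"
      if "g \<in> carrier G" for g
    proof -
      show "t \<otimes> (p \<otimes> g) = p \<otimes> (t \<otimes> g)" "t \<otimes> (x \<otimes> g) = x \<otimes> (t \<otimes> g)"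
        using that tp tx by (simp_all add: m_assoc[symmetric])
      show "t \<otimes> (y \<otimes> g) = y \<otimes> (t \<otimes> g)" "y \<otimes> (y \<otimes> g) = t \<otimes> g" using that by (simp_all add: t_def m_assoc)
      have "y \<otimes> (x \<otimes> g) = x' \<otimes> (y \<otimes> g)" using that yx by (simp add: m_assoc[symmetric])
      also have "x' = p \<otimes> x" unfolding p_def x'x by (simp add: m_assoc xx)
      finally show "y \<otimes> (x \<otimes> g) = p \<otimes> (x \<otimes> (y \<otimes> g))" using that by (simp add: m_assoc)
    qed
    have dt: "d (t \<otimes> g) = d g" if "g \<in> carrier G" for g
      using that by (simp add: d_def cl)
    have ft: "f (t \<otimes> g) = f g" and fp: "f (p \<otimes> g) = - f g" if "g \<in> carrier G" for g
      using that dt[of g] dt[of "p \<otimes> g"] by (simp_all add: f_def past cancel_left_pair[OF pp])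
    have A: "neighbour_sum G ?S f g = f (x \<otimes> g) + 2 * f (y \<otimes> g)" if "g \<in> carrier G" for g
      unfolding neighbour_sum_triple[OF S(2)] using that by (simp add: m_assoc ft)
    have "neighbour_sum G ?S (neighbour_sum G ?S f) g
        = of_int 0 * neighbour_sum G ?S f g + of_int 5 * f g" if g: "g \<in> carrier G" for g
    proof -
      have "neighbour_sum G ?S (neighbour_sum G ?S f) g
        = f (x \<otimes> (x \<otimes> g)) + 2 * f (y \<otimes> (x \<otimes> g)) + (f (x \<otimes> (y \<otimes> g)) + 2 * f (y \<otimes> (y \<otimes> g)))
          + (f (x \<otimes> (t \<otimes> y \<otimes> g)) + 2 * f (y \<otimes> (t \<otimes> y \<otimes> g)))"
        using g unfolding neighbour_sum_triple[OF S(2), of _ "neighbour_sum G ?S f"]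
        by (subst (1 2 3) A) simp_all
      also have "x \<otimes> (t \<otimes> y \<otimes> g) = t \<otimes> (x \<otimes> (y \<otimes> g))" using g by (simp add: m_assoc past)
      also have "y \<otimes> (t \<otimes> y \<otimes> g) = g" using g pair by (simp add: m_assoc[symmetric])
      finally show ?thesis using g by (simp add: past(4,5) ft fp cl)
    qed
    moreover have "f \<one> \<noteq> 0"
    proof -
      have "t \<otimes> p \<noteq> \<one>" using False tt by (metis inv_equality inv_involution \<open>t \<in> carrier G\<close> \<open>p \<in> carrier G\<close> pp)
      then show ?thesis using p1 t1 by (simp add: f_def d_def unit_mass_def)
    qed
    ultimately obtain k :: int where "k * k = 5"
      using quadratic_has_root_in_Ints[OF S one_closed, of f 0 5] by auto
    then show False using not_between_squares[of 2 5 k] by simp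
  qed
qed

text \<open>If the product is nontrivial, the three commuting conjugates are independent, and some
  function has the signs -1, 1, 1 under them. This \<open>f\<close> and the sum \<open>u\<close> of
  its two translates by \<open>y\<close> and \<open>y^2\<close> obey \<open>A f = u - f\<close> and
  \<open>A u = 2 u + 2 f\<close>: trace 1, determinant -4, hence discriminant 17.\<close>

lemma order_3_conjugates:
  assumes x: "involution x" and y: "y \<in> carrier G" and y3: "y \<otimes> y \<otimes> y = \<one>"
    and nc: "x \<otimes> y \<noteq> y \<otimes> x"
  shows "x \<otimes> (y \<otimes> x \<otimes> inv y) \<otimes> (inv y \<otimes> x \<otimes> y) = \<one>"
proof (rule ccontr)
  assume v_neq: "\<not> ?thesis"
  define x1 where "x1 = y \<otimes> x \<otimes> inv y"
  define x2 where "x2 = inv y \<otimes> x \<otimes> y"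
  have [simp]: "x \<in> carrier G" "y \<in> carrier G" "x1 \<in> carrier G" "x2 \<in> carrier G"
    using x y by (simp_all add: x1_def x2_def)
  have x1: "involution x1" using involution_conj[OF x y] by (simp add: x1_def)
  have x2: "involution x2" using involution_conj[OF x, of "inv y"] y by (simp add: x2_def)
  have xx: "x \<otimes> x = \<one>" "x1 \<otimes> x1 = \<one>" "x2 \<otimes> x2 = \<one>" using x x1 x2 by auto
  note cl = cancel_left_pair[OF xx(1)] cancel_left_pair[OF xx(2)] cancel_left_pair[OF xx(3)]
  have iy: "inv y = y \<otimes> y" using y3 by (intro inv_equality) simp_all
  have yx: "y \<otimes> x = x1 \<otimes> y" by (simp add: x1_def m_assoc)
  have y'x: "y \<otimes> y \<otimes> x = x2 \<otimes> (y \<otimes> y)" by (simp add: x2_def m_assoc flip: iy)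
  have x1x: "x1 \<noteq> x" using yx nc by auto
  have x2x: "x2 \<noteq> x"
  proof
    assume "x2 = x"
    then have "y \<otimes> x = y \<otimes> x2" by simp
    also have "\<dots> = x \<otimes> y" by (simp add: x2_def m_assoc cancel_left_pair[OF r_inv])
    finally show False using nc by simp
  qed
  have x12: "x1 \<noteq> x2"
  proof
    assume "x1 = x2"
    then have "y \<otimes> (y \<otimes> x \<otimes> inv y) \<otimes> y = y \<otimes> (inv y \<otimes> x \<otimes> y) \<otimes> y" by (simp add: x1_def x2_def)
    then have "y \<otimes> y \<otimes> x = x \<otimes> (y \<otimes> y)" by (simp add: m_assoc cancel_left_pair[OF r_inv])
    then have "x2 \<otimes> (y \<otimes> y) = x \<otimes> (y \<otimes> y)" using y'x by simp
    then show False using x2x by simp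
  qed
  let ?S = "{x, y, y \<otimes> y}"
  have pair: "y \<otimes> (y \<otimes> y) = \<one>" using y3 by (simp add: m_assoc)
  have yyy: "y \<noteq> y \<otimes> y" using nc by auto
  have S: "connection_set G ?S" "card ?S = 3"
    using connection_set_inverse_pair[of x, OF _ _ _ _ _ pair yyy] x by auto
  \<comment> \<open>On \<open>f\<close> the involutions \<open>x, x1, x2\<close> act as \<open>-1, 1, 1\<close>; this is where \<open>x x1 x2 \<noteq> 1\<close> is needed.\<close>
  define h where "h g = unit_mass G g - unit_mass G (x \<otimes> g)" for g
  define e where "e g = h g + h (x1 \<otimes> g)" for g
  define f where "f g = e g + e (x2 \<otimes> g)" for g
  define u where "u g = f (y \<otimes> g) + f (y \<otimes> (y \<otimes> g))" for g
  have past: "x1 \<otimes> (x \<otimes> g) = x \<otimes> (x1 \<otimes> g)" "x2 \<otimes> (x \<otimes> g) = x \<otimes> (x2 \<otimes> g)"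
    "x2 \<otimes> (x1 \<otimes> g) = x1 \<otimes> (x2 \<otimes> g)" "y \<otimes> (x \<otimes> g) = x1 \<otimes> (y \<otimes> g)"
    "y \<otimes> (y \<otimes> (x \<otimes> g)) = x2 \<otimes> (y \<otimes> (y \<otimes> g))" "y \<otimes> (y \<otimes> (y \<otimes> g)) = g"
    if "g \<in> carrier G" for g
  proof -
    show "x1 \<otimes> (x \<otimes> g) = x \<otimes> (x1 \<otimes> g)" "x2 \<otimes> (x \<otimes> g) = x \<otimes> (x2 \<otimes> g)"
      "x2 \<otimes> (x1 \<otimes> g) = x1 \<otimes> (x2 \<otimes> g)" "y \<otimes> (x \<otimes> g) = x1 \<otimes> (y \<otimes> g)"
      "y \<otimes> (y \<otimes> (y \<otimes> g)) = g"
      using that involutions_commute[OF x1 x] involutions_commute[OF x2 x] involutions_commute[OF x2 x1]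
        yx y3
      by (simp_all add: m_assoc[symmetric])
    have "y \<otimes> (y \<otimes> (x \<otimes> g)) = y \<otimes> y \<otimes> x \<otimes> g" using that by (simp add: m_assoc)
    then show "y \<otimes> (y \<otimes> (x \<otimes> g)) = x2 \<otimes> (y \<otimes> (y \<otimes> g))"
      unfolding y'x using that by (simp add: m_assoc)
  qed
  have yx1: "y \<otimes> (x1 \<otimes> g) = x2 \<otimes> (y \<otimes> g)" if "g \<in> carrier G" for g
    using that past(4,5)[of "inv y \<otimes> g"] by (simp add: cancel_left_pair[OF r_inv])
  have fx: "f (x \<otimes> g) = - f g" "f (x1 \<otimes> g) = f g" "f (x2 \<otimes> g) = f g" if "g \<in> carrier G" for g
    using that by (simp_all add: f_def e_def h_def past(1-3) cl)
  have A: "neighbour_sum G ?S f g = u g - f g" if "g \<in> carrier G" for g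
    unfolding neighbour_sum_triple[OF S(2)] using that by (simp add: m_assoc fx u_def)
  have B: "neighbour_sum G ?S u g = 2 * u g + 2 * f g" if "g \<in> carrier G" for g
    unfolding neighbour_sum_triple[OF S(2)] using that
    by (simp add: m_assoc u_def past(4,6) yx1 fx)
  have "neighbour_sum G ?S (neighbour_sum G ?S f) g
      = of_int 1 * neighbour_sum G ?S f g + of_int 4 * f g" if g: "g \<in> carrier G" for g
  proof -
    have "neighbour_sum G ?S (neighbour_sum G ?S f) g = neighbour_sum G ?S (\<lambda>g. u g - f g) g"
      using g unfolding neighbour_sum_triple[OF S(2), of _ "neighbour_sum G ?S f"]
        neighbour_sum_triple[OF S(2), of _ "\<lambda>g. u g - f g"]
      by (subst (1 2 3) A) simp_all
    also have "\<dots> = neighbour_sum G ?S u g - neighbour_sum G ?S f g"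
      by (simp add: neighbour_sum_def sum_subtractf)
    finally show ?thesis unfolding A[OF g] B[OF g] by simp
  qed
  moreover have "f \<one> \<noteq> 0"
  proof -
    have sq: "a \<otimes> b \<noteq> \<one>" if "involution a" "involution b" "a \<noteq> b" for a b
      using that by (metis inv_equality inv_involution)
    have 1: "x \<otimes> x1 \<noteq> \<one>" "x \<otimes> x2 \<noteq> \<one>" "x1 \<otimes> x2 \<noteq> \<one>"
      using sq x x1 x2 x1x x2x x12 by auto
    have 2: "x \<otimes> (x1 \<otimes> x2) \<noteq> \<one>" using v_neq by (simp add: x1_def x2_def m_assoc)
    show ?thesis using 1 2 x x1 x2 by (simp add: f_def e_def h_def unit_mass_def)
  qed
  ultimately obtain k :: int where "k * k = 1 * k + 4"
    using quadratic_has_root_in_Ints[OF S one_closed, of f 1 4] by blast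
  then have "(2 * k - 1) * (2 * k - 1) = 17" by (simp add: algebra_simps)
  then show False using not_between_squares[of 4 17 "2 * k - 1"] by simp
qed

text \<open>Split \<open>y\<close> into commuting parts \<open>s\<close> of order 3 and
  \<open>t\<close> of order 2. As \<open>t\<close> commutes with \<open>x\<close>, the previous
  lemma applies to \<open>x\<close> and to \<open>x t\<close> in place of \<open>x\<close>, both
  with \<open>s\<close>; but the two products of conjugates differ by
  \<open>t^3 = t\<close>.\<close>

lemma order_6_commutes:
  assumes x: "involution x" and y: "y \<in> carrier G" and oy: "ord y = 6"
  shows "x \<otimes> y = y \<otimes> x"
proof (rule ccontr)
  assume nc: "x \<otimes> y \<noteq> y \<otimes> x"
  define t where "t = y [^] (3::nat)"
  define s where "s = y [^] (4::nat)"
  have [simp]: "x \<in> carrier G" "t \<in> carrier G" "s \<in> carrier G"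
    using x y by (simp_all add: t_def s_def)
  have "t \<otimes> t = y [^] (6::nat)" using y by (simp add: t_def nat_pow_mult)
  then have tt: "t \<otimes> t = \<one>" using pow_ord_eq_1[OF y] oy by simp
  have t1: "t \<noteq> \<one>" using pow_eq_id[OF y, of 3] oy by (simp add: t_def)
  have t: "involution t" using tt t1 by simp
  have "s \<otimes> s \<otimes> s = y [^] (12::nat)" using y by (simp add: s_def nat_pow_mult)
  moreover have "y [^] (12::nat) = \<one>" using pow_eq_id[OF y, of 12] oy by simp
  ultimately have s3: "s \<otimes> s \<otimes> s = \<one>" by simp
  \<comment> \<open>The exponents 4 and 3 are chosen so that their sum is 1 modulo 6.\<close>
  have "s \<otimes> t = y [^] (1 + 6::nat)" using y by (simp add: s_def t_def nat_pow_mult)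
  also have "\<dots> = y [^] (1::nat) \<otimes> y [^] (6::nat)" using y by (simp only: nat_pow_mult)
  also have "\<dots> = y" using pow_ord_eq_1[OF y] oy y by simp
  finally have st: "s \<otimes> t = y" .
  have ts: "t \<otimes> s = s \<otimes> t" using y by (simp add: s_def t_def nat_pow_mult)
  have tx: "t \<otimes> x = x \<otimes> t" using involutions_commute[OF t x] .
  have nc': "x \<otimes> s \<noteq> s \<otimes> x"
  proof
    assume xs: "x \<otimes> s = s \<otimes> x"
    have "x \<otimes> y = x \<otimes> s \<otimes> t" using st by (simp add: m_assoc)
    also have "\<dots> = s \<otimes> (x \<otimes> t)" unfolding xs by (simp add: m_assoc)
    also have "\<dots> = s \<otimes> t \<otimes> x" unfolding tx[symmetric] by (simp add: m_assoc)
    finally show False using nc st by simp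
  qed
  have "x \<noteq> t" using nc' ts by auto
  then have xt: "involution (x \<otimes> t)" using involution_mult[OF x t] tx by simp
  have "x \<otimes> t \<otimes> s \<noteq> s \<otimes> (x \<otimes> t)"
  proof
    assume "x \<otimes> t \<otimes> s = s \<otimes> (x \<otimes> t)"
    moreover have "x \<otimes> t \<otimes> s = x \<otimes> s \<otimes> t" by (simp add: m_assoc ts)
    ultimately have "x \<otimes> s \<otimes> t = s \<otimes> x \<otimes> t" by (simp add: m_assoc)
    then show False using nc' by simp
  qed
  from order_3_conjugates[OF xt _ s3 this]
  have a: "x \<otimes> t \<otimes> (s \<otimes> (x \<otimes> t) \<otimes> inv s) \<otimes> (inv s \<otimes> (x \<otimes> t) \<otimes> s) = \<one>" by simp
  have ts': "t \<otimes> inv s = inv s \<otimes> t"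
  proof -
    have "inv s = s \<otimes> s" using s3 by (intro inv_equality) simp_all
    then show ?thesis using ts by (simp add: m_assoc[symmetric]) (simp add: m_assoc ts)
  qed
  have past: "t \<otimes> (s \<otimes> g) = s \<otimes> (t \<otimes> g)" "t \<otimes> (inv s \<otimes> g) = inv s \<otimes> (t \<otimes> g)"
    "t \<otimes> (x \<otimes> g) = x \<otimes> (t \<otimes> g)" if "g \<in> carrier G" for g
    using that ts ts' tx by (simp_all add: m_assoc[symmetric])
  have "x \<otimes> t \<otimes> (s \<otimes> (x \<otimes> t) \<otimes> inv s) \<otimes> (inv s \<otimes> (x \<otimes> t) \<otimes> s)
      = x \<otimes> (s \<otimes> x \<otimes> inv s) \<otimes> (inv s \<otimes> x \<otimes> s) \<otimes> t"
    by (simp add: m_assoc past ts tt cancel_left_pair[OF tt])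
  also have "\<dots> = t" using order_3_conjugates[OF x _ s3 nc'] by simp
  finally show False using a t1 by simp
qed

lemma involution_element_cases:
  assumes x: "involution x" and y: "y \<in> carrier G"
  obtains (commute) "x \<otimes> y = y \<otimes> x" "ord y \<in> {1, 2, 3, 4, 6}"
  | (alternating) "x \<otimes> y \<noteq> y \<otimes> x" "y \<otimes> y \<otimes> y = \<one>"
      "x \<otimes> (y \<otimes> x \<otimes> inv y) \<otimes> (inv y \<otimes> x \<otimes> y) = \<one>"
proof -
  have o: "ord y \<in> {1, 2, 3, 4, 6}"
    using odd_ord_cases[OF x y] even_ord_cases[OF y] by auto
  show ?thesis
  proof (cases "x \<otimes> y = y \<otimes> x")
    case True
    then show ?thesis using commute o by blast
  next
    case False
    have "ord y = 3"
    proof -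
      have "ord y \<noteq> 6" using order_6_commutes[OF x y] False by blast
      moreover have "\<not> ord y dvd 4"
      proof
        assume "ord y dvd 4"
        then have "y [^] (4::nat) = \<one>" using pow_eq_id[OF y] by blast
        then have "y \<otimes> y \<otimes> (y \<otimes> y) = \<one>" using y by (simp add: numeral_eq_Suc m_assoc)
        then show False using order_4_commutes[OF x y] False by blast
      qed
      ultimately show ?thesis using o by auto
    qed
    then have "y [^] (3::nat) = \<one>" using pow_ord_eq_1[OF y] by simp
    then have y3: "y \<otimes> y \<otimes> y = \<one>" using y by (simp add: numeral_3_eq_3)
    then show ?thesis using alternating order_3_conjugates[OF x y y3 False] False by blast
  qed
qed

end

subsection \<open>Normal forms for the symmetric and the alternating group\<close>

text \<open>Elements of both groups are named by the same words, multiplied by the same table;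
  matching names is the isomorphism. The table itself need not be recognised as a group.\<close>

lemma is_iso_of_parametrizations:
  assumes p: "bij_betw p M (carrier G)" and q: "bij_betw q M (carrier H)"
    and closed: "\<And>m n. \<lbrakk>m \<in> M; n \<in> M\<rbrakk> \<Longrightarrow> mul m n \<in> M"
    and p_mult: "\<And>m n. \<lbrakk>m \<in> M; n \<in> M\<rbrakk> \<Longrightarrow> p (mul m n) = p m \<otimes>\<^bsub>G\<^esub> p n"
    and q_mult: "\<And>m n. \<lbrakk>m \<in> M; n \<in> M\<rbrakk> \<Longrightarrow> q (mul m n) = q m \<otimes>\<^bsub>H\<^esub> q n"
  shows "G \<cong> H"
proof -
  let ?p' = "the_inv_into M p"
  have p': "?p' g \<in> M" "p (?p' g) = g" if "g \<in> carrier G" for g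
    using that p by (auto simp: bij_betw_def f_the_inv_into_f the_inv_into_into)
  have p'p: "?p' (p m) = m" if "m \<in> M" for m
    using that p by (simp add: bij_betw_def the_inv_into_f_f)
  have "bij_betw (q \<circ> ?p') (carrier G) (carrier H)"
    using bij_betw_trans[OF bij_betw_the_inv_into[OF p] q] .
  moreover have "q \<circ> ?p' \<in> hom G H"
  proof (rule homI)
    fix g h assume gh: "g \<in> carrier G" "h \<in> carrier G"
    show "(q \<circ> ?p') g \<in> carrier H" using p'(1)[OF gh(1)] q by (auto simp: bij_betw_def)
    have "?p' (g \<otimes>\<^bsub>G\<^esub> h) = ?p' (p (mul (?p' g) (?p' h)))"
      using gh p' p_mult by simp
    also have "\<dots> = mul (?p' g) (?p' h)" using p'p closed p' gh by simp
    finally show "(q \<circ> ?p') (g \<otimes>\<^bsub>G\<^esub> h) = (q \<circ> ?p') g \<otimes>\<^bsub>H\<^esub> (q \<circ> ?p') h"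
      using q_mult p' gh by simp
  qed
  ultimately show ?thesis by (auto simp: is_iso_def iso_def)
qed

definition S3_words :: "(bool \<times> nat) set" where
  "S3_words = UNIV \<times> {0, 1, 2}"

text \<open>The pair \<open>(a, k)\<close> stands for the normal form \<open>x\<^sup>a r\<^sup>k\<close>.\<close>

fun S3_mult :: "bool \<times> nat \<Rightarrow> bool \<times> nat \<Rightarrow> bool \<times> nat" where
  "S3_mult (a, k) (b, l) = (a \<noteq> b, ((if b then 2 * k else k) + l) mod 3)"

fun S3_eval :: "('a, 'b) monoid_scheme \<Rightarrow> 'a \<Rightarrow> 'a \<Rightarrow> bool \<times> nat \<Rightarrow> 'a" where
  "S3_eval G x r (a, k) = (if a then x else \<one>\<^bsub>G\<^esub>) \<otimes>\<^bsub>G\<^esub> r [^]\<^bsub>G\<^esub> k"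

locale S3_relations = group G for G (structure) +
  fixes x r
  assumes in_carrier [simp]: "x \<in> carrier G" "r \<in> carrier G"
    and xx [simp]: "x \<otimes> x = \<one>" and rrr: "r \<otimes> (r \<otimes> r) = \<one>"
    and rx: "r \<otimes> x = x \<otimes> (r \<otimes> r)" and nontrivial: "r \<noteq> \<one>"
begin

abbreviation eval where "eval \<equiv> S3_eval G x r"

lemma reduce:
  "g \<in> carrier G \<Longrightarrow> x \<otimes> (x \<otimes> g) = g"
  "g \<in> carrier G \<Longrightarrow> r \<otimes> (r \<otimes> (r \<otimes> g)) = g"
  "g \<in> carrier G \<Longrightarrow> r \<otimes> (x \<otimes> g) = x \<otimes> (r \<otimes> (r \<otimes> g))"
  using rrr rx by (simp_all flip: m_assoc)

lemma S3_mult_closed: "\<lbrakk>m \<in> S3_words; n \<in> S3_words\<rbrakk> \<Longrightarrow> S3_mult m n \<in> S3_words"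
  by (auto simp: S3_words_def)

lemma eval_mult:
  "\<lbrakk>m \<in> S3_words; n \<in> S3_words\<rbrakk> \<Longrightarrow> eval (S3_mult m n) = eval m \<otimes> eval n"
  by (auto simp: S3_words_def m_assoc reduce rrr rx numeral_2_eq_2)

lemma rr_nontrivial: "r \<otimes> r \<noteq> \<one>"
  using rrr nontrivial by auto

text \<open>In particular \<open>x\<close> is not \<open>\<one>\<close>. A power of \<open>r\<close>
  commutes with \<open>r\<close>, which turns \<open>rx\<close> into \<open>x r = x r^2\<close> and
  \<open>r\<close> into \<open>\<one>\<close>.\<close>

lemma x_not_power: "x \<noteq> r [^] (k :: nat)"
proof
  assume k: "x = r [^] k"
  have "r \<otimes> r [^] k = r [^] k \<otimes> r" by (metis nat_pow_Suc nat_pow_Suc2 in_carrier(2))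
  then have "x \<otimes> r = x \<otimes> (r \<otimes> r)" using rx k by simp
  then show False using nontrivial by simp
qed

lemma eval_inj: "inj_on eval S3_words"
proof (rule inj_onI)
  fix m n assume mn: "m \<in> S3_words" "n \<in> S3_words" "eval m = eval n"
  obtain a k b l where m: "m = (a, k)" and n: "n = (b, l)" by (metis surj_pair)
  have kl: "k \<in> {0, 1, 2}" "l \<in> {0, 1, 2}" using mn m n by (auto simp: S3_words_def)
  have "r [^] i \<otimes> r [^] (3 - i) = \<one>" if "i \<in> {0, 1, 2}" for i :: nat
    using that rrr by (auto simp: nat_pow_mult numeral_eq_Suc m_assoc)
  then have ip: "inv (r [^] i) = r [^] (3 - i)" if "i \<in> {0, 1, 2}" for i :: nat
    using that inv_unique'[of "r [^] i" "r [^] (3 - i)"] by (metis inv_comm inv_equality in_carrier(2) nat_pow_closed)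
  have "a = b"
  proof (rule ccontr)
    assume "a \<noteq> b"
    then consider "x \<otimes> r [^] k = r [^] l" | "x \<otimes> r [^] l = r [^] k"
      using mn(3) m n by (auto split: if_splits)
    then have "x = r [^] (l + (3 - k)) \<or> x = r [^] (k + (3 - l))"
    proof cases
      case 1
      then have "x = r [^] l \<otimes> inv (r [^] k)" by (metis inv_solve_right in_carrier nat_pow_closed)
      then show ?thesis using ip[OF kl(1)] by (simp add: nat_pow_mult)
    next
      case 2
      then have "x = r [^] k \<otimes> inv (r [^] l)" by (metis inv_solve_right in_carrier nat_pow_closed)
      then show ?thesis using ip[OF kl(2)] by (simp add: nat_pow_mult)
    qed
    then show False using x_not_power by blast
  qed
  then have "r [^] k = r [^] l" using mn(3) m n by (auto split: if_splits)
  then have "k = l"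
    using kl nontrivial rr_nontrivial by (auto simp: numeral_2_eq_2)
  then show "m = n" using \<open>a = b\<close> m n by simp
qed

lemma eval_image: "eval ` S3_words = generate G {x, r}"
proof
  have "subgroup (generate G {x, r}) G" by (rule generate_is_subgroup) simp
  then interpret gen: subgroup "generate G {x, r}" G .
  have mem: "x \<in> generate G {x, r}" "r \<in> generate G {x, r}" by (auto intro: generate.incl)
  then have "r [^] (k::nat) \<in> generate G {x, r}" for k
    by (induction k) auto
  then show "eval ` S3_words \<subseteq> generate G {x, r}" using mem by (auto simp: S3_words_def)
  show "generate G {x, r} \<subseteq> eval ` S3_words"
  proof
    have w: "(a, k) \<in> S3_words" if "k \<in> {0, 1, 2}" for a k using that by (simp add: S3_words_def)
    fix g assume "g \<in> generate G {x, r}"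
    then show "g \<in> eval ` S3_words"
    proof (induction rule: generate.induct)
      case one
      have "\<one> = eval (False, 0)" by simp
      then show ?case using w[of 0] by blast
    next
      case (incl h)
      then have "h = eval (True, 0) \<or> h = eval (False, 1)" by auto
      then show ?case using w[of 0] w[of 1] by blast
    next
      case (inv h)
      have "inv x = x" "inv r = r \<otimes> r" using rrr
        by (auto intro!: inv_equality simp: m_assoc)
      then have "inv h = eval (True, 0) \<or> inv h = eval (False, 2)"
        using inv by (auto simp: numeral_2_eq_2)
      then show ?case using w[of 0] w[of 2] by blast
    next
      case (eng h1 h2)
      then obtain m n where mn: "m \<in> S3_words" "n \<in> S3_words" "h1 = eval m" "h2 = eval n" by blast
      then have "h1 \<otimes> h2 = eval (S3_mult m n)" using eval_mult by metis
      then show ?case using S3_mult_closed[OF mn(1,2)] by blast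
    qed
  qed
qed

lemma bij_eval:
  "carrier G = generate G {x, r} \<Longrightarrow> bij_betw eval S3_words (carrier G)"
  using eval_inj eval_image by (simp add: bij_betw_def)

lemma card_generate: "card (generate G {x, r}) = 6"
  using card_image[OF eval_inj] eval_image by (simp add: S3_words_def card_cartesian_product)

end

lemma S3_relations_is_iso:
  assumes G: "S3_relations G x r" "carrier G = generate G {x, r}"
    and H: "S3_relations H x' r'" "carrier H = generate H {x', r'}"
  shows "G \<cong> H"
  using is_iso_of_parametrizations[OF S3_relations.bij_eval[OF G] S3_relations.bij_eval[OF H],
      of S3_mult] S3_relations.S3_mult_closed[OF G(1)] S3_relations.eval_mult[OF G(1)]
      S3_relations.eval_mult[OF H(1)]
  by simp

text \<open>Witnesses are the transposition \<open>(1 2)\<close> and the 3-cycle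
  \<open>(1 2) (2 3)\<close>. They generate by counting: the words already give 6 = 3!
  elements.\<close>

lemma S3_relations_sym_group:
  obtains x r where "S3_relations (sym_group 3) x r"
    "carrier (sym_group 3) = generate (sym_group 3) {x, r}"
proof -
  let ?x = "transpose 1 2 :: nat \<Rightarrow> nat" and ?r = "transpose 1 2 \<circ> transpose 2 3 :: nat \<Rightarrow> nat"
  interpret S: group "sym_group 3" by (rule sym_group_is_group)
  have r: "S3_relations (sym_group 3) ?x ?r"
  proof unfold_locales
    show "?x \<in> carrier (sym_group 3)" "?r \<in> carrier (sym_group 3)"
      by (auto simp: sym_group_carrier intro!: permutes_swap_id permutes_compose)
    show "?x \<otimes>\<^bsub>sym_group 3\<^esub> ?x = \<one>\<^bsub>sym_group 3\<^esub>" by (simp add: sym_group_mult sym_group_one)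
    show "?r \<otimes>\<^bsub>sym_group 3\<^esub> (?r \<otimes>\<^bsub>sym_group 3\<^esub> ?r) = \<one>\<^bsub>sym_group 3\<^esub>"
      by (auto simp: sym_group_mult sym_group_one fun_eq_iff transpose_def)
    show "?r \<otimes>\<^bsub>sym_group 3\<^esub> ?x = ?x \<otimes>\<^bsub>sym_group 3\<^esub> (?r \<otimes>\<^bsub>sym_group 3\<^esub> ?r)"
      by (auto simp: sym_group_mult fun_eq_iff transpose_def)
    have "?r 1 = 2" by (simp add: transpose_def)
    then show "?r \<noteq> \<one>\<^bsub>sym_group 3\<^esub>" by (metis sym_group_one id_apply one_eq_numeral_iff num.distinct(1))
  qed
  have fin: "finite (carrier (sym_group 3))" using sym_group_card_carrier[of 3]
    by (metis card.infinite fact_nonzero)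
  have sub: "generate (sym_group 3) {?x, ?r} \<subseteq> carrier (sym_group 3)"
    using S.generate_incl S3_relations.in_carrier[OF r] by simp
  have "carrier (sym_group 3) = generate (sym_group 3) {?x, ?r}"
    using card_subset_eq[OF fin sub] S3_relations.card_generate[OF r] sym_group_card_carrier[of 3]
    by (simp add: fact_numeral)
  then show ?thesis using that r by blast
qed

section \<open>Words in the alternating group of degree 4\<close>

definition A4_words :: "(bool \<times> bool \<times> nat) set" where
  "A4_words = UNIV \<times> UNIV \<times> {0, 1, 2}"

text \<open>The triple \<open>(a, b, k)\<close> stands for the normal form \<open>x\<^sup>a (y x y\<^sup>2)\<^sup>b y\<^sup>k\<close>.\<close>

fun A4_mult :: "bool \<times> bool \<times> nat \<Rightarrow> bool \<times> bool \<times> nat \<Rightarrow> bool \<times> bool \<times> nat" where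
  "A4_mult (a, b, k) (c, d, l) =
     (a \<noteq> (if k = 0 then c else if k = 1 then d else c \<noteq> d),
      b \<noteq> (if k = 0 then d else if k = 1 then c \<noteq> d else c), (k + l) mod 3)"

fun A4_eval :: "('a, 'b) monoid_scheme \<Rightarrow> 'a \<Rightarrow> 'a \<Rightarrow> bool \<times> bool \<times> nat \<Rightarrow> 'a" where
  "A4_eval G x y (a, b, k) =
     (if a then x else \<one>\<^bsub>G\<^esub>) \<otimes>\<^bsub>G\<^esub>
       ((if b then y \<otimes>\<^bsub>G\<^esub> x \<otimes>\<^bsub>G\<^esub> (y \<otimes>\<^bsub>G\<^esub> y) else \<one>\<^bsub>G\<^esub>) \<otimes>\<^bsub>G\<^esub> y [^]\<^bsub>G\<^esub> k)"

text \<open>The presentation of A4 as a (2,3,3) triangle group. Its quotients satisfy these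
  relations too, and the spectrum is computed in this generality; noncommutation is added where
  elements have to be told apart.\<close>

locale A4_relations = group G for G (structure) +
  fixes x y
  assumes in_carrier [simp]: "x \<in> carrier G" "y \<in> carrier G"
    and xx [simp]: "x \<otimes> x = \<one>" and yyy: "y \<otimes> (y \<otimes> y) = \<one>"
    and xyxyxy: "x \<otimes> y \<otimes> (x \<otimes> y) \<otimes> (x \<otimes> y) = \<one>"
begin

definition x1 where "x1 = y \<otimes> x \<otimes> (y \<otimes> y)"
definition x2 where "x2 = y \<otimes> y \<otimes> x \<otimes> y"

abbreviation eval where "eval \<equiv> A4_eval G x y"

lemma conj_in_carrier [simp]: "x1 \<in> carrier G" "x2 \<in> carrier G"
  by (simp_all add: x1_def x2_def)

lemma reduce_xy:
  "g \<in> carrier G \<Longrightarrow> x \<otimes> (x \<otimes> g) = g"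
  "g \<in> carrier G \<Longrightarrow> y \<otimes> (y \<otimes> (y \<otimes> g)) = g"
  using yyy by (simp_all flip: m_assoc)

lemma conj_squares [simp]: "x1 \<otimes> x1 = \<one>" "x2 \<otimes> x2 = \<one>"
  using yyy by (simp_all add: x1_def x2_def m_assoc reduce_xy)

text \<open>The word \<open>x (y x y^2) (y^2 x y)\<close> collapses to \<open>(x y)^3\<close> by
  \<open>yyy\<close>. This is the link to the condition on the three conjugates of \<open>x\<close>,
  and it makes \<open>x\<close>, \<open>x1\<close>, \<open>x2\<close> together with
  \<open>\<one>\<close> a Klein four-group, or a quotient of one.\<close>

lemma conj_product: "x \<otimes> (x1 \<otimes> x2) = \<one>"
  using xyxyxy by (simp add: x1_def x2_def m_assoc reduce_xy)

lemma x2_eq: "x2 = x \<otimes> x1" and x1_x: "x1 \<otimes> x = x \<otimes> x1"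
proof -
  have "x = x1 \<otimes> x2"
    using conj_product reduce_xy(1)[of "x1 \<otimes> x2"] by simp
  then have "x1 \<otimes> x = x2" using cancel_left_pair[OF conj_squares(1), of x2] by simp
  moreover have "x \<otimes> x2 = x1"
    using \<open>x = x1 \<otimes> x2\<close> by (metis conj_in_carrier conj_squares(2) m_assoc r_one)
  then have "x2 = x \<otimes> x1" using reduce_xy(1)[of x2] by simp
  ultimately show "x2 = x \<otimes> x1" "x1 \<otimes> x = x \<otimes> x1" by simp_all
qed

lemma y_x: "y \<otimes> x = x1 \<otimes> y" and y_x1: "y \<otimes> x1 = x \<otimes> (x1 \<otimes> y)"
proof -
  show "y \<otimes> x = x1 \<otimes> y" using yyy by (simp add: x1_def m_assoc)
  have "y \<otimes> x1 = x2 \<otimes> y" by (simp add: x1_def x2_def m_assoc)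
  then show "y \<otimes> x1 = x \<otimes> (x1 \<otimes> y)" by (simp add: x2_eq m_assoc)
qed

lemma reduce:
  "g \<in> carrier G \<Longrightarrow> x1 \<otimes> (x1 \<otimes> g) = g"
  "g \<in> carrier G \<Longrightarrow> x1 \<otimes> (x \<otimes> g) = x \<otimes> (x1 \<otimes> g)"
  "g \<in> carrier G \<Longrightarrow> y \<otimes> (x \<otimes> g) = x1 \<otimes> (y \<otimes> g)"
  "g \<in> carrier G \<Longrightarrow> y \<otimes> (x1 \<otimes> g) = x \<otimes> (x1 \<otimes> (y \<otimes> g))"
proof -
  assume g: "g \<in> carrier G"
  show "x1 \<otimes> (x1 \<otimes> g) = g" "x1 \<otimes> (x \<otimes> g) = x \<otimes> (x1 \<otimes> g)" "y \<otimes> (x \<otimes> g) = x1 \<otimes> (y \<otimes> g)"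
    using g x1_x y_x by (simp_all flip: m_assoc)
  have "y \<otimes> (x1 \<otimes> g) = y \<otimes> x1 \<otimes> g" using g by (simp add: m_assoc)
  then show "y \<otimes> (x1 \<otimes> g) = x \<otimes> (x1 \<otimes> (y \<otimes> g))" unfolding y_x1 using g by (simp add: m_assoc)
qed

lemma eval_eq:
  "eval (a, b, k) = (if a then x else \<one>) \<otimes> ((if b then x1 else \<one>) \<otimes> y [^] k)"
  by (simp add: x1_def)

lemma A4_mult_closed: "\<lbrakk>m \<in> A4_words; n \<in> A4_words\<rbrakk> \<Longrightarrow> A4_mult m n \<in> A4_words"
  by (cases m; cases n) (auto simp: A4_words_def)

lemma eval_mult:
  assumes "m \<in> A4_words" "n \<in> A4_words"
  shows "eval (A4_mult m n) = eval m \<otimes> eval n"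
proof -
  obtain a b k c d l where m: "m = (a, b, k)" and n: "n = (c, d, l)" by (metis surj_pair)
  have kl: "k \<in> {0, 1, 2}" "l \<in> {0, 1, 2}" using assms m n by (auto simp: A4_words_def)
  note red = m_assoc reduce_xy reduce yyy x1_x y_x y_x1 numeral_2_eq_2
  have y: "y [^] k \<otimes> y [^] l = y [^] ((k + l) mod 3)"
    using kl by (auto simp: red)
  \<comment> \<open>Conjugation by \<open>y\<close> cycles \<open>x\<close>, \<open>x1\<close>,
    \<open>x x1\<close>. On exponents modulo 2 it is \<open>(c, d) \<mapsto> (d, c + d)\<close>, and
    its square is \<open>(c, d) \<mapsto> (c + d, c)\<close>; these are the branches of
    \<open>A4_mult\<close>.\<close>
  have conj: "y [^] k \<otimes> (if c then x else \<one>) \<otimes> (if d then x1 else \<one>)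
     = (if (if k = 0 then c else if k = 1 then d else c \<noteq> d) then x else \<one>) \<otimes>
       (if (if k = 0 then d else if k = 1 then c \<noteq> d else c) then x1 else \<one>) \<otimes> y [^] k"
    using kl(1) by (cases c; cases d) (auto simp: red)
  have V: "(if a then x else \<one>) \<otimes> (if b then x1 else \<one>) \<otimes> ((if c' then x else \<one>) \<otimes> (if d' then x1 else \<one>))
     = (if a \<noteq> c' then x else \<one>) \<otimes> (if b \<noteq> d' then x1 else \<one>)" for c' d'
    by (cases a; cases b; cases c'; cases d') (simp_all add: red)
  let ?c = "if k = 0 then c else if k = 1 then d else c \<noteq> d"
  let ?d = "if k = 0 then d else if k = 1 then c \<noteq> d else c"
  have e: "eval (a, b, k) = (if a then x else \<one>) \<otimes> (if b then x1 else \<one>) \<otimes> y [^] k" for a b k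
    unfolding eval_eq by (simp add: m_assoc)
  have "eval m \<otimes> eval n
      = (if a then x else \<one>) \<otimes> (if b then x1 else \<one>) \<otimes>
        (y [^] k \<otimes> (if c then x else \<one>) \<otimes> (if d then x1 else \<one>)) \<otimes> y [^] l"
    unfolding m n e by (simp add: m_assoc)
  also have "\<dots> = ((if a then x else \<one>) \<otimes> (if b then x1 else \<one>) \<otimes>
      ((if ?c then x else \<one>) \<otimes> (if ?d then x1 else \<one>))) \<otimes> (y [^] k \<otimes> y [^] l)"
    unfolding conj by (simp add: m_assoc)
  also have "\<dots> = eval (A4_mult m n)"
    unfolding V y m n A4_mult.simps e by simp
  finally show ?thesis by simp
qed

end

locale A4_nontrivial_relations = A4_relations +
  assumes nontrivial: "x \<otimes> y \<noteq> y \<otimes> x"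
begin

lemma ne: "x \<noteq> \<one>" "x1 \<noteq> \<one>" "x \<noteq> x1" "y \<noteq> \<one>" "y \<otimes> y \<noteq> \<one>"
proof -
  show "x \<noteq> \<one>" "y \<noteq> \<one>" using nontrivial by auto
  then show "y \<otimes> y \<noteq> \<one>" using yyy by auto
  show "x1 \<noteq> \<one>" using y_x nontrivial \<open>x \<noteq> \<one>\<close> by auto
  show "x \<noteq> x1" using y_x nontrivial by auto
qed

text \<open>Different exponents of \<open>y\<close> would place \<open>y\<close> or
  \<open>y^2\<close> in the four-group, where every square is \<open>\<one>\<close>, against
  \<open>yyy\<close> and \<open>y \<noteq> \<one>\<close>. Inside the four-group the products are
  distinct by \<open>ne\<close>.\<close>

lemma eval_inj: "inj_on eval A4_words"
proof (rule inj_onI)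
  fix m n assume mn: "m \<in> A4_words" "n \<in> A4_words" "eval m = eval n"
  obtain a b k c d l where m: "m = (a, b, k)" and n: "n = (c, d, l)" by (metis surj_pair)
  have kl: "k \<in> {0, 1, 2}" "l \<in> {0, 1, 2}" using mn m n by (auto simp: A4_words_def)
  have sq: "v \<otimes> v = \<one>" if "v \<in> {\<one>, x, x1, x \<otimes> x1}" for v
    using that by (auto simp: m_assoc reduce x1_x reduce_xy)
  have "(if a then x else \<one>) \<otimes> (if b then x1 else \<one>) \<otimes> y [^] k = (if c then x else \<one>) \<otimes> (if d then x1 else \<one>) \<otimes> y [^] l"
    using mn(3) unfolding m n eval_eq by (simp add: m_assoc)
  moreover define u where "u = (if a then x else \<one>) \<otimes> (if b then x1 else \<one>)"
  moreover define v where "v = (if c then x else \<one>) \<otimes> (if d then x1 else \<one>)"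
  ultimately have uv: "u \<otimes> y [^] k = v \<otimes> y [^] l" by simp
  have V: "u \<in> {\<one>, x, x1, x \<otimes> x1}" "v \<in> {\<one>, x, x1, x \<otimes> x1}" by (auto simp: u_def v_def)
  then have [simp]: "u \<in> carrier G" "v \<in> carrier G" by auto
  have "v \<otimes> u \<in> {\<one>, x, x1, x \<otimes> x1}"
    using V by (auto simp: m_assoc reduce x1_x reduce_xy)
  from sq[OF this] have vu: "v \<otimes> u \<otimes> (v \<otimes> u) = \<one>" .
  have "v \<otimes> u \<otimes> y [^] k = y [^] l"
    using uv cancel_left_pair[OF sq[OF V(2)], of "y [^] l"] by (simp add: m_assoc)
  then have vu_eq: "v \<otimes> u = y [^] l \<otimes> inv (y [^] k)" by (metis inv_solve_right in_carrier(2) nat_pow_closed m_closed \<open>u \<in> carrier G\<close> \<open>v \<in> carrier G\<close>)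
  have iy: "inv y = y \<otimes> y" "inv (y \<otimes> y) = y" using yyy by (auto intro!: inv_equality simp: m_assoc)
  have "k = l"
  proof (rule ccontr)
    assume "k \<noteq> l"
    then have "v \<otimes> u = y \<or> v \<otimes> u = y \<otimes> y"
      using vu_eq kl by (auto simp: iy numeral_2_eq_2 m_assoc yyy reduce_xy)
    then have "y \<otimes> y = \<one> \<or> y \<otimes> y \<otimes> (y \<otimes> y) = \<one>" using vu by metis
    then show False using ne(4,5) yyy by (auto simp: m_assoc)
  qed
  then have "u = v" using uv by simp
  have D: "x \<otimes> x1 \<noteq> \<one>" "x \<noteq> \<one>" "x1 \<noteq> \<one>" "x \<noteq> x1" "x \<otimes> x1 \<noteq> x" "x \<otimes> x1 \<noteq> x1"
    using reduce_xy(1)[of x1] ne(1-3) by auto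
  have "a = c \<and> b = d"
    using \<open>u = v\<close> unfolding u_def v_def
    by (cases a; cases b; cases c; cases d)
       (simp_all only: if_True if_False one_closed l_one r_one in_carrier conj_in_carrier simp_thms
         D D[symmetric])
  then show "m = n" using \<open>k = l\<close> m n by simp
qed

lemma eval_image: "eval ` A4_words = generate G {x, y}"
proof
  have "subgroup (generate G {x, y}) G" by (rule generate_is_subgroup) simp
  then interpret gen: subgroup "generate G {x, y}" G .
  have mem: "x \<in> generate G {x, y}" "y \<in> generate G {x, y}" by (auto intro: generate.incl)
  then have "y [^] (k::nat) \<in> generate G {x, y}" for k
    by (induction k) auto
  then show "eval ` A4_words \<subseteq> generate G {x, y}" using mem by (auto simp: A4_words_def)
  show "generate G {x, y} \<subseteq> eval ` A4_words"
  proof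
    have w: "(a, b, k) \<in> A4_words" if "k \<in> {0, 1, 2}" for a b k using that by (simp add: A4_words_def)
    fix g assume "g \<in> generate G {x, y}"
    then show "g \<in> eval ` A4_words"
    proof (induction rule: generate.induct)
      case one
      have "\<one> = eval (False, False, 0)" by simp
      then show ?case using w[of 0] by blast
    next
      case (incl h)
      then have "h = eval (True, False, 0) \<or> h = eval (False, False, 1)" by auto
      then show ?case using w[of 0] w[of 1] by blast
    next
      case (inv h)
      have "inv x = x" "inv y = y \<otimes> y" using yyy
        by (auto intro!: inv_equality simp: m_assoc)
      then have "inv h = eval (True, False, 0) \<or> inv h = eval (False, False, 2)"
        using inv by (auto simp: numeral_2_eq_2)
      then show ?case using w[of 0] w[of 2] by blast
    next
      case (eng h1 h2)
      then obtain m n where mn: "m \<in> A4_words" "n \<in> A4_words" "h1 = eval m" "h2 = eval n" by blast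
      then have "h1 \<otimes> h2 = eval (A4_mult m n)" using eval_mult by metis
      then show ?case using A4_mult_closed[OF mn(1,2)] by blast
    qed
  qed
qed

lemma bij_eval:
  "carrier G = generate G {x, y} \<Longrightarrow> bij_betw eval A4_words (carrier G)"
  using eval_inj eval_image by (simp add: bij_betw_def)

lemma card_generate: "card (generate G {x, y}) = 12"
  using card_image[OF eval_inj] eval_image by (simp add: A4_words_def card_cartesian_product)

end

lemma A4_relations_is_iso:
  assumes G: "A4_nontrivial_relations G x y" "carrier G = generate G {x, y}"
    and H: "A4_nontrivial_relations H x' y'" "carrier H = generate H {x', y'}"
  shows "G \<cong> H"
proof -
  interpret G: A4_nontrivial_relations G x y by fact
  interpret H: A4_nontrivial_relations H x' y' by fact
  show ?thesis
    using is_iso_of_parametrizations[OF G.bij_eval[OF G(2)] H.bij_eval[OF H(2)], of A4_mult]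
      G.A4_mult_closed G.eval_mult H.eval_mult by simp
qed

lemma fun_eq_id_on_4:
  fixes f :: "nat \<Rightarrow> nat"
  assumes "f 1 = 1" "f 2 = 2" "f 3 = 3" "f 4 = 4" "\<And>i. \<lbrakk>i \<noteq> 1; i \<noteq> 2; i \<noteq> 3; i \<noteq> 4\<rbrakk> \<Longrightarrow> f i = i"
  shows "f = id"
  using assms by (metis eq_id_iff)

text \<open>Witnesses are the double transposition \<open>(1 2) (3 4)\<close> and the 3-cycle
  \<open>(1 2) (2 3)\<close>. The words give 12 elements, the full order of the group.\<close>

lemma A4_relations_alt_group:
  obtains x y where "A4_nontrivial_relations (alt_group 4) x y"
    "carrier (alt_group 4) = generate (alt_group 4) {x, y}"
proof -
  let ?x = "transpose 1 2 \<circ> transpose 3 4 :: nat \<Rightarrow> nat"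
  let ?y = "transpose 1 2 \<circ> transpose 2 3 :: nat \<Rightarrow> nat"
  interpret A: group "alt_group 4" by (rule alt_group_is_group)
  have r: "A4_nontrivial_relations (alt_group 4) ?x ?y"
  proof unfold_locales
    show "?x \<in> carrier (alt_group 4)" "?y \<in> carrier (alt_group 4)"
      by (auto simp: alt_group_carrier evenperm_comp permutation_swap_id evenperm_swap
          intro!: permutes_swap_id permutes_compose)
    show "?x \<otimes>\<^bsub>alt_group 4\<^esub> ?x = \<one>\<^bsub>alt_group 4\<^esub>"
      "?y \<otimes>\<^bsub>alt_group 4\<^esub> (?y \<otimes>\<^bsub>alt_group 4\<^esub> ?y) = \<one>\<^bsub>alt_group 4\<^esub>"
      "?x \<otimes>\<^bsub>alt_group 4\<^esub> ?y \<otimes>\<^bsub>alt_group 4\<^esub> (?x \<otimes>\<^bsub>alt_group 4\<^esub> ?y) \<otimes>\<^bsub>alt_group 4\<^esub>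
        (?x \<otimes>\<^bsub>alt_group 4\<^esub> ?y) = \<one>\<^bsub>alt_group 4\<^esub>"
      unfolding alt_group_mult alt_group_one by (rule fun_eq_id_on_4; simp add: transpose_def)+
    have "(?x \<circ> ?y) 1 \<noteq> (?y \<circ> ?x) 1" by (simp add: transpose_def)
    then show "?x \<otimes>\<^bsub>alt_group 4\<^esub> ?y \<noteq> ?y \<otimes>\<^bsub>alt_group 4\<^esub> ?x" unfolding alt_group_mult by metis
  qed
  have c: "card (carrier (alt_group 4)) = 12" using alt_group_card_carrier[of 4] by (simp add: fact_numeral)
  then have fin: "finite (carrier (alt_group 4))" by (metis card.infinite zero_neq_numeral)
  have sub: "generate (alt_group 4) {?x, ?y} \<subseteq> carrier (alt_group 4)"
    by (rule A.generate_incl) (use A4_relations.in_carrier[OF A4_nontrivial_relations.axioms(1)[OF r]] in auto)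
  have "carrier (alt_group 4) = generate (alt_group 4) {?x, ?y}"
    using card_subset_eq[OF fin sub] A4_nontrivial_relations.card_generate[OF r] c by simp
  then show ?thesis using that r by blast
qed

subsection \<open>Integral spectra\<close>

text \<open>Inversion permutes the three elements, so it either fixes all of them or exchanges two
  and fixes the third.\<close>

lemma (in group) connection_set_cases:
  assumes S: "connection_set G S" "card S = 3"
  obtains (involutions) x y z where "S = {x, y, z}" "involution x" "involution y" "involution z"
      "x \<noteq> y" "x \<noteq> z" "y \<noteq> z"
  | (inverse_pair) x y where "S = {x, y, inv y}" "involution x" "y \<in> carrier G" "y \<otimes> y \<noteq> \<one>"
proof -
  have inv_S: "inv s \<in> S" if "s \<in> S" for s
    using S(1) that by (auto simp: connection_set_def SET_INV_def)
  have sub: "S \<subseteq> carrier G" "\<one> \<notin> S" using S(1) by (auto simp: connection_set_def)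
  show ?thesis
  proof (cases "\<forall>s\<in>S. s \<otimes> s = \<one>")
    case True
    then have "involution s" if "s \<in> S" for s using that sub by auto
    moreover obtain x y z where "S = {x, y, z}" "x \<noteq> y" "x \<noteq> z" "y \<noteq> z"
      using S(2) by (auto simp: card_3_iff)
    ultimately show ?thesis using involutions by simp
  next
    case False
    then obtain y where y: "y \<in> S" "y \<otimes> y \<noteq> \<one>" by auto
    then have yG: "y \<in> carrier G" using sub by auto
    have ne: "y \<noteq> inv y" using y yG by (metis r_inv)
    have "card (S - {y, inv y}) = 1"
      using S(2) y inv_S[OF y(1)] ne by (simp add: card_Diff_subset)
    then obtain x where x: "S - {y, inv y} = {x}" by (auto simp: card_1_singleton_iff)
    then have xS: "x \<in> S" "x \<noteq> y" "x \<noteq> inv y" by auto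
    have S_eq: "S = {x, y, inv y}" using x y(1) inv_S[OF y(1)] by auto
    have xG: "x \<in> carrier G" using xS sub by auto
    have "inv x \<noteq> y" "inv x \<noteq> inv y" using xS xG yG by auto
    then have "inv x = x" using inv_S[OF xS(1)] S_eq by auto
    then have "x \<otimes> x = \<one>" using xG by (metis r_inv)
    moreover have "x \<noteq> \<one>" using xS(1) sub by auto
    ultimately show ?thesis using inverse_pair S_eq xG yG y(2) by blast
  qed
qed

context group
begin

text \<open>An eigenfunction can be replaced by one on which a normalizing involution acts by a sign.\<close>

lemma split_eigenfunction:
  fixes f :: "'a \<Rightarrow> complex"
  assumes x: "involution x" and f: "\<exists>g\<in>carrier G. f g \<noteq> 0"
  obtains \<epsilon> :: complex where "\<epsilon> = 1 \<or> \<epsilon> = -1"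
    "\<exists>g\<in>carrier G. f g + \<epsilon> * f (x \<otimes> g) \<noteq> 0"
    "\<And>g. g \<in> carrier G \<Longrightarrow> f (x \<otimes> g) + \<epsilon> * f (x \<otimes> (x \<otimes> g)) = \<epsilon> * (f g + \<epsilon> * f (x \<otimes> g))"
proof -
  have xxg: "x \<otimes> (x \<otimes> g) = g" if "g \<in> carrier G" for g using that x by (simp add: cancel_left_pair)
  obtain g where g: "g \<in> carrier G" "f g \<noteq> 0" using f by blast
  have "f g + f (x \<otimes> g) \<noteq> 0 \<or> f g - f (x \<otimes> g) \<noteq> 0"
  proof (rule ccontr)
    assume "\<not> ?thesis"
    then have "f g + f (x \<otimes> g) = 0 \<and> f g = f (x \<otimes> g)" by auto
    then have "2 * f g = 0" by (metis mult_2)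
    then show False using g by simp
  qed
  then show ?thesis
  proof
    assume "f g + f (x \<otimes> g) \<noteq> 0"
    then show ?thesis using that[of 1] g xxg by (auto simp: add.commute)
  next
    assume "f g - f (x \<otimes> g) \<noteq> 0"
    then show ?thesis using that[of "-1"] g xxg by (auto simp: bexI[of _ g])
  qed
qed

text \<open>Whether \<open>x\<close> centralises or inverts \<open>y\<close>, it commutes with the
  sum of \<open>y\<close> and its inverse, so the split function \<open>h\<close> is an
  eigenfunction of that sum with eigenvalue \<open>\<mu> = k - \<epsilon>\<close>. Such
  \<open>\<mu>\<close> are the numbers \<open>w + 1/w\<close> for 4th or 6th roots of unity
  \<open>w\<close>, that is, 0, 1, -1, 2 or -2; the polynomials below express this without roots of
  unity.\<close>

lemma eigenvalue_inverse_pair: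
  fixes f :: "'a \<Rightarrow> complex"
  assumes x: "involution x" and y: "y \<in> carrier G" "y' \<in> carrier G" "y \<otimes> y' = \<one>"
    and normal: "y \<otimes> x = x \<otimes> y \<and> y' \<otimes> x = x \<otimes> y' \<or> y \<otimes> x = x \<otimes> y' \<and> y' \<otimes> x = x \<otimes> y"
    and pow: "y [^] (4::nat) = \<one> \<or> y [^] (6::nat) = \<one>"
    and f: "\<exists>g\<in>carrier G. f g \<noteq> 0"
    and ev: "\<And>g. g \<in> carrier G \<Longrightarrow> f (x \<otimes> g) + f (y \<otimes> g) + f (y' \<otimes> g) = k * f g"
  shows "k \<in> \<int>"
proof -
  have [simp]: "x \<in> carrier G" "y \<in> carrier G" "y' \<in> carrier G" using x y by auto
  have y'y: "y' \<otimes> y = \<one>" using y one_pair_commute by blast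
  note cl = cancel_left_pair[OF y(3)] cancel_left_pair[OF y'y]
  obtain \<epsilon> where e: "\<epsilon> = 1 \<or> \<epsilon> = -1" "\<exists>g\<in>carrier G. f g + \<epsilon> * f (x \<otimes> g) \<noteq> 0"
    "\<And>g. g \<in> carrier G \<Longrightarrow> f (x \<otimes> g) + \<epsilon> * f (x \<otimes> (x \<otimes> g)) = \<epsilon> * (f g + \<epsilon> * f (x \<otimes> g))"
    using split_eigenfunction[OF x f] by blast
  define h where "h g = f g + \<epsilon> * f (x \<otimes> g)" for g
  obtain g where g: "g \<in> carrier G" "h g \<noteq> 0" using e(2) by (auto simp: h_def)
  define \<mu> where "\<mu> = k - \<epsilon>"
  have T: "h (y \<otimes> g) + h (y' \<otimes> g) = \<mu> * h g" if g: "g \<in> carrier G" for g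
  proof -
    have "f (y \<otimes> (x \<otimes> g)) + f (y' \<otimes> (x \<otimes> g)) = f (x \<otimes> (y \<otimes> g)) + f (x \<otimes> (y' \<otimes> g))"
      using normal g by (auto simp: m_assoc[symmetric])
    moreover have "f (x \<otimes> (x \<otimes> g)) + f (y \<otimes> (x \<otimes> g)) + f (y' \<otimes> (x \<otimes> g)) = k * f (x \<otimes> g)"
      using ev[of "x \<otimes> g"] g by simp
    ultimately have "h (x \<otimes> g) + (h (y \<otimes> g) + h (y' \<otimes> g)) = k * h g"
      unfolding h_def using ev[OF g] by Groebner_Basis.algebra
    moreover have "h (x \<otimes> g) = \<epsilon> * h g" using e(3)[OF g] by (simp add: h_def)
    ultimately show ?thesis by (simp add: \<mu>_def algebra_simps)
  qed
  have T2: "h (y \<otimes> (y \<otimes> g)) + h (y' \<otimes> (y' \<otimes> g)) = (\<mu> * \<mu> - 2) * h g" if g: "g \<in> carrier G" for g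
  proof -
    have "h (y \<otimes> (y \<otimes> g)) + h g + (h g + h (y' \<otimes> (y' \<otimes> g))) = \<mu> * h (y \<otimes> g) + \<mu> * h (y' \<otimes> g)"
      using T[of "y \<otimes> g"] T[of "y' \<otimes> g"] g by (simp add: cl)
    also have "\<dots> = \<mu> * (\<mu> * h g)" using T[OF g] by (simp add: distrib_left[symmetric])
    finally show ?thesis by (simp add: algebra_simps)
  qed
  have "\<mu> * (\<mu> * \<mu> - 4) = 0 \<or> (\<mu> * \<mu> - 1) * (\<mu> * \<mu> - 4) = 0"
    using pow
  proof
    assume "y [^] (4::nat) = \<one>"
    then have y4: "y \<otimes> (y \<otimes> (y \<otimes> y)) = \<one>" by (simp add: numeral_eq_Suc m_assoc)
    have "y' \<otimes> y' = y' \<otimes> (y' \<otimes> (y \<otimes> (y \<otimes> (y \<otimes> y))))" by (simp add: y4)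
    then have y'2: "y' \<otimes> y' = y \<otimes> y" by (simp add: cl)
    then have y'2g: "y' \<otimes> (y' \<otimes> u) = y \<otimes> (y \<otimes> u)" if "u \<in> carrier G" for u
      using that by (simp add: m_assoc[symmetric])
    \<comment> \<open>As \<open>y^2\<close> equals its inverse, it acts on \<open>h\<close> as the
      scalar \<open>(\<mu>^2 - 2) / 2\<close>. But it merely exchanges the two terms of
      \<open>h (y g) + h (y' g)\<close>, so that scalar is 1 unless
      \<open>\<mu> = 0\<close>.\<close>
    have a: "2 * h (y \<otimes> (y \<otimes> u)) = (\<mu> * \<mu> - 2) * h u" if "u \<in> carrier G" for u
      using T2[OF that] y'2g[OF that] by simp
    have "y \<otimes> (y \<otimes> (y \<otimes> g)) = y' \<otimes> g"
    proof -
      have "y' \<otimes> g = y' \<otimes> (y' \<otimes> (y \<otimes> g))" using g by (simp add: cl)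
      then show ?thesis using g y'2g[of "y \<otimes> g"] by simp
    qed
    moreover have "y \<otimes> (y \<otimes> (y' \<otimes> g)) = y \<otimes> g" using g by (simp add: cl)
    ultimately have "2 * (h (y' \<otimes> g) + h (y \<otimes> g)) = (\<mu> * \<mu> - 2) * (h (y \<otimes> g) + h (y' \<otimes> g))"
      using a[of "y \<otimes> g"] a[of "y' \<otimes> g"] g by (simp add: distrib_left)
    then have "2 * (\<mu> * h g) = (\<mu> * \<mu> - 2) * (\<mu> * h g)" using T[OF g(1)] by (simp add: add.commute)
    then have "\<mu> * (\<mu> * \<mu> - 4) * h g = 0" by (simp add: algebra_simps)
    then show ?thesis using g by simp
  next
    assume "y [^] (6::nat) = \<one>"
    then have y6: "y \<otimes> (y \<otimes> (y \<otimes> (y \<otimes> (y \<otimes> y)))) = \<one>" by (simp add: numeral_eq_Suc m_assoc)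
    have "y' \<otimes> (y' \<otimes> (y' \<otimes> y')) = y' \<otimes> (y' \<otimes> (y' \<otimes> (y' \<otimes> (y \<otimes> (y \<otimes> (y \<otimes> (y \<otimes> (y \<otimes> y))))))))"
      by (simp add: y6)
    then have "y' \<otimes> (y' \<otimes> (y' \<otimes> y')) = y \<otimes> y" by (simp add: cl)
    then have y'4: "y' \<otimes> (y' \<otimes> (y' \<otimes> (y' \<otimes> u))) = y \<otimes> (y \<otimes> u)" if "u \<in> carrier G" for u
    proof -
      have "y' \<otimes> (y' \<otimes> (y' \<otimes> (y' \<otimes> u))) = y' \<otimes> (y' \<otimes> (y' \<otimes> y')) \<otimes> u" using that by (simp add: m_assoc)
      then show ?thesis using that \<open>y' \<otimes> (y' \<otimes> (y' \<otimes> y')) = y \<otimes> y\<close> by (simp add: m_assoc)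
    qed
    have y4: "y \<otimes> (y \<otimes> (y \<otimes> (y \<otimes> u))) = y' \<otimes> (y' \<otimes> u)" if "u \<in> carrier G" for u
    proof -
      have "y' \<otimes> (y' \<otimes> u) = y' \<otimes> (y' \<otimes> (y \<otimes> (y \<otimes> (y \<otimes> (y \<otimes> (y \<otimes> y)))) \<otimes> u))"
        using that by (simp add: y6)
      then show ?thesis using that by (simp add: m_assoc cl)
    qed
    \<comment> \<open>Here \<open>y^2\<close> has trivial cube, so the sum \<open>U\<close> of
      \<open>y^2\<close> and its inverse satisfies \<open>U^2 = U + 2\<close>, while
      \<open>U\<close> acts on \<open>h\<close> as \<open>\<mu>^2 - 2\<close>.\<close>
    have "h (y' \<otimes> (y' \<otimes> g)) + h g + (h g + h (y \<otimes> (y \<otimes> g)))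
       = (\<mu> * \<mu> - 2) * h (y \<otimes> (y \<otimes> g)) + (\<mu> * \<mu> - 2) * h (y' \<otimes> (y' \<otimes> g))"
      using T2[of "y \<otimes> (y \<otimes> g)"] T2[of "y' \<otimes> (y' \<otimes> g)"] g by (simp add: cl y4 y'4)
    also have "\<dots> = (\<mu> * \<mu> - 2) * ((\<mu> * \<mu> - 2) * h g)"
      using T2[OF g(1)] by (simp add: distrib_left[symmetric])
    finally have "(\<mu> * \<mu> - 2) * h g + 2 * h g = (\<mu> * \<mu> - 2) * ((\<mu> * \<mu> - 2) * h g)"
      using T2[OF g(1)] by (simp add: algebra_simps)
    then have "(\<mu> * \<mu> - 1) * (\<mu> * \<mu> - 4) * h g = 0" by Groebner_Basis.algebra
    then show ?thesis using g by simp
  qed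
  moreover have "(\<mu> * \<mu> - 4) = (\<mu> - 2) * (\<mu> + 2)" "(\<mu> * \<mu> - 1) = (\<mu> - 1) * (\<mu> + 1)"
    by (simp_all add: algebra_simps)
  ultimately have "\<mu> = 0 \<or> \<mu> - 2 = 0 \<or> \<mu> + 2 = 0 \<or> \<mu> - 1 = 0 \<or> \<mu> + 1 = 0" by auto
  then have "\<mu> \<in> {0, 2, -2, 1, -1}" by (auto simp: eq_neg_iff_add_eq_0)
  then have "\<mu> \<in> \<int>" by auto
  moreover have "\<epsilon> \<in> \<int>" using e(1) by auto
  ultimately have "\<mu> + \<epsilon> \<in> \<int>" by (rule Ints_add)
  then show ?thesis by (simp add: \<mu>_def)
qed

text \<open>Commuting involutions can be diagonalised one after another, so \<open>k\<close> is a
  sum of three signs.\<close>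

lemma eigenvalue_commuting_involutions:
  fixes f :: "'a \<Rightarrow> complex"
  assumes x: "involution x" and y: "involution y" and z: "involution z"
    and comm: "x \<otimes> y = y \<otimes> x" "x \<otimes> z = z \<otimes> x" "y \<otimes> z = z \<otimes> y"
    and f: "\<exists>g\<in>carrier G. f g \<noteq> 0"
    and ev: "\<And>g. g \<in> carrier G \<Longrightarrow> f (x \<otimes> g) + f (y \<otimes> g) + f (z \<otimes> g) = k * f g"
  shows "k \<in> \<int>"
proof -
  have [simp]: "x \<in> carrier G" "y \<in> carrier G" "z \<in> carrier G" using x y z by auto
  have past: "y \<otimes> (x \<otimes> g) = x \<otimes> (y \<otimes> g)" "z \<otimes> (x \<otimes> g) = x \<otimes> (z \<otimes> g)" "z \<otimes> (y \<otimes> g) = y \<otimes> (z \<otimes> g)"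
    if "g \<in> carrier G" for g
    using that comm by (simp_all flip: m_assoc)
  obtain \<epsilon> where e: "\<epsilon> = 1 \<or> \<epsilon> = -1" "\<exists>g\<in>carrier G. f g + \<epsilon> * f (x \<otimes> g) \<noteq> 0"
    "\<And>g. g \<in> carrier G \<Longrightarrow> f (x \<otimes> g) + \<epsilon> * f (x \<otimes> (x \<otimes> g)) = \<epsilon> * (f g + \<epsilon> * f (x \<otimes> g))"
    using split_eigenfunction[OF x f] by blast
  define h where "h g = f g + \<epsilon> * f (x \<otimes> g)" for g
  have h: "\<exists>g\<in>carrier G. h g \<noteq> 0" using e(2) by (simp add: h_def)
  have h_ev: "h (y \<otimes> g) + h (z \<otimes> g) = (k - \<epsilon>) * h g" if g: "g \<in> carrier G" for g
  proof -
    have "f (x \<otimes> (x \<otimes> g)) + f (x \<otimes> (y \<otimes> g)) + f (x \<otimes> (z \<otimes> g)) = k * f (x \<otimes> g)"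
      using ev[of "x \<otimes> g"] g by (simp add: past)
    then have "h (x \<otimes> g) + (h (y \<otimes> g) + h (z \<otimes> g)) = k * h g"
      unfolding h_def using ev[OF g] by Groebner_Basis.algebra
    moreover have "h (x \<otimes> g) = \<epsilon> * h g" using e(3)[OF g] by (simp add: h_def)
    ultimately show ?thesis by (simp add: algebra_simps)
  qed
  obtain \<delta> where d: "\<delta> = 1 \<or> \<delta> = -1" "\<exists>g\<in>carrier G. h g + \<delta> * h (y \<otimes> g) \<noteq> 0"
    "\<And>g. g \<in> carrier G \<Longrightarrow> h (y \<otimes> g) + \<delta> * h (y \<otimes> (y \<otimes> g)) = \<delta> * (h g + \<delta> * h (y \<otimes> g))"
    using split_eigenfunction[OF y h] by blast
  define u where "u g = h g + \<delta> * h (y \<otimes> g)" for g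
  define \<mu> where "\<mu> = k - \<epsilon> - \<delta>"
  have u_ev: "u (z \<otimes> g) = \<mu> * u g" if g: "g \<in> carrier G" for g
  proof -
    have "h (y \<otimes> (y \<otimes> g)) + h (y \<otimes> (z \<otimes> g)) = (k - \<epsilon>) * h (y \<otimes> g)"
      using h_ev[of "y \<otimes> g"] g by (simp add: past)
    then have "u (y \<otimes> g) + u (z \<otimes> g) = (k - \<epsilon>) * u g"
      unfolding u_def using h_ev[OF g] by Groebner_Basis.algebra
    moreover have "u (y \<otimes> g) = \<delta> * u g" using d(3)[OF g] by (simp add: u_def)
    ultimately show ?thesis by (simp add: \<mu>_def algebra_simps)
  qed
  obtain g where g: "g \<in> carrier G" "u g \<noteq> 0" using d(2) by (auto simp: u_def)
  have "u g = \<mu> * (\<mu> * u g)"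
    using u_ev[of "z \<otimes> g"] u_ev[OF g(1)] g z by (simp add: cancel_left_pair)
  then have "(\<mu> - 1) * (\<mu> + 1) * u g = 0" by (simp add: algebra_simps)
  then have "\<mu> = 1 \<or> \<mu> = -1" using g by (auto simp: eq_neg_iff_add_eq_0)
  then have "\<mu> \<in> \<int>" "\<epsilon> \<in> \<int>" "\<delta> \<in> \<int>" using e(1) d(1) by auto
  then have "\<mu> + \<epsilon> + \<delta> \<in> \<int>" by (intro Ints_add)
  then show ?thesis by (simp add: \<mu>_def)
qed

text \<open>Let \<open>A\<close> be the sum of the three reflections. Multiplication by a rotation
  permutes them, so rotations act trivially on \<open>A f\<close>; and \<open>A^2\<close> is three
  times the sum of \<open>\<one>\<close> and the two rotations. Hence \<open>A^3 = 9 A\<close>, and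
  \<open>k\<close> is 0, 3 or -3.\<close>

lemma eigenvalue_reflections:
  fixes f :: "'a \<Rightarrow> complex"
  assumes carrier: "a \<in> carrier G" "b \<in> carrier G" "c \<in> carrier G"
    and rel: "a \<otimes> a = \<one>" "b \<otimes> b = \<one>" "c = a \<otimes> (b \<otimes> a)" "c = b \<otimes> (a \<otimes> b)"
    and f: "\<exists>g\<in>carrier G. f g \<noteq> 0"
    and ev: "\<And>g. g \<in> carrier G \<Longrightarrow> f (a \<otimes> g) + f (b \<otimes> g) + f (c \<otimes> g) = k * f g"
  shows "k \<in> \<int>"
proof -
  note [simp] = carrier
  note cl = cancel_left_pair[OF rel(1)] cancel_left_pair[OF rel(2)]
  have c: "c \<otimes> g = a \<otimes> (b \<otimes> (a \<otimes> g))" "b \<otimes> (a \<otimes> (b \<otimes> g)) = a \<otimes> (b \<otimes> (a \<otimes> g))"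
    if "g \<in> carrier G" for g
  proof -
    show 1: "c \<otimes> g = a \<otimes> (b \<otimes> (a \<otimes> g))" unfolding rel(3) using that by (simp add: m_assoc)
    have "c \<otimes> g = b \<otimes> (a \<otimes> (b \<otimes> g))" unfolding rel(4) using that by (simp add: m_assoc)
    then show "b \<otimes> (a \<otimes> (b \<otimes> g)) = a \<otimes> (b \<otimes> (a \<otimes> g))" using 1 by simp
  qed
  obtain g where g: "g \<in> carrier G" "f g \<noteq> 0" using f by blast
  define P where "P g = f (a \<otimes> g) + f (b \<otimes> g) + f (a \<otimes> (b \<otimes> (a \<otimes> g)))" for g
  have P: "P g = k * f g" if "g \<in> carrier G" for g
    using ev[OF that] c(1)[OF that] by (simp add: P_def)
  have "P (a \<otimes> (b \<otimes> g)) = P g" "P (b \<otimes> (a \<otimes> g)) = P g"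
    using g by (simp_all add: P_def c cl)
  then have ab: "k * f (a \<otimes> (b \<otimes> g)) = k * f g" "k * f (b \<otimes> (a \<otimes> g)) = k * f g"
    using P g by simp_all
  have "P (a \<otimes> g) + P (b \<otimes> g) + P (a \<otimes> (b \<otimes> (a \<otimes> g)))
      = 3 * f g + 3 * f (a \<otimes> (b \<otimes> g)) + 3 * f (b \<otimes> (a \<otimes> g))"
    using g by (simp add: P_def c cl)
  moreover have "P (a \<otimes> g) + P (b \<otimes> g) + P (a \<otimes> (b \<otimes> (a \<otimes> g))) = k * P g"
    using g P[of "a \<otimes> g"] P[of "b \<otimes> g"] P[of "a \<otimes> (b \<otimes> (a \<otimes> g))"]
    by (simp add: P_def[of g] distrib_left)
  ultimately have "k * (k * f g) = 3 * f g + 3 * f (a \<otimes> (b \<otimes> g)) + 3 * f (b \<otimes> (a \<otimes> g))"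
    using P g by simp
  then have "k * (k * (k * f g)) = 3 * (k * f g) + 3 * (k * f (a \<otimes> (b \<otimes> g))) + 3 * (k * f (b \<otimes> (a \<otimes> g)))"
    by (simp add: algebra_simps)
  then have "k * (k - 3) * (k + 3) * f g = 0" unfolding ab by (simp add: algebra_simps)
  then have "k = 0 \<or> k = 3 \<or> k = -3" using g by (auto simp: eq_neg_iff_add_eq_0)
  then show ?thesis by auto
qed

end

context A4_relations
begin

text \<open>
  The normal Klein four-group is \<open>V = {\<one>, x, x1, x2}\<close>. Either the \<open>V\<close>-average of the eigenfunction
  is nonzero and the eigenvalue comes from the quotient \<open>G / V\<close>, or that average vanishes, which
  reads \<open>(1 + x) (y + y\<inverse>) (1 + x) f = 0\<close>.
\<close>

lemma eigenvalue_in_Ints: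
  fixes f :: "'a \<Rightarrow> complex"
  assumes f: "\<exists>g\<in>carrier G. f g \<noteq> 0"
    and ev: "\<And>g. g \<in> carrier G \<Longrightarrow> f (x \<otimes> g) + f (y \<otimes> g) + f (y \<otimes> (y \<otimes> g)) = k * f g"
  shows "k \<in> \<int>"
proof (cases "\<exists>g\<in>carrier G. f g + f (x \<otimes> g) + f (x1 \<otimes> g) + f (x \<otimes> (x1 \<otimes> g)) \<noteq> 0")
  case True
  define h where "h g = f g + f (x \<otimes> g) + f (x1 \<otimes> g) + f (x \<otimes> (x1 \<otimes> g))" for g
  obtain g where g: "g \<in> carrier G" "h g \<noteq> 0" using True by (auto simp: h_def)
  have T: "h (y \<otimes> g) + h (y \<otimes> (y \<otimes> g)) = (k - 1) * h g" if g: "g \<in> carrier G" for g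
  proof -
    have "h (x \<otimes> g) + h (y \<otimes> g) + h (y \<otimes> (y \<otimes> g))
        = k * f g + k * f (x \<otimes> g) + k * f (x1 \<otimes> g) + k * f (x \<otimes> (x1 \<otimes> g))"
      using ev[OF g, symmetric] ev[of "x \<otimes> g", symmetric] ev[of "x1 \<otimes> g", symmetric]
        ev[of "x \<otimes> (x1 \<otimes> g)", symmetric] g
      by (simp add: h_def reduce reduce_xy)
    then have "h (x \<otimes> g) + h (y \<otimes> g) + h (y \<otimes> (y \<otimes> g)) = k * h g"
      by (simp add: h_def distrib_left)
    moreover have "h (x \<otimes> g) = h g" using g by (simp add: h_def reduce reduce_xy)
    ultimately show ?thesis by (simp add: algebra_simps)
  qed
  \<comment> \<open>Since \<open>y^3 = \<one>\<close>, the operator \<open>y + y^2\<close> has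
    square \<open>y + y^2 + 2\<close>; with eigenvalue \<open>k - 1\<close> on \<open>h\<close> this
    leaves \<open>k = 0\<close> or \<open>k = 3\<close>.\<close>
  have "h (y \<otimes> (y \<otimes> g)) + h g = (k - 1) * h (y \<otimes> g)" "h g + h (y \<otimes> g) = (k - 1) * h (y \<otimes> (y \<otimes> g))"
    using T[of "y \<otimes> g"] T[of "y \<otimes> (y \<otimes> g)"] g(1) by (simp_all add: reduce_xy)
  then have "(k - 1) * ((k - 1) * h g) = (k - 1) * h g + 2 * h g"
    using T[OF g(1)] by Groebner_Basis.algebra
  then have "(k - 3) * k * h g = 0" by Groebner_Basis.algebra
  then show ?thesis using g by auto
next
  case False
  then have V: "f g + f (x \<otimes> g) + f (x1 \<otimes> g) + f (x \<otimes> (x1 \<otimes> g)) = 0" if "g \<in> carrier G" for g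
    using that by blast
  have T: "f (y \<otimes> u) + f (y \<otimes> (y \<otimes> u)) = k * f u - f (x \<otimes> u)" if "u \<in> carrier G" for u
    using ev[OF that] by (simp add: algebra_simps)
  have TX: "f (x \<otimes> (y \<otimes> u)) + f (x \<otimes> (y \<otimes> (y \<otimes> u))) = (k - 1) * (k * f u - f (x \<otimes> u)) - 2 * f u"
    if u: "u \<in> carrier G" for u
  proof -
    have "f (x \<otimes> (y \<otimes> u)) + f (y \<otimes> (y \<otimes> u)) + f u = k * f (y \<otimes> u)"
      "f (x \<otimes> (y \<otimes> (y \<otimes> u))) + f u + f (y \<otimes> u) = k * f (y \<otimes> (y \<otimes> u))"
      using ev[of "y \<otimes> u"] ev[of "y \<otimes> (y \<otimes> u)"] u by (simp_all add: reduce_xy)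
    then show ?thesis using ev[OF u] by Groebner_Basis.algebra
  qed
  \<comment> \<open>Adding \<open>T\<close> and \<open>TX\<close> at \<open>u\<close> and at
    \<open>x u\<close> produces on the left the full sums of \<open>f\<close> over the four-group
    translates of \<open>y u\<close> and \<open>y^2 u\<close>, which vanish; the right side is this
    product.\<close>
  have sum: "(k - 2) * (k + 1) * (f u + f (x \<otimes> u)) = 0" if u: "u \<in> carrier G" for u
  proof -
    have "f (x1 \<otimes> (y \<otimes> u)) + f (x \<otimes> (x1 \<otimes> (y \<otimes> (y \<otimes> u)))) = k * f (x \<otimes> u) - f u"
      using T[of "x \<otimes> u"] u by (simp add: reduce reduce_xy)
    moreover have "f (x \<otimes> (x1 \<otimes> (y \<otimes> u))) + f (x1 \<otimes> (y \<otimes> (y \<otimes> u)))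
        = (k - 1) * (k * f (x \<otimes> u) - f u) - 2 * f (x \<otimes> u)"
      using TX[of "x \<otimes> u"] u by (simp add: reduce reduce_xy)
    moreover have "f (y \<otimes> u) + f (x \<otimes> (y \<otimes> u)) + f (x1 \<otimes> (y \<otimes> u)) + f (x \<otimes> (x1 \<otimes> (y \<otimes> u))) = 0"
      "f (y \<otimes> (y \<otimes> u)) + f (x \<otimes> (y \<otimes> (y \<otimes> u))) + f (x1 \<otimes> (y \<otimes> (y \<otimes> u)))
        + f (x \<otimes> (x1 \<otimes> (y \<otimes> (y \<otimes> u)))) = 0"
      using V[of "y \<otimes> u"] V[of "y \<otimes> (y \<otimes> u)"] u by simp_all
    ultimately show ?thesis using T[OF u] TX[OF u] by Groebner_Basis.algebra
  qed
  show ?thesis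
  proof (cases "k = 2 \<or> k = -1")
    case False
    then have "f u + f (x \<otimes> u) = 0" if "u \<in> carrier G" for u
      using sum[OF that] by (auto simp: eq_neg_iff_add_eq_0)
    then have anti: "f (x \<otimes> u) = - f u" if "u \<in> carrier G" for u
      using that by (metis add.commute eq_neg_iff_add_eq_0)
    obtain g where g: "g \<in> carrier G" "f g \<noteq> 0" using f by blast
    \<comment> \<open>Once \<open>x\<close> acts as -1, \<open>T\<close> says that
      \<open>y + y^2\<close> acts as \<open>k + 1\<close>, and \<open>TX\<close> says that its
      negative acts as \<open>k^2 - 3\<close>.\<close>
    have "f (x \<otimes> g) = - f g" "f (x \<otimes> (y \<otimes> g)) = - f (y \<otimes> g)"
      "f (x \<otimes> (y \<otimes> (y \<otimes> g))) = - f (y \<otimes> (y \<otimes> g))"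
      using anti g by simp_all
    then have "(k - 1) * (k + 2) * f g = 0" using T[OF g(1)] TX[OF g(1)] by Groebner_Basis.algebra
    then have "k = 1 \<or> k = -2" using g by (auto simp: eq_neg_iff_add_eq_0)
    then show ?thesis by auto
  qed auto
qed

end

subsection \<open>Classification\<close>

context group
begin

lemma is_iso_hom_image:
  assumes K: "group K" and h: "h \<in> hom K G" "inj_on h (carrier K)" "h ` carrier K = A"
  shows "G\<lparr>carrier := A\<rparr> \<cong> K"
proof -
  have "h \<in> iso K (G\<lparr>carrier := A\<rparr>)"
    using h by (auto simp: iso_def hom_def bij_betw_def)
  then have "K \<cong> G\<lparr>carrier := A\<rparr>" by (auto simp: is_iso_def)
  then show ?thesis by (rule group.iso_sym[OF K])
qed

lemma int_pow_mod_ord: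
  assumes "y \<in> carrier G" "ord y = n"
  shows "y [^] ((i + j) mod int n) = y [^] i \<otimes> y [^] j"
proof -
  have "int n dvd (i + j) - (i + j) mod int n" by (simp add: dvd_minus_mod)
  then show ?thesis using assms int_pow_eq[of y "(i + j) mod int n" "i + j"] by (simp add: int_pow_mult)
qed

lemma int_pow_inj_on:
  assumes "y \<in> carrier G" "ord y = n"
  shows "inj_on (\<lambda>i::int. y [^] i) {0..<int n}"
proof (rule inj_onI)
  fix i j :: int assume ij: "i \<in> {0..<int n}" "j \<in> {0..<int n}" and "y [^] i = y [^] j"
  then have "int n dvd j - i" using assms int_pow_eq by blast
  then have "j mod int n = i mod int n" by (simp add: mod_eq_dvd_iff)
  then show "i = j" using ij by simp
qed

lemma cyclic_subgroup_is_iso: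
  assumes y: "y \<in> carrier G" "ord y = n" "n > 0"
  shows "generated_subgroup G {y} \<cong> integer_mod_group n"
proof (rule is_iso_hom_image[where h = "\<lambda>i::int. y [^] i"])
  have c: "carrier (integer_mod_group n) = {0..<int n}" using y(3) by (simp add: carrier_integer_mod_group)
  show "group (integer_mod_group n)" by simp
  show "(\<lambda>i::int. y [^] i) \<in> hom (integer_mod_group n) G"
    using y int_pow_mod_ord by (auto intro!: homI)
  show "inj_on (\<lambda>i::int. y [^] i) (carrier (integer_mod_group n))"
    unfolding c by (rule int_pow_inj_on[OF y(1,2)])
  have "y [^] k \<in> (\<lambda>i::int. y [^] i) ` {0..<int n}" for k :: int
  proof -
    have "y [^] k = y [^] (k mod int n)" using int_pow_mod_ord[OF y(1,2), of k 0] y(1) by simp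
    moreover have "k mod int n \<in> {0..<int n}" using y(3) by simp
    ultimately show ?thesis by blast
  qed
  then show "(\<lambda>i::int. y [^] i) ` carrier (integer_mod_group n) = generate G {y}"
    unfolding c generate_pow[OF y(1)] by auto
qed

lemma ord_eq_2_iff_involution:
  assumes "x \<in> carrier G"
  shows "ord x = 2 \<longleftrightarrow> involution x"
proof
  assume o: "ord x = 2"
  then have "x [^] (2::nat) = \<one>" using pow_ord_eq_1[OF assms] by simp
  moreover have "x \<noteq> \<one>" using o by auto
  ultimately show "involution x" using assms by (simp add: numeral_2_eq_2)
next
  assume x: "involution x"
  then have "ord x dvd 2" using pow_eq_id[of x 2] by (simp add: numeral_2_eq_2)
  moreover have "ord x \<noteq> 1" using x ord_eq_1[of x] by auto
  ultimately show "ord x = 2" using two_is_prime_nat by (metis prime_nat_iff)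
qed

lemma direct_product_subgroup_is_iso:
  assumes x: "involution x" and y: "y \<in> carrier G" "ord y = n" "n > 1"
    and comm: "x \<otimes> y = y \<otimes> x" and notin: "x \<notin> generate G {y}"
  shows "generated_subgroup G {x, y} \<cong> integer_mod_group 2 \<times>\<times> integer_mod_group n"
proof -
  have [simp]: "x \<in> carrier G" using x by simp
  have ox: "ord x = 2" using x ord_eq_2_iff_involution by simp
  let ?h = "\<lambda>(i::int, j::int). x [^] i \<otimes> y [^] j"
  let ?K = "integer_mod_group 2 \<times>\<times> integer_mod_group n"
  have c: "carrier ?K = {0..<2} \<times> {0..<int n}" using y(3) by (simp add: carrier_integer_mod_group)
  have xy: "y [^] j \<otimes> x = x \<otimes> y [^] j" for j :: int
  proof (cases j rule: int_cases2)
    case (nonneg k)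
    then show ?thesis using group_commutes_pow[of y x k] comm y(1) by (simp add: int_pow_int)
  next
    case (nonpos k)
    have "y [^] k \<otimes> x = x \<otimes> y [^] k" using group_commutes_pow[of y x k] comm y(1) by simp
    then have "inv (y [^] k) \<otimes> (y [^] k \<otimes> x) \<otimes> inv (y [^] k) = inv (y [^] k) \<otimes> (x \<otimes> y [^] k) \<otimes> inv (y [^] k)"
      by simp
    then have "x \<otimes> inv (y [^] k) = inv (y [^] k) \<otimes> x"
      using y(1) by (simp add: m_assoc cancel_left_pair[OF l_inv])
    then show ?thesis using nonpos y(1) by (simp add: int_pow_neg int_pow_int)
  qed
  have xy': "y [^] j \<otimes> x [^] i = x [^] i \<otimes> y [^] j" if "i \<in> {0..<2}" for i j :: int
  proof -
    have "i = 0 \<or> i = 1" using that by auto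
    then show ?thesis using xy y(1) by auto
  qed
  interpret K: group ?K by (intro DirProd_group) simp_all
  have hom: "?h \<in> hom ?K G"
  proof (rule homI)
    fix p q assume "p \<in> carrier ?K" "q \<in> carrier ?K"
    then obtain i j i' j' where pq: "p = (i, j)" "q = (i', j')" "i \<in> {0..<2}" "i' \<in> {0..<2}"
      unfolding c by auto
    show "?h p \<in> carrier G" using pq y(1) by simp
    have "?h p \<otimes> ?h q = x [^] i \<otimes> (y [^] j \<otimes> x [^] i') \<otimes> y [^] j'" using pq y(1) by (simp add: m_assoc)
    also have "\<dots> = (x [^] i \<otimes> x [^] i') \<otimes> (y [^] j \<otimes> y [^] j')"
      unfolding xy'[OF pq(4)] using y(1) by (simp add: m_assoc)
    also have "\<dots> = ?h (p \<otimes>\<^bsub>?K\<^esub> q)"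
      using pq int_pow_mod_ord[OF y(1,2), of j j'] int_pow_mod_ord[OF _ ox, of i i'] by simp
    finally show "?h (p \<otimes>\<^bsub>?K\<^esub> q) = ?h p \<otimes> ?h q" by simp
  qed
  interpret h: group_hom ?K G ?h using hom by unfold_locales
  have inj: "inj_on ?h (carrier ?K)"
  proof (rule inj_onI)
    fix p q assume "p \<in> carrier ?K" "q \<in> carrier ?K" and eq: "?h p = ?h q"
    then obtain i j i' j' where pq: "p = (i, j)" "q = (i', j')"
      and ii': "i \<in> {0..<2}" "i' \<in> {0..<2}" and jj': "j \<in> {0..<int n}" "j' \<in> {0..<int n}"
      unfolding c by blast
    have i01: "i = 0 \<or> i = 1" "i' = 0 \<or> i' = 1" using ii' by auto
    have no: "x \<otimes> y [^] a \<noteq> y [^] b" for a b :: int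
    proof
      assume "x \<otimes> y [^] a = y [^] b"
      then have "x = y [^] b \<otimes> inv (y [^] a)" using y(1) by (metis inv_solve_right \<open>x \<in> carrier G\<close> int_pow_closed)
      then have "x = y [^] (b - a)" using y(1) by (simp add: int_pow_diff)
      then show False using notin generate_pow[OF y(1)] by blast
    qed
    have "i = i'" using i01 eq pq no[of j j'] no[of j' j, symmetric] y(1) by auto
    then have "y [^] j = y [^] j'" using eq pq y(1) by simp
    then have "j = j'" using inj_onD[OF int_pow_inj_on[OF y(1,2)] _ jj'] by simp
    then show "p = q" using pq \<open>i = i'\<close> by simp
  qed
  have img: "?h ` carrier ?K = generate G {x, y}"
  proof
    have "subgroup (generate G {x, y}) G" by (rule generate_is_subgroup) (use y(1) in simp)
    moreover have "x \<in> generate G {x, y}" "y \<in> generate G {x, y}" by (auto intro: generate.incl)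
    ultimately show "?h ` carrier ?K \<subseteq> generate G {x, y}"
      by (auto intro!: subgroup.m_closed subgroup_int_pow_closed)
    have "x = ?h (1, 0)" "y = ?h (0, 1)" using y(1) by simp_all
    moreover have "(1, 0) \<in> carrier ?K" "(0, 1) \<in> carrier ?K" unfolding c using y(3) by auto
    ultimately have "{x, y} \<subseteq> ?h ` carrier ?K" by blast
    then show "generate G {x, y} \<subseteq> ?h ` carrier ?K"
      by (rule generate_subgroup_incl) (rule h.img_is_subgroup)
  qed
  show ?thesis by (rule is_iso_hom_image[OF K.is_group hom inj img])
qed

lemma generate_eqI:
  assumes "A \<subseteq> carrier G" "B \<subseteq> carrier G" "A \<subseteq> generate G B" "B \<subseteq> generate G A"
  shows "generate G A = generate G B"
  using assms generate_is_subgroup generate_subgroup_incl by (metis subset_antisym)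

end

definition listed_group :: "('a, 'b) monoid_scheme \<Rightarrow> bool" where
  "listed_group H \<longleftrightarrow>
     H \<cong> integer_mod_group 2 \<or>
     H \<cong> integer_mod_group 2 \<times>\<times> integer_mod_group 2 \<or>
     H \<cong> integer_mod_group 4 \<or>
     H \<cong> integer_mod_group 6 \<or>
     H \<cong> integer_mod_group 2 \<times>\<times> integer_mod_group 4 \<or>
     H \<cong> integer_mod_group 2 \<times>\<times> integer_mod_group 6 \<or>
     H \<cong> alt_group 4"

context A3_group
begin

lemma noncommuting_imp_sym_group:
  assumes x: "involution x" and z: "involution z" and nc: "x \<otimes> z \<noteq> z \<otimes> x"
  shows "G \<cong> sym_group 3"
proof -
  define r where "r = x \<otimes> z"
  have [simp]: "x \<in> carrier G" "z \<in> carrier G" "r \<in> carrier G" using x z by (simp_all add: r_def)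
  have xx: "x \<otimes> x = \<one>" "z \<otimes> z = \<one>" using x z by auto
  note cl = cancel_left_pair[OF xx(1)] cancel_left_pair[OF xx(2)]
  have rel: "S3_relations G x r"
  proof unfold_locales
    show "r \<otimes> (r \<otimes> r) = \<one>"
      using product_involutions_cube[OF x z nc] by (simp add: r_def m_assoc)
    show "r \<otimes> x = x \<otimes> (r \<otimes> r)"
      using involutions_braid[OF x z nc] by (simp add: r_def m_assoc cl)
    show "r \<noteq> \<one>" using nc one_pair_commute[of x z] by (auto simp: r_def)
  qed (use xx in simp_all)
  have "subgroup (generate G {x, r}) G" by (rule generate_is_subgroup) simp
  moreover have "x \<in> generate G {x, r}" "r \<in> generate G {x, r}" by (auto intro: generate.incl)
  moreover have "z = x \<otimes> r" by (simp add: r_def cl)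
  ultimately have "{x, z} \<subseteq> generate G {x, r}" by (auto intro: subgroup.m_closed)
  then have "generate G {x, z} \<subseteq> generate G {x, r}"
    by (rule generate_subgroup_incl) (rule generate_is_subgroup, simp)
  then have "carrier G \<subseteq> generate G {x, r}" unfolding carrier_eq_reflections[OF x z nc] .
  then have gen: "carrier G = generate G {x, r}" by (rule subset_antisym) (simp add: generate_incl)
  obtain x' r' where sym: "S3_relations (sym_group 3) x' r'"
    "carrier (sym_group 3) = generate (sym_group 3) {x', r'}"
    by (rule S3_relations_sym_group)
  show ?thesis by (rule S3_relations_is_iso[OF rel gen sym])
qed

end

context A3_commuting
begin

text \<open>A cyclic group of odd order contains no involution, and the even orders are already
  bounded.\<close>

lemma involution_in_cyclic:
  assumes x: "involution x" and w: "w \<in> carrier G" and gen: "x \<in> generate G {w}"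
  shows "generated_subgroup G {w} \<cong> integer_mod_group (ord w)" "ord w \<in> {2, 4, 6}"
proof -
  show "generated_subgroup G {w} \<cong> integer_mod_group (ord w)"
    using cyclic_subgroup_is_iso[OF w refl] ord_pos[OF w] by simp
  obtain k :: int where k: "x = w [^] k" using gen generate_pow[OF w] by auto
  have "even (ord w)"
  proof (rule ccontr)
    assume odd: "odd (ord w)"
    have "\<not> int (ord w) dvd k" using x k int_pow_eq_id[OF w] by auto
    moreover have "w [^] (k + k) = \<one>" using x k int_pow_mult[OF w, of k k] by metis
    then have "int (ord w) dvd 2 * k" unfolding mult_2 using int_pow_eq_id[OF w] by blast
    moreover have "coprime (int (ord w)) 2" using odd by simp
    ultimately show False by (metis coprime_dvd_mult_right_iff)
  qed
  then show "ord w \<in> {2, 4, 6}" using even_ord_cases w by blast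
qed

text \<open>For commuting \<open>x\<close> and \<open>y\<close> the group is cyclic if
  \<open>x\<close> is a power of \<open>y\<close>, and otherwise a direct product or again cyclic
  according to the parity of the order of \<open>y\<close>. For noncommuting ones the product of the
  conjugates of \<open>x\<close> is \<open>(x y)^3\<close>, which supplies the remaining relation of
  A4.\<close>

lemma listed_generated_subgroup:
  assumes x: "involution x" and y: "y \<in> carrier G"
  shows "listed_group (generated_subgroup G {x, y})"
  using x y
proof (cases rule: involution_element_cases)
  case commute
  have [simp]: "x \<in> carrier G" "y \<in> carrier G" using x y by auto
  have xx: "x \<otimes> x = \<one>" using x by simp
  have x_pow: "x [^] (2 * k) = \<one>" for k :: nat
    using xx nat_pow_pow[of x 2 k] by (simp add: numeral_2_eq_2)
  have cyclic: "listed_group (generated_subgroup G {x, y})"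
    if w: "w \<in> carrier G" "x \<in> generate G {w}" "y \<in> generate G {w}" "w \<in> generate G {x, y}" for w
  proof -
    have "generate G {x, y} = generate G {w}"
      by (rule generate_eqI) (use w in auto)
    then show ?thesis
      using involution_in_cyclic[OF x w(1,2)] by (auto simp: listed_group_def)
  qed
  show ?thesis
  proof (cases "x \<in> generate G {y}")
    case True
    then show ?thesis by (intro cyclic[of y]) (auto intro: generate.incl)
  next
    case notin: False
    show ?thesis
    proof (cases "even (ord y)")
      case True
      then have o: "ord y = 2 \<or> ord y = 4 \<or> ord y = 6" using commute(2) by auto
      then have "ord y > 1" by auto
      from direct_product_subgroup_is_iso[OF x y refl this commute(1) notin]
      show ?thesis using o by (auto simp: listed_group_def)
    next
      case False
      \<comment> \<open>For odd \<open>m = ord y\<close> the power \<open>(x y)^m\<close> is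
        \<open>x\<close>, so \<open>x y\<close> alone generates. The orders 1 and 3 of
        \<open>y\<close> account for the cyclic groups of order 2 and 6.\<close>
      define w where "w = x \<otimes> y"
      have w: "w \<in> carrier G" by (simp add: w_def)
      obtain k where k: "ord y = Suc (2 * k)" using False by (auto elim!: oddE)
      have "w [^] ord y = x [^] ord y \<otimes> y [^] ord y"
        using pow_mult_distrib[OF commute(1)] by (simp add: w_def)
      then have "w [^] ord y = x [^] ord y" by simp
      then have xw: "x = w [^] ord y" using x_pow[of k] by (simp add: k)
      then have "x = w [^] int (ord y)" by (simp add: int_pow_int)
      then have xg: "x \<in> generate G {w}" using generate_pow[OF w] by blast
      have sub: "subgroup (generate G {w}) G" by (rule generate_is_subgroup) (use w in simp)
      have "y = x \<otimes> w" using xx by (simp add: w_def cancel_left_pair)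
      then have "y \<in> generate G {w}"
        using xg subgroup.m_closed[OF sub] by (auto intro: generate.incl)
      moreover have "w \<in> generate G {x, y}"
        unfolding w_def by (intro generate.eng generate.incl) simp_all
      ultimately show ?thesis using cyclic w xg by blast
    qed
  qed
next
  case alternating
  have [simp]: "x \<in> carrier G" "y \<in> carrier G" using x y by auto
  let ?H = "generated_subgroup G {x, y}"
  have sub: "subgroup (generate G {x, y}) G" by (rule generate_is_subgroup) simp
  interpret H: group ?H by (rule subgroup_imp_group[OF sub])
  have mem: "x \<in> generate G {x, y}" "y \<in> generate G {x, y}" by (auto intro: generate.incl)
  have yyy: "y \<otimes> (y \<otimes> y) = \<one>" using alternating(2) by (simp add: m_assoc)
  have iy: "inv y = y \<otimes> y" using yyy by (intro inv_equality) (simp_all add: m_assoc)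
  have yg: "y \<otimes> (y \<otimes> (y \<otimes> g)) = g" if "g \<in> carrier G" for g
    using that yyy by (simp flip: m_assoc)
  have "x \<otimes> y \<otimes> (x \<otimes> y) \<otimes> (x \<otimes> y) = x \<otimes> (y \<otimes> x \<otimes> inv y) \<otimes> (inv y \<otimes> x \<otimes> y)"
    by (simp add: iy m_assoc yg)
  then have xyxyxy: "x \<otimes> y \<otimes> (x \<otimes> y) \<otimes> (x \<otimes> y) = \<one>" using alternating(3) by simp
  have rel: "A4_nontrivial_relations ?H x y"
    by unfold_locales (use mem yyy xyxyxy alternating(1) x in simp_all)
  have gen: "carrier ?H = generate ?H {x, y}"
    using generate_consistent[OF _ sub, of "{x, y}"] mem by simp
  obtain x' y' where alt: "A4_nontrivial_relations (alt_group 4) x' y'"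
    "carrier (alt_group 4) = generate (alt_group 4) {x', y'}"
    by (rule A4_relations_alt_group)
  have "?H \<cong> alt_group 4" by (rule A4_relations_is_iso[OF rel gen alt])
  then show ?thesis by (simp add: listed_group_def)
qed

end

text \<open>Each alternative is matched with one of the four spectral computations. The reflection
  triple and the case where \<open>x\<close> inverts \<open>y\<close> serve S3; the commuting cases
  and the A4 relations serve the listed groups.\<close>

lemma (in group) class_A3I:
  assumes fin: "finite (carrier G)" and even: "even (Coset.order G)"
    and inv3: "\<And>x y z. \<lbrakk>involution x; involution y; involution z; x \<noteq> y; x \<noteq> z; y \<noteq> z\<rbrakk> \<Longrightarrow>
      x \<otimes> y = y \<otimes> x \<and> x \<otimes> z = z \<otimes> x \<and> y \<otimes> z = z \<otimes> y \<or>
      z = x \<otimes> (y \<otimes> x) \<and> z = y \<otimes> (x \<otimes> y)"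
    and pair: "\<And>x y. \<lbrakk>involution x; y \<in> carrier G; y \<otimes> y \<noteq> \<one>\<rbrakk> \<Longrightarrow>
      (y \<otimes> x = x \<otimes> y \<or> y \<otimes> x = x \<otimes> inv y) \<and> (y [^] (4::nat) = \<one> \<or> y [^] (6::nat) = \<one>) \<or>
      A4_relations G x y"
  shows "class_A3 G"
  unfolding class_A3_def
proof (intro conjI allI impI is_group fin even, elim conjE)
  fix S assume S: "connection_set G S" "card S = 3"
  have sub: "S \<subseteq> carrier G" using S by (simp add: connection_set_def)
  show "integral_graph (cayley_graph G S)"
    unfolding integral_cayley_graph_iff[OF is_group fin sub]
  proof (intro allI impI)
    fix f k assume f: "\<exists>g\<in>carrier G. f g \<noteq> 0"
      and ev: "\<forall>g\<in>carrier G. neighbour_sum G S f g = k * f g"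
    show "k \<in> \<int>" using S
    proof (cases rule: connection_set_cases)
      case (involutions x y z)
      have ev': "f (x \<otimes> g) + f (y \<otimes> g) + f (z \<otimes> g) = k * f g" if "g \<in> carrier G" for g
        using ev that neighbour_sum_triple[of x y z G f g] S(2) unfolding involutions(1) by simp
      from inv3[OF involutions(2-7)] show ?thesis
      proof
        assume "x \<otimes> y = y \<otimes> x \<and> x \<otimes> z = z \<otimes> x \<and> y \<otimes> z = z \<otimes> y"
        then show ?thesis
          using eigenvalue_commuting_involutions[OF involutions(2-4) _ _ _ f ev'] by blast
      next
        assume "z = x \<otimes> (y \<otimes> x) \<and> z = y \<otimes> (x \<otimes> y)"
        then show ?thesis
          using eigenvalue_reflections[of x y z f k] involutions(2-4) f ev' by blast
      qed
    next
      case (inverse_pair x y)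
      have ev': "f (x \<otimes> g) + f (y \<otimes> g) + f (inv y \<otimes> g) = k * f g" if "g \<in> carrier G" for g
        using ev that neighbour_sum_triple[of x y "inv y" G f g] S(2) unfolding inverse_pair(1) by simp
      have y: "y \<in> carrier G" "inv y \<in> carrier G" "y \<otimes> inv y = \<one>" using inverse_pair(3) by simp_all
      have x: "x \<in> carrier G" using inverse_pair(2) by simp
      from pair[OF inverse_pair(2-4)] show ?thesis
      proof
        assume A: "(y \<otimes> x = x \<otimes> y \<or> y \<otimes> x = x \<otimes> inv y) \<and> (y [^] (4::nat) = \<one> \<or> y [^] (6::nat) = \<one>)"
        from A have "y \<otimes> x = x \<otimes> y \<or> y \<otimes> x = x \<otimes> inv y" ..
        then have "y \<otimes> x = x \<otimes> y \<and> inv y \<otimes> x = x \<otimes> inv y \<or> y \<otimes> x = x \<otimes> inv y \<and> inv y \<otimes> x = x \<otimes> y"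
        proof
          assume yx: "y \<otimes> x = x \<otimes> y"
          have "inv y \<otimes> x = inv y \<otimes> (x \<otimes> y) \<otimes> inv y" using x y by (simp add: m_assoc)
          also have "\<dots> = inv y \<otimes> (y \<otimes> x) \<otimes> inv y" using yx by simp
          also have "\<dots> = x \<otimes> inv y" using x y by (simp add: m_assoc cancel_left_pair[OF l_inv])
          finally show ?thesis using yx by simp
        next
          assume yx: "y \<otimes> x = x \<otimes> inv y"
          have "inv y \<otimes> x = inv y \<otimes> (x \<otimes> inv y) \<otimes> y" using x y by (simp add: m_assoc)
          also have "\<dots> = inv y \<otimes> (y \<otimes> x) \<otimes> y" using yx by simp
          also have "\<dots> = x \<otimes> y" using x y by (simp add: m_assoc cancel_left_pair[OF l_inv])
          finally show ?thesis using yx by simp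
        qed
        then show ?thesis
          using eigenvalue_inverse_pair[OF inverse_pair(2) y _ _ f ev'] A by blast
      next
        assume "A4_relations G x y"
        then interpret A4_relations G x y .
        have "inv y = y \<otimes> y" using yyy by (intro inv_equality) (simp_all add: m_assoc)
        then have "f (x \<otimes> g) + f (y \<otimes> g) + f (y \<otimes> (y \<otimes> g)) = k * f g" if "g \<in> carrier G" for g
          using ev'[OF that] that by (simp add: m_assoc)
        then show ?thesis by (rule eigenvalue_in_Ints[OF f])
      qed
    qed
  qed
qed

text \<open>Any three distinct involutions are all the reflections, and any other nontrivial element
  is a rotation inverted by every reflection. Both facts are decided on words.\<close>

lemma (in S3_relations) class_A3:
  assumes gen: "carrier G = generate G {x, r}"
  shows "class_A3 G"
proof -
  have bij: "bij_betw eval S3_words (carrier G)" using bij_eval[OF gen] .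
  have one: "eval (False, 0) = \<one>" "(False, 0) \<in> S3_words" by (simp_all add: S3_words_def)
  have eq: "eval m = eval n \<longleftrightarrow> m = n" if "m \<in> S3_words" "n \<in> S3_words" for m n
    using that eval_inj by (auto dest: inj_onD)
  have word: "\<exists>m\<in>S3_words. u = eval m" if "u \<in> carrier G" for u
    using that bij by (auto simp: bij_betw_def)
  have words: "S3_words = {(False, 0), (False, 1), (False, 2), (True, 0), (True, 1), (True, 2)}"
    by (auto simp: S3_words_def)
  have reflection: "\<exists>k\<in>{0, 1, 2}. u = eval (True, k)" if u: "involution u" for u
  proof -
    obtain m where m: "m \<in> S3_words" "u = eval m" using word u by blast
    have "S3_mult m m = (False, 0)" "m \<noteq> (False, 0)"
      using u m one eq[OF S3_mult_closed[OF m(1,1)] one(2)] eval_mult[OF m(1,1)] by auto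
    then show ?thesis using m unfolding words by auto
  qed
  show ?thesis
  proof (rule class_A3I)
    show fin: "finite (carrier G)" using bij by (simp add: bij_betw_finite[symmetric] S3_words_def)
    show "even (Coset.order G)" using card_generate gen by (simp add: Coset.order_def)
  next
    fix a b c assume *: "involution a" "involution b" "involution c" "a \<noteq> b" "a \<noteq> c" "b \<noteq> c"
    obtain i j k where ijk: "i \<in> {0, 1, 2}" "j \<in> {0, 1, 2}" "k \<in> {0, 1, 2}"
      "a = eval (True, i)" "b = eval (True, j)" "c = eval (True, k)"
      using reflection * by meson
    then have ne: "i \<noteq> j" "i \<noteq> k" "j \<noteq> k" using * by auto
    have w: "(True, l) \<in> S3_words" if "l \<in> {0, 1, 2}" for l using that by (simp add: S3_words_def)
    note w' = w[OF ijk(1)] w[OF ijk(2)] w[OF ijk(3)]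
    have "(True, k) = S3_mult (True, i) (S3_mult (True, j) (True, i))"
      "(True, k) = S3_mult (True, j) (S3_mult (True, i) (True, j))"
      using ijk(1-3) ne by auto
    then have "c = a \<otimes> (b \<otimes> a)" "c = b \<otimes> (a \<otimes> b)"
      unfolding ijk(4-6) using w' by (metis eval_mult S3_mult_closed)+
    then show "a \<otimes> b = b \<otimes> a \<and> a \<otimes> c = c \<otimes> a \<and> b \<otimes> c = c \<otimes> b \<or>
        c = a \<otimes> (b \<otimes> a) \<and> c = b \<otimes> (a \<otimes> b)" by blast
  next
    fix a b assume a: "involution a" and b: "b \<in> carrier G" "b \<otimes> b \<noteq> \<one>"
    obtain i where i: "i \<in> {0, 1, 2}" "a = eval (True, i)" using reflection a by blast
    obtain n where n: "n \<in> S3_words" "b = eval n" using word b by blast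
    have m: "(True, i) \<in> S3_words" using i by (simp add: S3_words_def)
    have "S3_mult n n \<noteq> (False, 0)" using b eval_mult[OF n(1,1)] n one by auto
    then have "S3_mult n (S3_mult n n) = (False, 0)" "S3_mult n (True, i) = S3_mult (True, i) (S3_mult n n)"
      using n(1) i(1) unfolding words by auto
    then have bbb: "b \<otimes> (b \<otimes> b) = \<one>" and ba: "b \<otimes> a = a \<otimes> (b \<otimes> b)"
      unfolding n(2) i(2) one(1)[symmetric] using m n(1) by (metis eval_mult S3_mult_closed)+
    have "inv b = b \<otimes> b" using bbb b by (intro inv_equality) (simp_all add: m_assoc)
    moreover have "b [^] (6::nat) = b \<otimes> (b \<otimes> b) \<otimes> (b \<otimes> (b \<otimes> b))"
      using b by (simp add: numeral_eq_Suc m_assoc)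
    ultimately show "(b \<otimes> a = a \<otimes> b \<or> b \<otimes> a = a \<otimes> inv b) \<and> (b [^] (4::nat) = \<one> \<or> b [^] (6::nat) = \<one>) \<or>
        A4_relations G a b"
      using ba bbb by simp
  qed
qed

text \<open>Involutions lie in the four-group. If \<open>v\<close> does too, everything commutes;
  otherwise \<open>v\<close> and \<open>u v\<close> both lie outside it, where all elements have
  order 3. A finite check over exponents verifies this.\<close>

lemma (in A4_nontrivial_relations) involution_cases:
  assumes gen: "carrier G = generate G {x, y}"
    and u: "involution u" and v: "v \<in> carrier G"
  shows "v \<otimes> v = \<one> \<and> u \<otimes> v = v \<otimes> u \<or>
    v \<otimes> (v \<otimes> v) = \<one> \<and> u \<otimes> v \<otimes> (u \<otimes> v) \<otimes> (u \<otimes> v) = \<one>"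
proof -
  have bij: "bij_betw eval A4_words (carrier G)" using bij_eval[OF gen] .
  have one: "eval (False, False, 0) = \<one>" "(False, False, 0) \<in> A4_words" by (simp_all add: A4_words_def)
  have word: "\<exists>m\<in>A4_words. u = eval m" if "u \<in> carrier G" for u
    using that bij by (auto simp: bij_betw_def)
  obtain m where m: "m \<in> A4_words" "u = eval m" using word u by blast
  obtain n where n: "n \<in> A4_words" "v = eval n" using word v by blast
  have "eval (A4_mult m m) = \<one>" using eval_mult[OF m(1,1)] m(2) u by simp
  then have "A4_mult m m = (False, False, 0)"
    using eval_inj A4_mult_closed[OF m(1,1)] one by (metis inj_onD)
  then obtain a b where ab: "m = (a, b, 0)"
    using m(1) by (cases m) (auto simp: A4_words_def simp del: One_nat_def)
  have words: "A4_mult n n = (False, False, 0) \<and> A4_mult m n = A4_mult n m \<or>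
      A4_mult n (A4_mult n n) = (False, False, 0) \<and>
      A4_mult (A4_mult (A4_mult m n) (A4_mult m n)) (A4_mult m n) = (False, False, 0)"
  proof -
    obtain c d l where cdl: "n = (c, d, l)" by (metis surj_pair)
    then consider "n = (c, d, 0)" | "n = (c, d, 1)" | "n = (c, d, 2)"
      using n(1) by (auto simp: A4_words_def)
    then show ?thesis
      by cases (cases a; cases b; cases c; cases d; simp add: ab)+
  qed
  have "v \<otimes> v = eval (A4_mult n n)" "u \<otimes> v = eval (A4_mult m n)" "v \<otimes> u = eval (A4_mult n m)"
    "v \<otimes> (v \<otimes> v) = eval (A4_mult n (A4_mult n n))"
    "u \<otimes> v \<otimes> (u \<otimes> v) \<otimes> (u \<otimes> v)
      = eval (A4_mult (A4_mult (A4_mult m n) (A4_mult m n)) (A4_mult m n))"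
    unfolding m(2) n(2) by (simp_all only: eval_mult A4_mult_closed m(1) n(1))
  then show ?thesis using words one(1) by (elim disjE conjE) (simp_all only: simp_thms)
qed

lemma group_hom_of_iso:
  "\<lbrakk>group G; group H; h \<in> iso G H\<rbrakk> \<Longrightarrow> group_hom G H h"
  by (simp add: group_hom_def group_hom_axioms_def iso_def)

lemma is_iso_sym_group_imp_class_A3:
  assumes "group G" "G \<cong> sym_group 3"
  shows "class_A3 G"
proof -
  obtain x r where rel: "S3_relations (sym_group 3) x r"
    and gen: "carrier (sym_group 3) = generate (sym_group 3) {x, r}"
    by (rule S3_relations_sym_group)
  interpret S: S3_relations "sym_group 3" x r by fact
  obtain h where h: "h \<in> iso (sym_group 3) G"
    using group.iso_sym[OF assms] by (auto simp: is_iso_def)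
  interpret h: group_hom "sym_group 3" G h
    by (rule group_hom_of_iso[OF S.is_group assms(1) h])
  have inj: "inj_on h (carrier (sym_group 3))" and img: "h ` carrier (sym_group 3) = carrier G"
    using h by (auto simp: iso_def bij_betw_def)
  interpret G: S3_relations G "h x" "h r"
  proof unfold_locales
    show "h x \<in> carrier G" "h r \<in> carrier G" by simp_all
    show "h x \<otimes>\<^bsub>G\<^esub> h x = \<one>\<^bsub>G\<^esub>" using S.xx by (metis h.hom_mult h.hom_one S.in_carrier(1))
    show "h r \<otimes>\<^bsub>G\<^esub> (h r \<otimes>\<^bsub>G\<^esub> h r) = \<one>\<^bsub>G\<^esub>"
      using S.rrr by (metis h.hom_mult h.hom_one S.in_carrier(2) S.m_closed)
    show "h r \<otimes>\<^bsub>G\<^esub> h x = h x \<otimes>\<^bsub>G\<^esub> (h r \<otimes>\<^bsub>G\<^esub> h r)"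
      using S.rx by (metis h.hom_mult S.in_carrier S.m_closed)
    show "h r \<noteq> \<one>\<^bsub>G\<^esub>"
      using S.nontrivial inj by (metis h.hom_one S.in_carrier(2) S.one_closed inj_onD)
  qed
  have "generate G (h ` {x, r}) = h ` generate (sym_group 3) {x, r}"
    by (rule h.generate_img) simp
  then have "carrier G = generate G {h x, h r}" using img unfolding gen by simp
  then show ?thesis by (rule G.class_A3)
qed

text \<open>Extracts from the list exactly what \<open>class_A3I\<close> consumes: the abelian
  entries have exponent dividing 4 or 6, and A4 contributes its defining relations unless
  \<open>v\<close> lies in the four-group.\<close>

lemma listed_group_imp:
  assumes H: "group H" and listed: "listed_group H"
    and u: "u \<in> carrier H" "u \<otimes>\<^bsub>H\<^esub> u = \<one>\<^bsub>H\<^esub>" "u \<noteq> \<one>\<^bsub>H\<^esub>" and v: "v \<in> carrier H"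
  shows "u \<otimes>\<^bsub>H\<^esub> v = v \<otimes>\<^bsub>H\<^esub> u \<and> (v [^]\<^bsub>H\<^esub> (4::nat) = \<one>\<^bsub>H\<^esub> \<or> v [^]\<^bsub>H\<^esub> (6::nat) = \<one>\<^bsub>H\<^esub>) \<or>
    v \<otimes>\<^bsub>H\<^esub> (v \<otimes>\<^bsub>H\<^esub> v) = \<one>\<^bsub>H\<^esub> \<and>
    u \<otimes>\<^bsub>H\<^esub> v \<otimes>\<^bsub>H\<^esub> (u \<otimes>\<^bsub>H\<^esub> v) \<otimes>\<^bsub>H\<^esub> (u \<otimes>\<^bsub>H\<^esub> v) = \<one>\<^bsub>H\<^esub>"
proof -
  interpret H: group H by fact
  \<comment> \<open>Common treatment of the abelian entries: commutation and the exponent are pulled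
    back along an injective homomorphism.\<close>
  have abelian: "u \<otimes>\<^bsub>H\<^esub> v = v \<otimes>\<^bsub>H\<^esub> u \<and> v [^]\<^bsub>H\<^esub> n = \<one>\<^bsub>H\<^esub>"
    if iso: "H \<cong> K" and K: "comm_group K"
      and pow: "\<And>k. k \<in> carrier K \<Longrightarrow> k [^]\<^bsub>K\<^esub> n = \<one>\<^bsub>K\<^esub>" for K :: "'c monoid" and n :: nat
  proof -
    interpret K: comm_group K by fact
    obtain h where h: "h \<in> iso H K" using iso by (auto simp: is_iso_def)
    interpret h: group_hom H K h by (rule group_hom_of_iso[OF H K.is_group h])
    have inj: "inj_on h (carrier H)" using h by (auto simp: iso_def bij_betw_def)
    have "h (u \<otimes>\<^bsub>H\<^esub> v) = h (v \<otimes>\<^bsub>H\<^esub> u)" using u v by (simp add: K.m_comm)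
    moreover have "h (v [^]\<^bsub>H\<^esub> n) = h \<one>\<^bsub>H\<^esub>" using v pow by (simp add: h.hom_nat_pow)
    ultimately show ?thesis using inj_onD[OF inj] u v by (metis H.m_closed H.nat_pow_closed H.one_closed)
  qed
  have Z: "k [^]\<^bsub>integer_mod_group n\<^esub> m = \<one>\<^bsub>integer_mod_group n\<^esub>" if "n dvd m" for k and n m :: nat
    using that by (auto elim!: dvdE)
  have pow_prod: "p [^]\<^bsub>A \<times>\<times> B\<^esub> m = (fst p [^]\<^bsub>A\<^esub> m, snd p [^]\<^bsub>B\<^esub> m)"
    for A :: "int monoid" and B :: "int monoid" and p and m :: nat
    by (induction m) (simp_all add: mult_DirProd' prod_eq_iff nat_pow_def)
  have prod: "comm_group (integer_mod_group a \<times>\<times> integer_mod_group b)" for a b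
  proof -
    interpret P: group "integer_mod_group a \<times>\<times> integer_mod_group b" by (intro DirProd_group) simp_all
    show ?thesis
      by (rule P.group_comm_groupI) (auto simp: add.commute)
  qed
  from listed consider
      n where "n \<in> {2, 4, 6::nat}" "H \<cong> integer_mod_group n"
    | n where "n \<in> {2, 4, 6::nat}" "H \<cong> integer_mod_group 2 \<times>\<times> integer_mod_group n"
    | "H \<cong> alt_group 4"
    unfolding listed_group_def by blast
  then show ?thesis
  proof cases
    case 1
    have "n dvd 4 \<or> n dvd 6" using 1(1) by auto
    then show ?thesis using abelian[OF 1(2)] Z by (metis abelian_integer_mod_group)
  next
    case 2
    have "n dvd 4 \<or> n dvd 6" using 2(1) by auto
    moreover have "p [^]\<^bsub>integer_mod_group 2 \<times>\<times> integer_mod_group n\<^esub> m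
        = \<one>\<^bsub>integer_mod_group 2 \<times>\<times> integer_mod_group n\<^esub>" if "n dvd m" "2 dvd m" for p and m :: nat
      using Z[OF that(1)] Z[OF that(2)] by (simp add: pow_prod del: pow_integer_mod_group)
    ultimately show ?thesis using abelian[OF 2(2) prod] by (metis even_numeral)
  next
    case 3
    obtain x y where rel: "A4_nontrivial_relations (alt_group 4) x y"
      and gen: "carrier (alt_group 4) = generate (alt_group 4) {x, y}"
      by (rule A4_relations_alt_group)
    interpret A: A4_nontrivial_relations "alt_group 4" x y by fact
    obtain h where h: "h \<in> iso (alt_group 4) H"
      using H.iso_sym[OF 3] by (auto simp: is_iso_def)
    interpret h: group_hom "alt_group 4" H h
      by (rule group_hom_of_iso[OF A.is_group H h])
    have inj: "inj_on h (carrier (alt_group 4))" and img: "h ` carrier (alt_group 4) = carrier H"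
      using h by (auto simp: iso_def bij_betw_def)
    interpret H': A4_nontrivial_relations H "h x" "h y"
    proof unfold_locales
      show "h x \<in> carrier H" "h y \<in> carrier H" by simp_all
      show "h x \<otimes>\<^bsub>H\<^esub> h x = \<one>\<^bsub>H\<^esub>" using A.xx by (metis h.hom_mult h.hom_one A.in_carrier(1))
      show "h y \<otimes>\<^bsub>H\<^esub> (h y \<otimes>\<^bsub>H\<^esub> h y) = \<one>\<^bsub>H\<^esub>"
        using A.yyy by (metis h.hom_mult h.hom_one A.in_carrier(2) A.m_closed)
      show "h x \<otimes>\<^bsub>H\<^esub> h y \<otimes>\<^bsub>H\<^esub> (h x \<otimes>\<^bsub>H\<^esub> h y) \<otimes>\<^bsub>H\<^esub> (h x \<otimes>\<^bsub>H\<^esub> h y) = \<one>\<^bsub>H\<^esub>"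
        using A.xyxyxy by (metis h.hom_mult h.hom_one A.in_carrier A.m_closed)
      show "h x \<otimes>\<^bsub>H\<^esub> h y \<noteq> h y \<otimes>\<^bsub>H\<^esub> h x"
      proof
        assume "h x \<otimes>\<^bsub>H\<^esub> h y = h y \<otimes>\<^bsub>H\<^esub> h x"
        then have "h (x \<otimes>\<^bsub>alt_group 4\<^esub> y) = h (y \<otimes>\<^bsub>alt_group 4\<^esub> x)" by simp
        then have "x \<otimes>\<^bsub>alt_group 4\<^esub> y = y \<otimes>\<^bsub>alt_group 4\<^esub> x"
          by (rule inj_onD[OF inj]) simp_all
        then show False using A.nontrivial by simp
      qed
    qed
    have "generate H (h ` {x, y}) = h ` generate (alt_group 4) {x, y}"
      by (rule h.generate_img) simp
    then have "carrier H = generate H {h x, h y}" using img unfolding gen by simp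
    note cases = H'.involution_cases[OF this _ v, of u]
    have "v [^]\<^bsub>H\<^esub> (4::nat) = v \<otimes>\<^bsub>H\<^esub> v \<otimes>\<^bsub>H\<^esub> (v \<otimes>\<^bsub>H\<^esub> v)"
      using v by (simp add: numeral_eq_Suc H.m_assoc)
    then have "v [^]\<^bsub>H\<^esub> (4::nat) = \<one>\<^bsub>H\<^esub>" if "v \<otimes>\<^bsub>H\<^esub> v = \<one>\<^bsub>H\<^esub>" using that by simp
    then show ?thesis using cases u by blast
  qed
qed

lemma (in group) listed_imp_class_A3:
  assumes fin: "finite (carrier G)" and even: "even (Coset.order G)"
    and listed: "\<And>x y. \<lbrakk>involution x; y \<in> carrier G\<rbrakk> \<Longrightarrow> listed_group (generated_subgroup G {x, y})"
  shows "class_A3 G"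
proof -
  have cases: "x \<otimes> y = y \<otimes> x \<and> (y [^] (4::nat) = \<one> \<or> y [^] (6::nat) = \<one>) \<or>
      y \<otimes> (y \<otimes> y) = \<one> \<and> x \<otimes> y \<otimes> (x \<otimes> y) \<otimes> (x \<otimes> y) = \<one>"
    if x: "involution x" and y: "y \<in> carrier G" for x y
  proof -
    let ?H = "generated_subgroup G {x, y}"
    have sub: "subgroup (generate G {x, y}) G" by (rule generate_is_subgroup) (use x y in simp)
    have "x \<in> carrier ?H" "y \<in> carrier ?H" by (auto intro: generate.incl)
    then show ?thesis
      using listed_group_imp[OF subgroup_imp_group[OF sub] listed[OF x y], of x y] x
      by (simp flip: nat_pow_consistent)
  qed
  show ?thesis
  proof (rule class_A3I[OF fin even])
    fix x y z assume *: "involution x" "involution y" "involution z"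
    \<comment> \<open>The A4 alternative would give \<open>v\<close> a trivial cube as well as a
      trivial square, hence \<open>v = \<one>\<close>.\<close>
    have "u \<otimes> v = v \<otimes> u" if "involution u" "involution v" for u v
      using cases[of u v] that by auto
    then show "x \<otimes> y = y \<otimes> x \<and> x \<otimes> z = z \<otimes> x \<and> y \<otimes> z = z \<otimes> y \<or>
        z = x \<otimes> (y \<otimes> x) \<and> z = y \<otimes> (x \<otimes> y)" using * by blast
  next
    fix x y assume x: "involution x" and y: "y \<in> carrier G"
    show "(y \<otimes> x = x \<otimes> y \<or> y \<otimes> x = x \<otimes> inv y) \<and> (y [^] (4::nat) = \<one> \<or> y [^] (6::nat) = \<one>) \<or>
        A4_relations G x y"
      using cases[OF x y] x y by (auto simp: A4_relations_def A4_relations_axioms_def is_group)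
  qed
qed

theorem theorem2p6:
  fixes G :: "('a, 'b) monoid_scheme"
  assumes "group G" and "finite (carrier G)"
  shows "class_A3 G \<longleftrightarrow>
    G \<cong> sym_group 3 \<or>
    (even (Coset.order G) \<and>
     (\<forall>x \<in> carrier G. \<forall>y \<in> carrier G. group.ord G x = 2 \<longrightarrow>
       (let H = generated_subgroup G {x, y} in
          H \<cong> integer_mod_group 2 \<or>
          H \<cong> integer_mod_group 2 \<times>\<times> integer_mod_group 2 \<or>
          H \<cong> integer_mod_group 4 \<or>
          H \<cong> integer_mod_group 6 \<or>
          H \<cong> integer_mod_group 2 \<times>\<times> integer_mod_group 4 \<or>
          H \<cong> integer_mod_group 2 \<times>\<times> integer_mod_group 6 \<or>
          H \<cong> alt_group 4)))"
  unfolding Let_def listed_group_def[symmetric]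
proof
  interpret group G by fact
  assume A3: "class_A3 G"
  interpret A3_group G by unfold_locales (rule A3)
  show "G \<cong> sym_group 3 \<or> (even (Coset.order G) \<and> (\<forall>x \<in> carrier G. \<forall>y \<in> carrier G. ord x = 2 \<longrightarrow>
      listed_group (generated_subgroup G {x, y})))"
  proof (cases "\<exists>x z. involution x \<and> involution z \<and> x \<otimes>\<^bsub>G\<^esub> z \<noteq> z \<otimes>\<^bsub>G\<^esub> x")
    case True
    then show ?thesis using noncommuting_imp_sym_group by blast
  next
    case False
    then interpret A3_commuting G by unfold_locales blast
    show ?thesis using even_order listed_generated_subgroup ord_eq_2_iff_involution by blast
  qed
next
  interpret group G by fact
  assume "G \<cong> sym_group 3 \<or> (even (Coset.order G) \<and> (\<forall>x \<in> carrier G. \<forall>y \<in> carrier G. ord x = 2 \<longrightarrow>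
      listed_group (generated_subgroup G {x, y})))"
  then show "class_A3 G"
  proof
    assume "G \<cong> sym_group 3"
    then show ?thesis by (rule is_iso_sym_group_imp_class_A3[OF assms(1)])
  next
    assume "even (Coset.order G) \<and> (\<forall>x \<in> carrier G. \<forall>y \<in> carrier G. ord x = 2 \<longrightarrow>
      listed_group (generated_subgroup G {x, y}))"
    then show ?thesis
      using listed_imp_class_A3[OF assms(2)] ord_eq_2_iff_involution by blast
  qed
qed

end
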